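(* Let $A$ be a commutative ring with $1$ and let $f\in A[X]$ be a strict real zero polynomial of degree $n$. Then there exist an integer $r\le (2p(A)+1)n$ and a symmetric matrix $M\in\operatorname{Sym}_r(A)$ such that $f$ divides the characteristic polynomial $\det(X\cdot \mathrm{I}_r-M)$ in $A[X]$.
   Context: $\operatorname{Sym}_r(A)$ is the set of symmetric $r\times r$ matrices with entries in $A$. $\Sigma A^2$ denotes the set of finite sums $a_1^2+\dots+a_k^2$ with $a_i\in A$. The Pythagoras number $p(A)$ is the smallest integer $q$ such that every element of $\Sigma A^2$ is a sum of $q$ squares of elements of $A$; if no such integer exists, $p(A)=\infty$ (and then the bound on $r$ is vacuous). A monic polynomial $f\in A[X]$ is a real zero polynomial if for every ring homomorphism $\varphi:A\to R$ into a real closed field $R$, the image of $f$ in $R[X]$ has all its zeros (in the algebraic closure of $R$) in $R$; it is a strict real zero polynomial if moreover, for every such $\varphi$, all these zeros are simple. *)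

theory Defs
  imports "Jordan_Normal_Form.Char_Poly" "Jordan_Normal_Form.VS_Connect"
    "HOL-Algebra.Polynomial_Divisibility" "HOL-Library.Extended_Nat"
begin

definition sum_sq :: "'a::comm_ring_1 list \<Rightarrow> 'a" where
  "sum_sq xs = sum_list (map (\<lambda>x. x * x) xs)"

definition sos_set :: "'a::comm_ring_1 set" where
  "sos_set = {sum_sq xs | xs. True}"

text \<open>Pythagoras number: the least q such that every sum of squares is a sum of
  q squares; infinity if no such q exists (Inf of the empty set of enat).\<close>
definition pythagoras_number :: "'a::comm_ring_1 itself \<Rightarrow> enat" where
  "pythagoras_number (_::'a itself) =
     Inf {enat q | q. \<forall>x \<in> (sos_set :: 'a set). \<exists>xs. length xs = q \<and> x = sum_sq xs}"

text \<open>Artin--Schreier characterisation: a field in which -1 is not a sum of squares,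
  every element is a square or minus a square, and every polynomial of odd degree
  has a root.\<close>
definition real_closed_field :: "('b, 'c) ring_scheme \<Rightarrow> bool" where
  "real_closed_field R \<longleftrightarrow>
     field R \<and>
     (\<forall>xs. set xs \<subseteq> carrier R \<longrightarrow>
        foldr (\<lambda>x s. x \<otimes>\<^bsub>R\<^esub> x \<oplus>\<^bsub>R\<^esub> s) xs \<zero>\<^bsub>R\<^esub> \<noteq> \<ominus>\<^bsub>R\<^esub> \<one>\<^bsub>R\<^esub>) \<and>
     (\<forall>a \<in> carrier R. \<exists>b \<in> carrier R. a = b \<otimes>\<^bsub>R\<^esub> b \<or> \<ominus>\<^bsub>R\<^esub> a = b \<otimes>\<^bsub>R\<^esub> b) \<and>
     (\<forall>p \<in> carrier (poly_ring R). odd (Polynomials.degree p) \<longrightarrow>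
        (\<exists>x. ring.is_root R p x))"

text \<open>Image of a polynomial over the type-class ring under a map phi, as a
  HOL-Algebra polynomial (coefficient list, leading coefficient first).\<close>
definition poly_image :: "('a::comm_ring_1 \<Rightarrow> 'b) \<Rightarrow> 'a poly \<Rightarrow> 'b list" where
  "poly_image \<phi> f = map \<phi> (rev (coeffs f))"

text \<open>All zeros of the image in R (in an algebraic closure) lie in R:
  the image splits over R.  Strict: moreover all of them are simple.\<close>
definition real_zeros_in :: "('b, 'c) ring_scheme \<Rightarrow> 'b list \<Rightarrow> bool" where
  "real_zeros_in R p \<longleftrightarrow> ring.splitted R p"

definition strict_real_zeros_in :: "('b, 'c) ring_scheme \<Rightarrow> 'b list \<Rightarrow> bool" where
  "strict_real_zeros_in R p \<longleftrightarrow> ring.splitted R p \<and> (\<forall>x. count (ring.roots R p) x \<le> 1)"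

definition real_zero_poly :: "'a::comm_ring_1 poly \<Rightarrow> bool" where
  "real_zero_poly f \<longleftrightarrow> monic f \<and>
     (\<forall>(R :: 'a list ring) \<phi>. real_closed_field R \<longrightarrow> \<phi> \<in> ring_hom class_ring R \<longrightarrow>
        real_zeros_in R (poly_image \<phi> f))"

definition strict_real_zero_poly :: "'a::comm_ring_1 poly \<Rightarrow> bool" where
  "strict_real_zero_poly f \<longleftrightarrow> monic f \<and>
     (\<forall>(R :: 'a list ring) \<phi>. real_closed_field R \<longrightarrow> \<phi> \<in> ring_hom class_ring R \<longrightarrow>
        strict_real_zeros_in R (poly_image \<phi> f))"

end

theory Submission
  imports Defs "HOL-Algebra.Algebraic_Closure"
begin

text \<open>Let \<open>H = (s\<^sub>i\<^sub>+\<^sub>j)\<close> be the Hankel matrix of the power sums of the zeros of \<open>f\<close>, computed from the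
  coefficients by Newton's identities. At a real closed point of \<open>A\<close> the form \<open>u\<^sup>T H u\<close> is
  \<open>\<Sum>\<^sub>k (\<Sum>\<^sub>i u\<^sub>i x\<^sub>k\<^sup>i)\<^sup>2\<close> with \<open>n\<close> distinct \<open>x\<^sub>k\<close>, so \<open>H\<close> is positive definite at every prime cone. The
  Positivstellensatz turns this into an identity \<open>c H = I + V\<^sup>T V\<close> over \<open>A\<close>; diagonalising a multiple of
  \<open>H\<close> by congruence keeps the number of rows of \<open>V\<close> down to \<open>2 p(A) n\<close>. Since \<open>H C\<close> is symmetric for the
  companion matrix \<open>C\<close> of \<open>f\<close>, the endomorphism \<open>C\<close> of the column space of \<open>(I, V)\<close> extends to a symmetric
  matrix.\<close>

text \<open>\<open>strict_real_zero_poly\<close> tests only real closed fields whose elements are of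
  type \<open>'a list\<close>. The real closure attached to a prime cone must therefore live on that
  type: it is cut out of an algebraic closure of the residue field whose elements are coded by lists
  over \<open>'a\<close>.

  Nothing in \<open>A\<close> can be assumed invertible or cancellable. Denominators are replaced by
  cofactors \<open>1 + s\<close> with \<open>s\<close> a sum of squares, a class closed under
  multiplication, and divisibility by \<open>f\<close> comes from an adjugate matrix, not from
  eigenvalues.

  The Positivstellensatz gives no control over the number of squares, whereas a diagonalised form in
  \<open>n\<close> variables needs only \<open>n\<close> coefficients, each costing
  \<open>p(A)\<close> squares. To leave exactly \<open>I\<close> behind, the form diagonalised is
  \<open>L = 2 (1 + s) H - I\<close>. If \<open>(1 + d) L\<close> is a combination of
  \<open>n\<close> squares, then \<open>2 (1 + s) (1 + d) H = I + d I + (1 + d) L\<close>. The last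
  two terms take \<open>p(A) n\<close> rows each and \<open>I\<close> takes \<open>n\<close>, whence
  the bound \<open>(2 p(A) + 1) n\<close>.\<close>

section \<open>Sums of squares in a commutative ring\<close>

lemma sum_sq_simps [simp]:
  "sum_sq [] = 0" "sum_sq (x # xs) = x * x + sum_sq xs"
  "sum_sq (xs @ ys) = sum_sq xs + sum_sq ys"
  by (auto simp: sum_sq_def)

lemma sum_sq_map_mult: "sum_sq (map ((*) c) xs) = c * c * sum_sq xs"
  by (induction xs) (auto simp: algebra_simps)

lemma sos_sum_sq [simp, intro]: "sum_sq xs \<in> sos_set"
  by (auto simp: sos_set_def)

lemma sos_0 [simp, intro]: "0 \<in> sos_set"
  using sos_sum_sq[of "[]"] by simp

lemma sos_square [simp, intro]: "a * a \<in> sos_set"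
  using sos_sum_sq[of "[a]"] by simp

lemma sos_1 [simp, intro]: "1 \<in> sos_set"
  using sos_square[of 1] by simp

lemma sos_add [intro]: "a \<in> sos_set \<Longrightarrow> b \<in> sos_set \<Longrightarrow> a + b \<in> sos_set"
  unfolding sos_set_def by (clarsimp, metis sum_sq_simps(3))

lemma sos_mult [intro]:
  assumes "a \<in> sos_set" "b \<in> sos_set" shows "a * b \<in> sos_set"
proof -
  obtain xs where xs: "a = sum_sq xs" using assms by (auto simp: sos_set_def)
  have "sum_sq xs * b \<in> sos_set"
  proof (induction xs)
    case (Cons x xs)
    obtain ys where ys: "b = sum_sq ys" using assms by (auto simp: sos_set_def)
    have "x * x * b = sum_sq (map ((*) x) ys)" by (simp add: ys sum_sq_map_mult)
    then show ?case using Cons by (simp add: distrib_right sos_add del: sum_sq_map_mult)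
  qed simp
  then show ?thesis by (simp add: xs)
qed

lemma sos_numeral [simp, intro]: "numeral k \<in> sos_set"
proof -
  have "of_nat m \<in> sos_set" for m by (induction m) auto
  from this[of "numeral k"] show ?thesis by simp
qed

lemma one_plus_sos_mult:
  assumes "a \<in> sos_set" "b \<in> sos_set"
  shows "\<exists>c\<in>sos_set. (1 + a) * (1 + b) = 1 + c"
  by (rule bexI[of _ "a + b + a * b"]) (use assms in \<open>auto simp: algebra_simps\<close>)

section \<open>Orderings of a commutative ring\<close>

definition preordering :: "'a::comm_ring_1 set \<Rightarrow> bool" where
  "preordering P \<longleftrightarrow> (\<forall>a\<in>P. \<forall>b\<in>P. a + b \<in> P \<and> a * b \<in> P) \<and> (\<forall>a. a * a \<in> P) \<and> - 1 \<notin> P"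

definition supp :: "'a::comm_ring_1 set \<Rightarrow> 'a set" where
  "supp P = {a. a \<in> P \<and> - a \<in> P}"

text \<open>These are the points of the real spectrum: \<open>supp P\<close> is a prime ideal, and
  \<open>P\<close> induces an ordering of its residue field.\<close>

definition prime_cone :: "'a::comm_ring_1 set \<Rightarrow> bool" where
  "prime_cone P \<longleftrightarrow> preordering P \<and> (\<forall>a. a \<in> P \<or> - a \<in> P) \<and>
     (\<forall>a b. a * b \<in> supp P \<longrightarrow> a \<in> supp P \<or> b \<in> supp P)"

lemma preorderingD:
  assumes "preordering P"
  shows "a \<in> P \<Longrightarrow> b \<in> P \<Longrightarrow> a + b \<in> P" "a \<in> P \<Longrightarrow> b \<in> P \<Longrightarrow> a * b \<in> P"
    "a * a \<in> P" "- 1 \<notin> P" "0 \<in> P" "1 \<in> P"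
  using assms by (auto simp: preordering_def) (metis mult_zero_left, metis mult_1)

text \<open>The set \<open>P + a P\<close> is closed under sums and products because
  \<open>a * a\<close> lies in \<open>P\<close>. It contains \<open>P\<close> and \<open>a\<close>,
  so by maximality it can only fail to be a preordering by containing \<open>- 1\<close>.\<close>

lemma preordering_adjoin:
  assumes P: "preordering P" and max: "\<And>Q. preordering Q \<Longrightarrow> P \<subseteq> Q \<Longrightarrow> Q = P" and a: "a \<notin> P"
  shows "\<exists>p\<in>P. \<exists>q\<in>P. - 1 = p + a * q"
proof (rule ccontr)
  assume neg: "\<not> ?thesis"
  let ?Q = "{p + a * q | p q. p \<in> P \<and> q \<in> P}"
  note D = preorderingD[OF P]
  have sub: "P \<subseteq> ?Q"
  proof
    fix x assume "x \<in> P"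
    moreover have "x = x + a * 0" by simp
    ultimately show "x \<in> ?Q" using D(5) by blast
  qed
  have "preordering ?Q"
    unfolding preordering_def
  proof (intro conjI ballI allI)
    fix x y assume "x \<in> ?Q" "y \<in> ?Q"
    then obtain p q r s where *: "x = p + a * q" "y = r + a * s" "p \<in> P" "q \<in> P" "r \<in> P" "s \<in> P"
      by auto
    have "x + y = (p + r) + a * (q + s)" by (simp add: * algebra_simps)
    then show "x + y \<in> ?Q" using * D by blast
    have "x * y = (p * r + a * a * (q * s)) + a * (p * s + q * r)" by (simp add: * algebra_simps)
    moreover have "p * r + a * a * (q * s) \<in> P" "p * s + q * r \<in> P"
      using *(3-) by (simp_all add: D)
    ultimately show "x * y \<in> ?Q" by blast
  next
    show "- 1 \<notin> ?Q" using neg by auto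
  qed (use sub D(3) in auto)
  then have "?Q = P" using max sub by blast
  moreover have "0 + a * 1 \<in> ?Q" using D(5,6) by blast
  ultimately show False using a by simp
qed

lemma maximal_preordering_prime_cone:
  assumes P: "preordering P" and max: "\<And>Q. preordering Q \<Longrightarrow> P \<subseteq> Q \<Longrightarrow> Q = P"
  shows "prime_cone P"
proof -
  note D = preorderingD[OF P]
  \<comment> \<open>Multiplying \<open>a q = - (1 + p)\<close> by \<open>b s = - (1 + r)\<close>
    gives \<open>- 1 = p + r + p r - a b q s\<close>. Totality is the case \<open>b = - a\<close>,
    where \<open>- (a * b)\<close> is a square.\<close>
  have contra: False if *: "-1 = p + a * q" "-1 = r + b * s" "- (a * b) \<in> P"
    "p \<in> P" "q \<in> P" "r \<in> P" "s \<in> P" for a b p q r s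
  proof -
    have "a * q = - (1 + p)" "b * s = - (1 + r)" using *(1,2) by (auto simp: algebra_simps)
    then have "(a * q) * (b * s) = (- (1 + p)) * (- (1 + r))" by metis
    then have "(a * q) * (b * s) = (1 + p) * (1 + r)" by (simp only: minus_mult_minus)
    then have "-1 = p + r + p * r + (- (a * b)) * (q * s)" by (simp add: algebra_simps)
    also have "\<dots> \<in> P" using *(3-) by (intro D(1,2))
    finally show False using D by simp
  qed
  have "a \<in> P \<or> - a \<in> P" for a
  proof (rule ccontr)
    assume "\<not> ?thesis"
    then obtain p q r s where *: "-1 = p + a * q" "-1 = r + (- a) * s" "p \<in> P" "q \<in> P" "r \<in> P" "s \<in> P"
      using preordering_adjoin[OF assms] by metis
    show False using contra[OF *(1,2) _ *(3-)] D(3)[of a] by simp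
  qed
  moreover have "a \<in> supp P \<or> b \<in> supp P" if ab: "a * b \<in> supp P" for a b
  proof (rule ccontr)
    assume neg: "\<not> ?thesis"
    \<comment> \<open>Outside the support, \<open>x\<close> or \<open>- x\<close> lies outside
      \<open>P\<close>. The choice of signs is harmless, since \<open>supp P\<close> contains
      \<open>a * b\<close> together with its negative.\<close>
    have ex: "\<exists>x'\<in>{x, -x}. \<exists>p\<in>P. \<exists>q\<in>P. - 1 = p + x' * q" if "x \<notin> supp P" for x
      using that preordering_adjoin[OF assms] unfolding supp_def by blast
    obtain a' p q where 1: "a' \<in> {a, -a}" "p \<in> P" "q \<in> P" "- 1 = p + a' * q"
      using ex[of a] neg by blast
    obtain b' r s where 2: "b' \<in> {b, -b}" "r \<in> P" "s \<in> P" "- 1 = r + b' * s"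
      using ex[of b] neg by blast
    have "- (a' * b') \<in> P" using ab 1(1) 2(1) by (auto simp: supp_def)
    from contra[OF 1(4) 2(4) this 1(2,3) 2(2,3)] show False .
  qed
  ultimately show ?thesis using P by (simp add: prime_cone_def)
qed

lemma prime_cone_extension:
  assumes "preordering T"
  shows "\<exists>P. prime_cone P \<and> T \<subseteq> P"
proof -
  define F where "F = {P. preordering P \<and> T \<subseteq> P}"
  have "\<exists>M\<in>F. \<forall>U\<in>F. M \<subseteq> U \<longrightarrow> U = M"
  proof (rule subset_Zorn_nonempty)
    show "F \<noteq> {}" using assms by (auto simp: F_def)
    fix C assume C: "C \<noteq> {}" "subset.chain F C"
    then have pre: "preordering P" "T \<subseteq> P" if "P \<in> C" for P
      using that by (auto simp: subset.chain_def F_def)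
    have "preordering (\<Union>C)"
      unfolding preordering_def
    proof (intro conjI ballI allI)
      fix a b assume "a \<in> \<Union>C" "b \<in> \<Union>C"
      then obtain U V where "U \<in> C" "V \<in> C" "a \<in> U" "b \<in> V" by auto
      moreover then have "U \<subseteq> V \<or> V \<subseteq> U" using C by (auto simp: subset.chain_def)
      ultimately obtain Z where Z: "Z \<in> C" "a \<in> Z" "b \<in> Z" by blast
      then show "a + b \<in> \<Union>C" "a * b \<in> \<Union>C" using preorderingD[OF pre(1)[OF Z(1)]] by blast+
    next
      fix a show "a * a \<in> \<Union>C" using C(1) pre(1) preorderingD(3) by blast
    next
      show "- 1 \<notin> \<Union>C" using pre(1) preorderingD(4) by blast
    qed
    then show "\<Union>C \<in> F" using C(1) pre by (auto simp: F_def)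
  qed
  then obtain M where M: "preordering M" "T \<subseteq> M" "\<And>U. preordering U \<Longrightarrow> M \<subseteq> U \<Longrightarrow> U = M"
    by (auto simp: F_def)
  then show ?thesis using maximal_preordering_prime_cone by blast
qed

text \<open>If no identity exists, the elements \<open>s - h t\<close> with sums of squares
  \<open>s\<close>, \<open>t\<close> never reach \<open>- 1\<close>. They form a preordering
  containing \<open>- h\<close>, and a prime cone above it contradicts the assumption.\<close>

lemma positivstellensatz:
  fixes h :: "'a::comm_ring_1"
  assumes "\<And>P. prime_cone P \<Longrightarrow> - h \<notin> P"
  shows "\<exists>s\<in>sos_set. \<exists>t\<in>sos_set. s * h = 1 + t"
proof (rule ccontr)
  assume neg: "\<not> ?thesis"
  define T where "T = {s - h * t | s t. s \<in> sos_set \<and> t \<in> sos_set}"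
  have "preordering T"
    unfolding preordering_def
  proof (intro conjI ballI allI)
    fix x y assume "x \<in> T" "y \<in> T"
    then obtain p q r s where *: "x = p - h * q" "y = r - h * s"
      "p \<in> sos_set" "q \<in> sos_set" "r \<in> sos_set" "s \<in> sos_set"
      by (auto simp: T_def)
    have "x + y = (p + r) - h * (q + s)" by (simp add: * algebra_simps)
    then show "x + y \<in> T" using * unfolding T_def by blast
    have "x * y = (p * r + h * h * (q * s)) - h * (p * s + q * r)" by (simp add: * algebra_simps)
    moreover have "p * r + h * h * (q * s) \<in> sos_set" "p * s + q * r \<in> sos_set"
      using * by auto
    ultimately show "x * y \<in> T" unfolding T_def by blast
  next
    fix a
    have "a * a = a * a - h * 0" by simp
    then show "a * a \<in> T" unfolding T_def by blast
  next
    show "- 1 \<notin> T"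
    proof
      assume "- 1 \<in> T"
      then obtain s t where "s \<in> sos_set" "t \<in> sos_set" "- 1 = s - h * t" by (auto simp: T_def)
      then have "t * h = 1 + s" by (simp add: algebra_simps)
      then show False using neg \<open>s \<in> _\<close> \<open>t \<in> _\<close> by blast
    qed
  qed
  then obtain P where P: "prime_cone P" "T \<subseteq> P" using prime_cone_extension by blast
  have "- h = 0 - h * 1" by simp
  then have "- h \<in> T" unfolding T_def by blast
  then show False using P assms by blast
qed

section \<open>Sums of squares of linear forms\<close>

definition gram :: "(nat \<Rightarrow> 'a::comm_ring_1) list \<Rightarrow> nat \<Rightarrow> nat \<Rightarrow> 'a" where
  "gram ls i j = (\<Sum>l\<leftarrow>ls. l i * l j)"

definition gram_cone :: "nat \<Rightarrow> (nat \<Rightarrow> nat \<Rightarrow> 'a::comm_ring_1) set" where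
  "gram_cone n = {K. \<exists>ls. \<forall>i<n. \<forall>j<n. K i j = gram ls i j}"

definition unit_mat :: "nat \<Rightarrow> nat \<Rightarrow> 'a::comm_ring_1" where
  "unit_mat i j = (if i = j then 1 else 0)"

text \<open>A division-free way of saying that \<open>K\<close> is bounded below by
  \<open>I / (1 + s)\<close>, with the difference witnessed by squares of linear forms.\<close>

definition certified_pos :: "nat \<Rightarrow> (nat \<Rightarrow> nat \<Rightarrow> 'a::comm_ring_1) \<Rightarrow> bool" where
  "certified_pos n K \<longleftrightarrow>
     (\<exists>s\<in>sos_set. (\<lambda>i j. (1 + s) * K i j - unit_mat i j) \<in> gram_cone n)"

lemma gram_simps [simp]:
  "gram [] i j = 0" "gram (l # ls) i j = l i * l j + gram ls i j"
  "gram (ls @ ls') i j = gram ls i j + gram ls' i j"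
  by (auto simp: gram_def)

lemma gram_coneI: "(\<And>i j. i < n \<Longrightarrow> j < n \<Longrightarrow> K i j = gram ls i j) \<Longrightarrow> K \<in> gram_cone n"
  unfolding gram_cone_def by auto

lemma gram_cone_cong:
  "(\<And>i j. i < n \<Longrightarrow> j < n \<Longrightarrow> K i j = L i j) \<Longrightarrow> K \<in> gram_cone n \<longleftrightarrow> L \<in> gram_cone n"
  unfolding gram_cone_def by auto

lemma gram_cone_0: "(\<lambda>i j. 0) \<in> gram_cone n"
  by (rule gram_coneI[of _ _ "[]"]) simp

lemma gram_cone_add:
  assumes "K \<in> gram_cone n" "L \<in> gram_cone n"
  shows "(\<lambda>i j. K i j + L i j) \<in> gram_cone n"
proof -
  obtain ks ls where "\<forall>i<n. \<forall>j<n. K i j = gram ks i j" "\<forall>i<n. \<forall>j<n. L i j = gram ls i j"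
    using assms by (auto simp: gram_cone_def)
  then show ?thesis by (intro gram_coneI[of _ _ "ks @ ls"]) simp
qed

lemma gram_cone_sum:
  assumes "\<And>t. t \<in> I \<Longrightarrow> K t \<in> gram_cone n"
  shows "(\<lambda>i j. \<Sum>t\<in>I. K t i j) \<in> gram_cone n"
proof (cases "finite I")
  case True
  then show ?thesis using assms
    by (induction I) (auto intro: gram_cone_0 gram_cone_add)
qed (simp add: gram_cone_0)

lemma gram_cone_rank_one: "(\<lambda>i j. v i * v j) \<in> gram_cone n"
  by (rule gram_coneI[of _ _ "[v]"]) simp

lemma gram_map_scale: "gram (map (\<lambda>l i. c * l i) ls) i j = c * c * gram ls i j"
  by (induction ls) (auto simp: algebra_simps)

lemma gram_cone_scale:
  assumes "s \<in> sos_set" "K \<in> gram_cone n"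
  shows "(\<lambda>i j. s * K i j) \<in> gram_cone n"
proof -
  obtain xs where s: "s = sum_sq xs" using assms by (auto simp: sos_set_def)
  obtain ls where ls: "\<forall>i<n. \<forall>j<n. K i j = gram ls i j"
    using assms by (auto simp: gram_cone_def)
  have "(\<lambda>i j. sum_sq xs * K i j) \<in> gram_cone n"
  proof (induction xs)
    case (Cons x xs)
    have "(\<lambda>i j. x * x * K i j) \<in> gram_cone n"
      by (rule gram_coneI[of _ _ "map (\<lambda>l i. x * l i) ls"]) (use ls in \<open>simp add: gram_map_scale\<close>)
    from gram_cone_add[OF this Cons] show ?case by (simp add: algebra_simps)
  qed (simp add: gram_cone_0)
  then show ?thesis by (simp add: s)
qed

lemma unit_mat_eq_sum: "i < n \<Longrightarrow> unit_mat i j = (\<Sum>t<n. unit_mat t i * unit_mat t j)"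
  by (simp add: unit_mat_def if_distrib[of "\<lambda>x. x * _"] cong: if_cong)

lemma unit_mat_gram_cone: "unit_mat \<in> gram_cone n"
proof -
  have "(\<lambda>i j. \<Sum>t<n. unit_mat t i * unit_mat t j) \<in> gram_cone n"
    by (intro gram_cone_sum gram_cone_rank_one)
  then show ?thesis using unit_mat_eq_sum by (subst gram_cone_cong) auto
qed

section \<open>Schur complements without division\<close>

definition schur :: "(nat \<Rightarrow> nat \<Rightarrow> 'a::comm_ring_1) \<Rightarrow> nat \<Rightarrow> nat \<Rightarrow> 'a" where
  "schur K i j = K 0 0 * K (Suc i) (Suc j) - K 0 (Suc i) * K 0 (Suc j)"

definition shift :: "(nat \<Rightarrow> nat \<Rightarrow> 'a::comm_ring_1) \<Rightarrow> nat \<Rightarrow> nat \<Rightarrow> 'a" where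
  "shift K i j = (case i of 0 \<Rightarrow> 0 | Suc i' \<Rightarrow> (case j of 0 \<Rightarrow> 0 | Suc j' \<Rightarrow> K i' j'))"

lemma shift_simps [simp]:
  "shift K 0 j = 0" "shift K i 0 = 0" "shift K (Suc i) (Suc j) = K i j"
  by (auto simp: shift_def split: nat.split)

lemma schur_sym: "(\<And>i j. K i j = K j i) \<Longrightarrow> schur K i j = schur K j i"
  by (simp add: schur_def mult.commute)

lemma schur_decomp:
  assumes "\<And>i j. K i j = K j i"
  shows "K 0 0 * K i j = K 0 i * K 0 j + shift (schur K) i j"
proof (cases i)
  case 0
  then show ?thesis by simp
next
  case (Suc i')
  then show ?thesis using assms[of i 0] by (cases j) (simp_all add: schur_def)
qed

lemma gram_cone_shift:
  assumes "K \<in> gram_cone n"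
  shows "shift K \<in> gram_cone (Suc n)"
proof -
  obtain ls where ls: "\<forall>i<n. \<forall>j<n. K i j = gram ls i j"
    using assms by (auto simp: gram_cone_def)
  have *: "gram (map (\<lambda>l. case_nat 0 l) ls) i j = shift (gram ls) i j" for i j
    by (induction ls) (auto simp: shift_def split: nat.splits)
  show ?thesis
    by (rule gram_coneI[of _ _ "map (\<lambda>l. case_nat 0 l) ls"])
      (use ls in \<open>auto simp: * shift_def split: nat.splits\<close>)
qed

lemma gram_diag_sos: "gram ls i i \<in> sos_set"
  by (induction ls) auto

lemma certified_posE:
  assumes "certified_pos n K"
  obtains s ls where "s \<in> sos_set"
    "\<And>i j. i < n \<Longrightarrow> j < n \<Longrightarrow> gram ls i j = (1 + s) * K i j - unit_mat i j"
proof -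
  obtain s ls where "s \<in> sos_set" "\<forall>i<n. \<forall>j<n. (1 + s) * K i j - unit_mat i j = gram ls i j"
    using assms unfolding certified_pos_def gram_cone_def by blast
  then show thesis by (intro that[of s ls]) auto
qed

lemma certified_pos_corner:
  assumes "certified_pos (Suc n) K"
  shows "\<exists>s\<in>sos_set. \<exists>t\<in>sos_set. (1 + s) * K 0 0 = 1 + t"
proof -
  obtain s ls where s: "s \<in> sos_set"
    "\<And>i j. i < Suc n \<Longrightarrow> j < Suc n \<Longrightarrow> gram ls i j = (1 + s) * K i j - unit_mat i j"
    using certified_posE[OF assms] by blast
  have "(1 + s) * K 0 0 = 1 + gram ls 0 0" using s(2)[of 0 0] by (simp add: unit_mat_def)
  then show ?thesis using s(1) gram_diag_sos by blast
qed

text \<open>The Schur complement is, up to the factor \<open>K 0 0\<close>, the form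
  \<open>K\<close> on the complement orthogonal to the first basis vector, so a lower bound for
  \<open>K\<close> restricts to one for it.\<close>

lemma certified_pos_schur:
  fixes K :: "nat \<Rightarrow> nat \<Rightarrow> 'a::comm_ring_1"
  assumes "certified_pos (Suc n) K" and sym: "\<And>i j. K i j = K j i"
  shows "certified_pos n (schur K)"
proof -
  obtain s ls where s: "s \<in> sos_set"
    and g: "\<And>i j. i < Suc n \<Longrightarrow> j < Suc n \<Longrightarrow> gram ls i j = (1 + s) * K i j - unit_mat i j"
    using certified_posE[OF assms(1)] by blast
  define S h v t where "S = 1 + s" and "h = K 0 0" and "v = (\<lambda>i. K 0 (Suc i))" and "t = gram ls 0 0"
  have t: "t \<in> sos_set" unfolding t_def by (rule gram_diag_sos)
  have Sh: "S * h = 1 + t" using g[of 0 0] by (simp add: unit_mat_def S_def h_def t_def)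
  have S: "S \<in> sos_set" using s by (auto simp: S_def)
  \<comment> \<open>These are the forms \<open>l\<close> evaluated at the vectors
    \<open>(- \<Sum> v i y i, h y)\<close>, which are exactly of the shape that the first row of
    \<open>K\<close> annihilates.\<close>
  define ls' where "ls' = map (\<lambda>l i. h * l (Suc i) - v i * l 0) ls"
  have g': "gram ls' i j = v i * v j * gram ls 0 0 - h * v i * gram ls 0 (Suc j)
      - h * v j * gram ls (Suc i) 0 + h * h * gram ls (Suc i) (Suc j)" for i j
    unfolding ls'_def by (induction ls) (auto simp: algebra_simps)
  have main: "gram ls' i j = S * h * schur K i j - v i * v j - h * h * unit_mat i j"
    if "i < n" "j < n" for i j
    using that by (simp add: g' g unit_mat_def schur_def v_def h_def sym[of "Suc i" 0] flip: S_def)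
      (simp add: algebra_simps)
  obtain s' where s': "s' \<in> sos_set" "(1 + s) * ((1 + s) * (1 + t)) = 1 + s'"
    using one_plus_sos_mult[OF s t] one_plus_sos_mult[OF s] by fastforce
  \<comment> \<open>Multiplying \<open>main\<close> by \<open>S * S\<close> turns its term
    \<open>h * h * unit_mat\<close> into \<open>(1 + t)^2 * unit_mat\<close>. The leading 1 cancels
    the identity matrix and \<open>2 t + t^2\<close> remains.\<close>
  have eq: "(1 + s') * schur K i j - unit_mat i j =
      S * S * gram ls' i j + S * S * (v i * v j) + (2 * t + t * t) * unit_mat i j"
    if "i < n" "j < n" for i j
  proof -
    have "1 + s' = S * S * (S * h)" using s'(2) unfolding Sh by (simp add: S_def mult.assoc)
    then have "(1 + s') * schur K i j - unit_mat i j =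
       S * S * gram ls' i j + S * S * (v i * v j) + (S * h) * (S * h) * unit_mat i j - unit_mat i j"
      by (simp only: mult.assoc main[OF that]) (simp add: algebra_simps)
    then show ?thesis unfolding Sh by (simp add: algebra_simps)
  qed
  have "(\<lambda>i j. S * S * gram ls' i j + S * S * (v i * v j) + (2 * t + t * t) * unit_mat i j) \<in> gram_cone n"
    using S t by (intro gram_cone_add gram_cone_scale unit_mat_gram_cone gram_cone_rank_one
      gram_coneI[of _ _ ls']) auto
  then have "(\<lambda>i j. (1 + s') * schur K i j - unit_mat i j) \<in> gram_cone n"
    by (subst gram_cone_cong[OF eq])
  then show ?thesis using s' by (auto simp: certified_pos_def)
qed

text \<open>By \<open>schur_decomp\<close>, each elimination step splits off a single weighted
  square, that of the first row. Hence \<open>n\<close> weighted squares suffice, however many forms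
  the certificate uses.\<close>

lemma certified_pos_diagonalise:
  fixes K :: "nat \<Rightarrow> nat \<Rightarrow> 'a::comm_ring_1"
  assumes "certified_pos n K" "\<And>i j. K i j = K j i"
  shows "\<exists>d\<in>sos_set. \<exists>\<alpha> c. (\<forall>t<n. \<alpha> t \<in> sos_set) \<and>
    (\<forall>i<n. \<forall>j<n. (1 + d) * K i j = (\<Sum>t<n. \<alpha> t * (c t i * c t j)))"
  using assms
proof (induction n arbitrary: K)
  case 0
  show ?case by (rule bexI[of _ 0]) auto
next
  case (Suc n)
  obtain s t where st: "s \<in> sos_set" "t \<in> sos_set" "(1 + s) * K 0 0 = 1 + t"
    using certified_pos_corner[OF Suc.prems(1)] by blast
  obtain d \<alpha> c where d: "d \<in> sos_set" "\<forall>t<n. \<alpha> t \<in> sos_set"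
    "\<And>i j. i < n \<Longrightarrow> j < n \<Longrightarrow> (1 + d) * schur K i j = (\<Sum>t<n. \<alpha> t * (c t i * c t j))"
    using Suc.IH[OF certified_pos_schur[OF Suc.prems] schur_sym[OF Suc.prems(2)]] by blast
  \<comment> \<open>Since \<open>1 + t = (1 + s) * K 0 0\<close>, this cofactor contains the factor
    \<open>K 0 0\<close> that \<open>schur_decomp\<close> needs.\<close>
  obtain d' where d': "d' \<in> sos_set" "(1 + d) * (1 + t) = 1 + d'"
    using one_plus_sos_mult[OF d(1) st(2)] by blast
  define \<alpha>' where "\<alpha>' = case_nat ((1 + s) * (1 + d)) (\<lambda>t. (1 + s) * \<alpha> t)"
  define c' where "c' = case_nat (K 0) (\<lambda>t. case_nat 0 (c t))"
  have "\<alpha>' t \<in> sos_set" if "t < Suc n" for t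
    using that st d by (auto simp: \<alpha>'_def split: nat.split)
  moreover have "(1 + d') * K i j = (\<Sum>t<Suc n. \<alpha>' t * (c' t i * c' t j))" if "i < Suc n" "j < Suc n" for i j
  proof -
    have sh: "(1 + d) * shift (schur K) i j = (\<Sum>t<n. \<alpha> t * (case_nat 0 (c t) i * case_nat 0 (c t) j))"
      using that by (cases i; cases j) (auto simp: d(3))
    have "(1 + d') * K i j = (1 + s) * (1 + d) * (K 0 0 * K i j)"
      using d'(2)[symmetric] st(3)[symmetric] by (simp add: algebra_simps)
    also have "\<dots> = (1 + s) * (1 + d) * (K 0 i * K 0 j) + (1 + s) * ((1 + d) * shift (schur K) i j)"
      unfolding schur_decomp[of K, OF Suc.prems(2)] by (simp add: algebra_simps)
    also have "\<dots> = (\<Sum>t<Suc n. \<alpha>' t * (c' t i * c' t j))"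
      unfolding sh by (simp only: sum.lessThan_Suc_shift \<alpha>'_def c'_def nat.case sum_distrib_left mult.assoc)
    finally show ?thesis .
  qed
  ultimately show ?case using d'(1) by blast
qed

section \<open>Forms that are positive definite at every prime cone\<close>

definition pos_def_on_cones :: "nat \<Rightarrow> (nat \<Rightarrow> nat \<Rightarrow> 'a::comm_ring_1) \<Rightarrow> bool" where
  "pos_def_on_cones n K \<longleftrightarrow>
     (\<forall>P u. prime_cone P \<longrightarrow> (\<exists>i<n. u i \<notin> supp P) \<longrightarrow> - (\<Sum>i<n. \<Sum>j<n. K i j * (u i * u j)) \<notin> P)"

text \<open>The vector \<open>w\<close> is the lift of \<open>K 0 0 * y\<close> that is annihilated
  by the first row of \<open>K\<close>: this is completing the square in the first variable.\<close>

lemma schur_quadratic_form: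
  fixes K :: "nat \<Rightarrow> nat \<Rightarrow> 'a::comm_ring_1" and y :: "nat \<Rightarrow> 'a" and n :: nat
  assumes sym: "\<And>i j. K i j = K j i"
  defines "w \<equiv> case_nat (- (\<Sum>j<n. K 0 (Suc j) * y j)) (\<lambda>i. K 0 0 * y i)"
  shows "(\<Sum>i<Suc n. \<Sum>j<Suc n. K i j * (w i * w j)) =
    K 0 0 * (\<Sum>i<n. \<Sum>j<n. schur K i j * (y i * y j))"
proof -
  define h m where "h = K 0 0" and "m = (\<Sum>j<n. K 0 (Suc j) * y j)"
  define Q where "Q = (\<Sum>i<n. \<Sum>j<n. K (Suc i) (Suc j) * (y i * y j))"
  have mm: "m * m = (\<Sum>i<n. \<Sum>j<n. (K 0 (Suc i) * K 0 (Suc j)) * (y i * y j))"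
    unfolding m_def sum_product by (intro sum.cong) (auto simp: algebra_simps)
  have w0: "w 0 = - m" and wS: "w (Suc i) = h * y i" for i by (simp_all add: w_def m_def h_def)
  have row: "(\<Sum>j<n. K 0 (Suc j) * (w 0 * w (Suc j))) = - (h * m * m)"
    unfolding w0 wS by (subst (3) m_def) (simp add: sum_distrib_left sum_negf[symmetric] algebra_simps)
  have col: "(\<Sum>i<n. K (Suc i) 0 * (w (Suc i) * w 0)) = - (h * m * m)"
    using row by (simp add: sym[of "Suc _" 0] mult.commute[of "w 0"])
  have bulk: "(\<Sum>i<n. \<Sum>j<n. K (Suc i) (Suc j) * (w (Suc i) * w (Suc j))) = h * h * Q"
    unfolding wS Q_def by (simp add: sum_distrib_left algebra_simps)
  have "(\<Sum>i<Suc n. \<Sum>j<Suc n. K i j * (w i * w j)) = h * (m * m) - h * m * m - h * m * m + h * h * Q"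
    by (simp only: sum.lessThan_Suc_shift sum.distrib row col bulk) (simp add: w0 h_def algebra_simps)
  also have "\<dots> = h * (h * Q - m * m)" by (simp add: algebra_simps)
  also have "h * Q - m * m = (\<Sum>i<n. \<Sum>j<n. schur K i j * (y i * y j))"
    unfolding mm Q_def schur_def h_def
    by (simp only: sum_distrib_left sum_subtractf[symmetric] left_diff_distrib mult.assoc)
  finally show ?thesis by (simp add: h_def)
qed

lemma prime_coneD:
  assumes "prime_cone P"
  shows "preordering P" "a \<in> P \<or> - a \<in> P" "a * b \<in> supp P \<Longrightarrow> a \<in> supp P \<or> b \<in> supp P"
    "1 \<notin> supp P"
  using assms preorderingD(4)[of P] by (auto simp: prime_cone_def supp_def)

lemma pos_def_on_cones_corner:
  assumes "pos_def_on_cones (Suc n) K" "prime_cone P"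
  shows "- K 0 0 \<notin> P"
proof -
  have "- (\<Sum>i<Suc n. \<Sum>j<Suc n. K i j * (unit_mat 0 i * unit_mat 0 j)) \<notin> P"
  proof -
    have "\<exists>i<Suc n. unit_mat 0 i \<notin> supp P"
      using prime_coneD(4)[OF assms(2)] by (intro exI[of _ 0]) (simp add: unit_mat_def)
    then show ?thesis using assms unfolding pos_def_on_cones_def by blast
  qed
  then show ?thesis by (simp add: sum.lessThan_Suc_shift unit_mat_def del: sum.lessThan_Suc)
qed

text \<open>At a prime cone \<open>K 0 0\<close> is strictly positive and \<open>supp P\<close> is
  prime, so a nonzero \<open>y\<close> lifts to a nonzero \<open>w\<close>; the positive factor
  \<open>K 0 0\<close> in \<open>schur_quadratic_form\<close> does not affect the sign.\<close>

lemma pos_def_on_cones_schur: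
  fixes K :: "nat \<Rightarrow> nat \<Rightarrow> 'a::comm_ring_1"
  assumes pd: "pos_def_on_cones (Suc n) K" and sym: "\<And>i j. K i j = K j i"
  shows "pos_def_on_cones n (schur K)"
  unfolding pos_def_on_cones_def
proof (intro allI impI notI)
  fix P y assume P: "prime_cone P" and y: "\<exists>i<n. y i \<notin> supp P"
    and neg: "- (\<Sum>i<n. \<Sum>j<n. schur K i j * (y i * y j)) \<in> P"
  define w where "w = case_nat (- (\<Sum>j<n. K 0 (Suc j) * y j)) (\<lambda>i. K 0 0 * y i)"
  obtain i where i: "i < n" "y i \<notin> supp P" using y by blast
  have h: "- K 0 0 \<notin> P" by (rule pos_def_on_cones_corner[OF pd P])
  then have h': "K 0 0 \<in> P" using prime_coneD(2)[OF P] by blast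
  have "K 0 0 \<notin> supp P" using h by (auto simp: supp_def)
  then have "w (Suc i) \<notin> supp P" using prime_coneD(3)[OF P] i by (auto simp: w_def)
  then have "- (\<Sum>i<Suc n. \<Sum>j<Suc n. K i j * (w i * w j)) \<notin> P"
    using pd P i(1) unfolding pos_def_on_cones_def by (meson Suc_mono)
  then have "K 0 0 * - (\<Sum>i<n. \<Sum>j<n. schur K i j * (y i * y j)) \<notin> P"
    unfolding w_def schur_quadratic_form[of K, OF sym] mult_minus_right .
  then show False using h' neg preorderingD(2)[OF prime_coneD(1)[OF P]] by blast
qed

text \<open>Lagrange's identity, the sum-of-squares form of the Cauchy-Schwarz inequality. The
  factor 2 appears because the sum runs over all ordered pairs \<open>a\<close>,
  \<open>b\<close>.\<close>

lemma lagrange_gram_cone: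
  "(\<lambda>i j. 2 * (\<Sum>t<n. y t * y t) * unit_mat i j - 2 * (y i * y j)) \<in> gram_cone n"
proof -
  define g where "g a b i = y a * unit_mat b i - y b * unit_mat a i" for a b i
  have "(\<lambda>i j. \<Sum>a<n. \<Sum>b<n. g a b i * g a b j) \<in> gram_cone n"
    by (intro gram_cone_sum gram_cone_rank_one)
  moreover have "(\<Sum>a<n. \<Sum>b<n. g a b i * g a b j) =
      2 * (\<Sum>t<n. y t * y t) * unit_mat i j - 2 * (y i * y j)" if "i < n" "j < n" for i j
  proof -
    have delta: "(\<Sum>b<n. z b * unit_mat b k) = z k" if "k < n" for k and z :: "nat \<Rightarrow> 'a"
      using that by (simp add: unit_mat_def if_distrib[of "\<lambda>x. _ * x"] cong: if_cong)
    have uc: "unit_mat j i = (unit_mat i j :: 'a)" by (simp add: unit_mat_def)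
    have "(\<Sum>a<n. \<Sum>b<n. g a b i * g a b j) =
       (\<Sum>a<n. \<Sum>b<n. y a * y a * (unit_mat b i * unit_mat b j))
       + (\<Sum>a<n. \<Sum>b<n. y b * y b * (unit_mat a i * unit_mat a j))
       - (\<Sum>a<n. \<Sum>b<n. (y a * unit_mat a j) * (y b * unit_mat b i))
       - (\<Sum>a<n. \<Sum>b<n. (y a * unit_mat a i) * (y b * unit_mat b j))"
      by (simp only: sum_subtractf[symmetric] sum.distrib[symmetric])
        (intro sum.cong refl, simp add: g_def algebra_simps)
    also have "\<dots> = (\<Sum>t<n. y t * y t) * unit_mat i j + (\<Sum>t<n. y t * y t) * unit_mat i j
        - y j * y i - y i * y j"
      by (simp only: sum_product[symmetric] sum_distrib_left[symmetric] sum_distrib_right[symmetric]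
        delta[OF that(1)] delta[OF that(2)] uc)
    finally show ?thesis by (simp add: algebra_simps)
  qed
  ultimately show ?thesis by (subst (asm) gram_cone_cong) auto
qed

text \<open>Converse to \<open>certified_pos_corner\<close> and \<open>certified_pos_schur\<close>.
  Up to cofactors, \<open>K\<close> is \<open>x x^T\<close> plus the bordered Schur complement, and
  the latter dominates \<open>Z\<close>, the identity matrix without its first diagonal entry. The
  missing entry is obtained from \<open>x x^T\<close> and \<open>Z\<close> together, because
  \<open>x 0 = 1 + t\<close>.\<close>

lemma certified_pos_combine:
  fixes K :: "nat \<Rightarrow> nat \<Rightarrow> 'a::comm_ring_1"
  assumes sym: "\<And>i j. K i j = K j i"
    and s: "s \<in> sos_set" and t: "t \<in> sos_set" and st: "(1 + s) * K 0 0 = 1 + t"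
    and pos: "certified_pos n (schur K)"
  shows "certified_pos (Suc n) K"
proof -
  obtain s2 where s2: "s2 \<in> sos_set" "(\<lambda>i j. (1 + s2) * schur K i j - unit_mat i j) \<in> gram_cone n"
    using pos by (auto simp: certified_pos_def)
  define x where "x i = (1 + s) * K 0 i" for i
  define q where "q = (\<Sum>t<n. x (Suc t) * x (Suc t))"
  define G where "G = shift (\<lambda>i j. (1 + s2) * schur K i j - unit_mat i j)"
  define Z :: "nat \<Rightarrow> nat \<Rightarrow> 'a" where "Z = shift unit_mat"
  define e :: "nat \<Rightarrow> 'a" where "e = unit_mat 0"
  have q: "q \<in> sos_set"
  proof -
    have "(\<Sum>t<m. x (Suc t) * x (Suc t)) \<in> sos_set" for m by (induction m) auto
    then show ?thesis by (simp add: q_def)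
  qed
  have unit: "unit_mat i j = e i * e j + Z i j" for i j
    by (cases i; cases j) (auto simp: e_def Z_def unit_mat_def)
  have Zc: "Z \<in> gram_cone (Suc n)" and Gc: "G \<in> gram_cone (Suc n)"
    unfolding Z_def G_def using s2 by (auto intro: gram_cone_shift unit_mat_gram_cone)
  have shZ: "(1 + s2) * shift (schur K) i j = Z i j + G i j" for i j
    by (cases i; cases j) (auto simp: Z_def G_def)

  \<comment> \<open>The matrix \<open>2 x x^T + 2 q Z\<close> dominates \<open>e e^T\<close>. Here
    \<open>w w^T\<close> accounts for the first row and column, up to the corner surplus
    \<open>(x 0)^2 - 1 = 2 t + t^2\<close>; what is left in the lower block is the Gram matrix of
    Lagrange's identity.\<close>
  define L where "L i j = 2 * (x i * x j) + 2 * q * Z i j - e i * e j" for i j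
  define w where "w i = (if i = 0 then x i else 2 * x i)" for i
  have "shift (\<lambda>i j. 2 * q * unit_mat i j - 2 * (x (Suc i) * x (Suc j))) \<in> gram_cone (Suc n)"
    unfolding q_def by (intro gram_cone_shift lagrange_gram_cone)
  then have "(\<lambda>i j. w i * w j + (2 * t + t * t) * (e i * e j) +
      shift (\<lambda>i j. 2 * q * unit_mat i j - 2 * (x (Suc i) * x (Suc j))) i j) \<in> gram_cone (Suc n)"
    using t by (intro gram_cone_add gram_cone_scale gram_cone_rank_one) auto
  also have "(\<lambda>i j. w i * w j + (2 * t + t * t) * (e i * e j) +
      shift (\<lambda>i j. 2 * q * unit_mat i j - 2 * (x (Suc i) * x (Suc j))) i j) = L"
  proof (intro ext)
    fix i j
    have "x 0 = 1 + t" by (simp add: x_def st)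
    then show "w i * w j + (2 * t + t * t) * (e i * e j) +
      shift (\<lambda>i j. 2 * q * unit_mat i j - 2 * (x (Suc i) * x (Suc j))) i j = L i j"
      by (cases i; cases j) (auto simp: L_def w_def Z_def e_def unit_mat_def algebra_simps)
  qed
  finally have Lc: "L \<in> gram_cone (Suc n)" .

  \<comment> \<open>With this \<mu> one has
    \<open>\<mu> (x x^T + Z) = L + 2 q x x^T + Z + I\<close>, which makes the identity matrix
    appear. \<open>R\<close> is the excess of \<open>S^2 (1 + s2) K 0 0 K\<close> over
    \<open>x x^T + Z\<close>.\<close>
  define S \<mu> where "S = 1 + s" and "\<mu> = 2 + 2 * q"
  define R where "R i j = s2 * (x i * x j) + (2 * s + s * s) * Z i j + S * S * G i j" for i j
  have S: "S \<in> sos_set" and \<mu>: "\<mu> \<in> sos_set" using s q by (auto simp: S_def \<mu>_def)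
  have R: "R \<in> gram_cone (Suc n)"
    unfolding R_def using S s s2 Zc Gc by (intro gram_cone_add gram_cone_scale gram_cone_rank_one) auto
  have N: "(\<lambda>i j. S * (L i j + 2 * q * (x i * x j) + Z i j + \<mu> * R i j) + s * unit_mat i j) \<in> gram_cone (Suc n)"
    using S s q \<mu> Zc Lc R
    by (intro gram_cone_add[OF gram_cone_scale] gram_cone_add gram_cone_scale gram_cone_rank_one unit_mat_gram_cone) auto
  \<comment> \<open>The first factor is \<open>1 + t = S * K 0 0\<close>. It supplies the
    \<open>K 0 0\<close> in front of \<open>K\<close>, leaving one spare \<open>S\<close>.\<close>
  obtain r where r: "r \<in> sos_set" "(1 + t) * ((1 + (1 + 2 * q)) * ((1 + s) * ((1 + s) * (1 + s2)))) = 1 + r"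
  proof -
    obtain r1 where 1: "r1 \<in> sos_set" "(1 + s) * (1 + s2) = 1 + r1"
      using one_plus_sos_mult[OF s s2(1)] by blast
    obtain r2 where 2: "r2 \<in> sos_set" "(1 + s) * (1 + r1) = 1 + r2"
      using one_plus_sos_mult[OF s 1(1)] by blast
    obtain r3 where 3: "r3 \<in> sos_set" "(1 + (1 + 2 * q)) * (1 + r2) = 1 + r3"
      using one_plus_sos_mult[OF _ 2(1), of "1 + 2 * q"] q by blast
    show ?thesis
      using that one_plus_sos_mult[OF t 3(1)] unfolding 1(2) 2(2) 3(2) by blast
  qed
  have "(1 + r) * K i j - unit_mat i j =
     S * (L i j + 2 * q * (x i * x j) + Z i j + \<mu> * R i j) + s * unit_mat i j" for i j
  proof -
    have a: "L i j + 2 * q * (x i * x j) + Z i j + \<mu> * R i j + unit_mat i j =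
       \<mu> * (x i * x j + Z i j + R i j)"
      by (simp add: L_def unit \<mu>_def algebra_simps)
    have b: "x i * x j + Z i j + R i j = S * S * (1 + s2) * (K 0 0 * K i j)"
    proof -
      have "S * S * (1 + s2) * (K 0 0 * K i j) =
         (1 + s2) * (x i * x j) + S * S * ((1 + s2) * shift (schur K) i j)"
        unfolding schur_decomp[of K, OF sym] by (simp add: x_def S_def algebra_simps)
      then show ?thesis unfolding shZ by (simp add: R_def S_def algebra_simps)
    qed
    have "1 + r = (S * K 0 0) * \<mu> * (S * S * (1 + s2))"
      using r(2) st by (simp add: S_def \<mu>_def mult.assoc add.assoc[symmetric])
    then have "(1 + r) * K i j = S * (\<mu> * (S * S * (1 + s2) * (K 0 0 * K i j)))"
      by (simp add: mult_ac)
    also have "\<dots> = S * (L i j + 2 * q * (x i * x j) + Z i j + \<mu> * R i j + unit_mat i j)"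
      unfolding a b[symmetric] ..
    finally show ?thesis by (simp add: S_def algebra_simps)
  qed
  then show ?thesis using N r(1) unfolding certified_pos_def by (intro bexI[of _ r]) simp_all
qed

text \<open>The cofactor of a certificate \<open>s h = 1 + t\<close> can be made at least one because
  \<open>2 h + (2 + h\<^sup>2) = 1 + (1 + h)\<^sup>2\<close>.\<close>

lemma pos_def_on_cones_imp_certified_pos:
  fixes K :: "nat \<Rightarrow> nat \<Rightarrow> 'a::comm_ring_1"
  assumes "pos_def_on_cones n K" "\<And>i j. K i j = K j i"
  shows "certified_pos n K"
  using assms
proof (induction n arbitrary: K)
  case 0
  show ?case unfolding certified_pos_def by (rule bexI[of _ 0]) (auto intro: gram_coneI)
next
  case (Suc n)
  have pos: "certified_pos n (schur K)"
    using Suc.IH[OF pos_def_on_cones_schur[OF Suc.prems] schur_sym[OF Suc.prems(2)]] .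
  define h where "h = K 0 0"
  obtain s t where st: "s \<in> sos_set" "t \<in> sos_set" "s * h = 1 + t"
    using positivstellensatz[OF pos_def_on_cones_corner[OF Suc.prems(1)]] unfolding h_def by blast
  define s' t' where "s' = 1 + s * (2 + h * h)" and "t' = (1 + h) * (1 + h) + t * (2 + h * h)"
  have "(1 + s') * h = 2 * h + (s * h) * (2 + h * h)" by (simp add: s'_def algebra_simps)
  also have "\<dots> = 1 + t'" unfolding st(3) t'_def by (simp add: algebra_simps)
  finally have "(1 + s') * K 0 0 = 1 + t'" by (simp add: h_def)
  moreover have "s' \<in> sos_set" "t' \<in> sos_set"
    using st by (auto simp: s'_def t'_def)
  ultimately show ?case using certified_pos_combine[of K s' t' n] pos Suc.prems(2) by blast
qed

section \<open>Symmetric matrices with a prescribed eigenvalue\<close>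

text \<open>Multiplying \<open>N w = f y\<close> by the adjugate of \<open>N\<close> gives \<open>det N * w = f * (adj N y)\<close>.\<close>

lemma dvd_det_if_eigenvector:
  fixes N :: "'a::comm_ring_1 mat"
  assumes N: "N \<in> carrier_mat r r"
    and eq: "\<And>i. i < r \<Longrightarrow> (\<Sum>j<r. N $$ (i, j) * w j) = f * y i"
    and k: "k < r" "w k = 1"
  shows "f dvd det N"
proof -
  have Nw: "N *\<^sub>v vec r w = f \<cdot>\<^sub>v vec r y"
    using N eq by (intro eq_vecI) (auto simp: scalar_prod_def lessThan_atLeast0)
  have "det N \<cdot>\<^sub>v vec r w = (adj_mat N * N) *\<^sub>v vec r w"
    unfolding adj_mat(3)[OF N] by (intro eq_vecI) (auto simp: scalar_prod_def if_distrib[of "\<lambda>x. _ * x * _"] cong: if_cong)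
  also have "\<dots> = adj_mat N *\<^sub>v (f \<cdot>\<^sub>v vec r y)"
    unfolding Nw[symmetric] using adj_mat(1)[OF N] N by (subst assoc_mult_mat_vec) auto
  also have "\<dots> = f \<cdot>\<^sub>v (adj_mat N *\<^sub>v vec r y)"
    using adj_mat(1)[OF N]
    by (intro eq_vecI) (auto simp: scalar_prod_def sum_distrib_left mult.left_commute)
  finally have "(det N \<cdot>\<^sub>v vec r w) $ k = (f \<cdot>\<^sub>v (adj_mat N *\<^sub>v vec r y)) $ k" by simp
  then have "det N = f * (adj_mat N *\<^sub>v vec r y) $ k"
    using k adj_mat(1)[OF N] by simp
  then show ?thesis by simp
qed

section \<open>Newton power sums and the companion matrix\<close>

definition rev_coeff :: "'a::comm_ring_1 poly \<Rightarrow> nat \<Rightarrow> 'a" where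
  "rev_coeff f j = (if j \<le> Polynomial.degree f then Polynomial.coeff f (Polynomial.degree f - j) else 0)"

text \<open>Newton's identities, read as a recursive definition of the power sums of the roots of \<open>f\<close>.\<close>

fun power_sum :: "'a::comm_ring_1 poly \<Rightarrow> nat \<Rightarrow> 'a" where
  "power_sum f m = (of_nat (Polynomial.degree f) - of_nat m) * rev_coeff f m
     - (\<Sum>j<m. rev_coeff f (Suc j) * power_sum f (m - Suc j))"

declare power_sum.simps [simp del]

text \<open>From index \<open>n\<close> on, the first term of Newton's identity drops out: at
  \<open>n\<close> its integer factor is zero, beyond \<open>n\<close> its coefficient is. What
  remains is the linear recurrence with characteristic polynomial \<open>f\<close>.\<close>

lemma power_sum_recurrence:
  fixes f :: "'a::comm_ring_1 poly"
  defines "n \<equiv> Polynomial.degree f"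
  shows "power_sum f (m + n) = - (\<Sum>i<n. Polynomial.coeff f i * power_sum f (m + i))"
proof -
  have "(of_nat n - of_nat (m + n)) * rev_coeff f (m + n) = 0"
    by (cases m) (auto simp: rev_coeff_def n_def)
  then have "power_sum f (m + n) = - (\<Sum>j<m + n. rev_coeff f (Suc j) * power_sum f (m + n - Suc j))"
    by (subst power_sum.simps) (simp add: n_def)
  also have "(\<Sum>j<m + n. rev_coeff f (Suc j) * power_sum f (m + n - Suc j)) =
      (\<Sum>j<n. rev_coeff f (Suc j) * power_sum f (m + n - Suc j))"
    by (rule sum.mono_neutral_right) (auto simp: rev_coeff_def n_def)
  also have "\<dots> = (\<Sum>j<n. Polynomial.coeff f (n - Suc j) * power_sum f (m + (n - Suc j)))"
    by (intro sum.cong) (auto simp: rev_coeff_def n_def)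
  also have "\<dots> = (\<Sum>i<n. Polynomial.coeff f i * power_sum f (m + i))"
    by (rule sum.nat_diff_reindex[of "\<lambda>i. Polynomial.coeff f i * power_sum f (m + i)"])
  finally show ?thesis .
qed

text \<open>For monic \<open>f\<close>, this is multiplication by \<open>X\<close> on
  \<open>A[X]/(f)\<close> in the basis of powers of \<open>X\<close>.\<close>

definition companion :: "'a::comm_ring_1 poly \<Rightarrow> nat \<Rightarrow> nat \<Rightarrow> 'a" where
  "companion f i j = (if i = Suc j then 1 else 0) - (if Suc j = Polynomial.degree f then Polynomial.coeff f i else 0)"

text \<open>Multiplying by the companion matrix advances the Hankel matrix \<open>H\<close> by one
  index. The product is again a Hankel matrix, hence symmetric: multiplication by \<open>X\<close>
  is self-adjoint for the trace form.\<close>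

lemma hankel_companion:
  fixes f :: "'a::comm_ring_1 poly"
  defines "n \<equiv> Polynomial.degree f"
  assumes "j < n"
  shows "(\<Sum>k<n. power_sum f (i + k) * companion f k j) = power_sum f (Suc (i + j))"
proof (cases "Suc j = n")
  case True
  then have "(\<Sum>k<n. power_sum f (i + k) * companion f k j) = (\<Sum>k<n. - (Polynomial.coeff f k * power_sum f (i + k)))"
    by (intro sum.cong) (auto simp: companion_def n_def)
  also have "\<dots> = power_sum f (i + n)"
    by (simp add: sum_negf power_sum_recurrence n_def)
  finally show ?thesis by (simp add: True[symmetric])
next
  case False
  then show ?thesis using assms
    by (simp add: companion_def if_distrib[of "\<lambda>x. _ * x"] cong: if_cong)
qed

text \<open>The Horner quotients \<open>z j = poly_shift (Suc j) f\<close> satisfy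
  \<open>z (i - 1) = coeff f i + X z i\<close> for \<open>i > 0\<close> and end with
  \<open>z (n - 1) = 1\<close>. Hence they form an eigenvector for \<open>X\<close> modulo
  \<open>f\<close>, and its entry 1 is what the adjugate argument requires.\<close>

lemma companion_eigenvector:
  fixes f :: "'a::comm_ring_1 poly"
  defines "n \<equiv> Polynomial.degree f"
  assumes "monic f" "i < n"
  shows "(\<Sum>j<n. Polynomial.smult (companion f i j) (poly_shift (Suc j) f)) =
    pCons 0 (poly_shift (Suc i) f) - (if i = 0 then f else 0)"
proof -
  have shift: "poly_shift k f = pCons (Polynomial.coeff f k) (poly_shift (Suc k) f)" for k
    by (rule poly_eqI) (simp add: coeff_poly_shift coeff_pCons split: nat.split)
  have top: "poly_shift n f = 1"
    using assms(2) by (intro poly_eqI) (auto simp: coeff_poly_shift n_def coeff_1 coeff_eq_0 Suc_le_eq)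
  have "(\<Sum>j<n. Polynomial.smult (companion f i j) (poly_shift (Suc j) f)) =
     (\<Sum>j<n. (if i = Suc j then poly_shift i f else 0) - (if j = n - 1 then [:Polynomial.coeff f i:] else 0))"
    by (intro sum.cong) (use top assms(3) in \<open>auto simp: companion_def smult_diff_left n_def\<close>)
  also have "\<dots> = (if i = 0 then 0 else poly_shift i f) - [:Polynomial.coeff f i:]"
    using assms(3) by (cases i) (auto simp: sum_subtractf sum_negf)
  also have "\<dots> = pCons 0 (poly_shift (Suc i) f) - (if i = 0 then f else 0)"
  proof -
    have "pCons 0 (poly_shift (Suc i) f) = poly_shift i f - [:Polynomial.coeff f i:]"
      by (subst shift[of i]) simp
    then show ?thesis by simp
  qed
  finally show ?thesis .
qed

lemma gram_nth: "gram ls i j = (\<Sum>r<length ls. (ls ! r) i * (ls ! r) j)"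
  unfolding gram_def by (simp add: sum_list_sum_nth lessThan_atLeast0)

text \<open>The columns of \<open>V = (I, ls)\<close> span an \<open>M\<close>-invariant direct summand on which \<open>M\<close> acts as
  the companion matrix: \<open>M V = V C\<close>. A symmetric such \<open>M\<close> exists as soon as \<open>V\<^sup>T V C\<close> is symmetric.\<close>

lemma symmetric_matrix_from_gram:
  fixes f :: "'a::comm_ring_1 poly" and ls :: "(nat \<Rightarrow> 'a) list"
  defines "n \<equiv> Polynomial.degree f"
  assumes f: "monic f" "0 < n"
    and G: "\<And>i j. i < n \<Longrightarrow> j < n \<Longrightarrow> c * power_sum f (i + j) = unit_mat i j + gram ls i j"
  shows "\<exists>M \<in> carrier_mat (n + length ls) (n + length ls). transpose_mat M = M \<and> f dvd char_poly M"
proof -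
  define m where "m = length ls"
  define V where "V r k = (ls ! r) k" for r k
  define C where "C = companion f"
  \<comment> \<open>With a zero lower right block, \<open>M (I; V) = (I; V) C\<close> forces
    \<open>B = V C\<close> and \<open>T = C - B^T V\<close>. Since \<open>V^T V = c H - I\<close>
    and \<open>C^T H = H C\<close>, the latter is \<open>C + C^T - c H C\<close>, which is
    symmetric.\<close>
  define B where "B r j = (\<Sum>k<n. V r k * C k j)" for r j
  define T where "T i j = C i j + C j i - c * power_sum f (Suc (i + j))" for i j
  define M where "M = mat (n + m) (n + m) (\<lambda>(i, j). if i < n then if j < n then T i j else B (j - n) i
    else if j < n then B (i - n) j else 0)"
  have M: "M \<in> carrier_mat (n + m) (n + m)" by (simp add: M_def)
  have sym: "transpose_mat M = M"
    by (rule eq_matI) (auto simp: M_def T_def add.commute)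
  define z where "z j = poly_shift (Suc j) f" for j
  \<comment> \<open>Here \<open>w = (I; V) z\<close>, and \<open>y\<close> is the first column of
    \<open>(I; V)\<close>. From \<open>C z = X z - f e_0\<close> it follows that
    \<open>M w = (I; V) C z = X w - f y\<close>.\<close>
  define w where "w i = (if i < n then z i else (\<Sum>k<n. Polynomial.smult (V (i - n) k) (z k)))" for i
  define y where "y i = (if i < n then if i = 0 then 1 else 0 else [:V (i - n) 0:])" for i
  have Cz: "(\<Sum>j<n. Polynomial.smult (C i j) (z j)) = pCons 0 (z i) - (if i = 0 then f else 0)" if "i < n" for i
    using companion_eigenvector[OF f(1)] that unfolding C_def z_def n_def by blast
  have Bz: "(\<Sum>j<n. Polynomial.smult (B r j) (z j)) = pCons 0 (\<Sum>k<n. Polynomial.smult (V r k) (z k)) - Polynomial.smult (V r 0) f" for r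
  proof -
    have "(\<Sum>j<n. Polynomial.smult (B r j) (z j)) = (\<Sum>j<n. \<Sum>k<n. Polynomial.smult (V r k) (Polynomial.smult (C k j) (z j)))"
      by (simp add: B_def smult_sum)
    also have "\<dots> = (\<Sum>k<n. Polynomial.smult (V r k) (\<Sum>j<n. Polynomial.smult (C k j) (z j)))"
      by (subst sum.swap) (simp add: smult_sum2)
    also have "\<dots> = (\<Sum>k<n. pCons 0 (Polynomial.smult (V r k) (z k)) - (if k = 0 then Polynomial.smult (V r 0) f else 0))"
      by (intro sum.cong) (auto simp: Cz smult_diff_right)
    also have "\<dots> = (\<Sum>k<n. pCons 0 (Polynomial.smult (V r k) (z k))) - Polynomial.smult (V r 0) f"
      using f(2) by (simp add: sum_subtractf)
    also have "(\<Sum>k<n. pCons 0 (Polynomial.smult (V r k) (z k))) = pCons 0 (\<Sum>k<n. Polynomial.smult (V r k) (z k))"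
      using sum_distrib_left[of "[:0, 1:]" "\<lambda>k. Polynomial.smult (V r k) (z k)" "{..<n}"] by simp
    finally show ?thesis .
  qed
  \<comment> \<open>This is the contribution \<open>B^T V z = C^T (c H - I) z\<close> of the upper
    right block.\<close>
  have tail: "(\<Sum>r<m. Polynomial.smult (B r i) (w (n + r))) =
      (\<Sum>l<n. Polynomial.smult (c * power_sum f (Suc (i + l))) (z l)) - (\<Sum>l<n. Polynomial.smult (C l i) (z l))"
    if i: "i < n" for i
  proof -
    have "(\<Sum>r<m. Polynomial.smult (B r i) (w (n + r))) =
        (\<Sum>r<m. \<Sum>l<n. Polynomial.smult (B r i * V r l) (z l))"
      by (simp add: w_def smult_sum2)
    also have "\<dots> = (\<Sum>l<n. Polynomial.smult (\<Sum>r<m. B r i * V r l) (z l))"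
      by (subst sum.swap) (simp add: smult_sum)
    also have "\<dots> = (\<Sum>l<n. Polynomial.smult (c * power_sum f (Suc (i + l)) - C l i) (z l))"
    proof (intro sum.cong refl arg_cong[of _ _ "\<lambda>a. Polynomial.smult a _"])
      fix l assume "l \<in> {..<n}"
      then have l: "l < n" by simp
      have "(\<Sum>r<m. B r i * V r l) = (\<Sum>r<m. \<Sum>k<n. C k i * (V r k * V r l))"
        by (simp add: B_def sum_distrib_left sum_distrib_right algebra_simps)
      also have "\<dots> = (\<Sum>k<n. C k i * gram ls k l)"
        by (subst sum.swap) (simp add: gram_nth V_def m_def sum_distrib_left)
      also have "\<dots> = (\<Sum>k<n. C k i * (c * power_sum f (k + l) - unit_mat k l))"
        using G l by (intro sum.cong) auto
      also have "\<dots> = c * (\<Sum>k<n. power_sum f (l + k) * C k i) - (\<Sum>k<n. C k i * unit_mat k l)"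
        by (simp add: sum_distrib_left sum_subtractf right_diff_distrib mult_ac add.commute)
      also have "(\<Sum>k<n. C k i * unit_mat k l) = C l i"
        using l by (simp add: unit_mat_def if_distrib[of "\<lambda>x. _ * x"] cong: if_cong)
      also have "(\<Sum>k<n. power_sum f (l + k) * C k i) = power_sum f (Suc (i + l))"
        using hankel_companion[of i f l] i by (simp add: C_def n_def add.commute)
      finally show "(\<Sum>r<m. B r i * V r l) = c * power_sum f (Suc (i + l)) - C l i" .
    qed
    finally show ?thesis by (simp add: smult_diff_left sum_subtractf)
  qed
  have split: "(\<Sum>j<n + m. F j) = (\<Sum>j<n. F j) + (\<Sum>r<m. F (n + r))" for F :: "nat \<Rightarrow> 'a poly"
    by (induction m) (simp_all add: add.assoc)
  have Mw: "(\<Sum>j<n + m. Polynomial.smult (M $$ (i, j)) (w j)) = pCons 0 (w i) - f * y i" if i: "i < n + m" for i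
  proof (cases "i < n")
    case True
    have "(\<Sum>j<n + m. Polynomial.smult (M $$ (i, j)) (w j)) = (\<Sum>j<n. Polynomial.smult (T i j) (z j)) + (\<Sum>r<m. Polynomial.smult (B r i) (w (n + r)))"
      unfolding split using True by (intro arg_cong2[of _ _ _ _ "(+)"] sum.cong) (auto simp: M_def w_def)
    also have "\<dots> = (\<Sum>j<n. Polynomial.smult (C i j) (z j))"
      unfolding tail[OF True] T_def by (simp add: smult_diff_left smult_add_left sum.distrib sum_subtractf)
    finally show ?thesis using True by (simp add: Cz w_def y_def)
  next
    case False
    have "(\<Sum>j<n + m. Polynomial.smult (M $$ (i, j)) (w j)) = (\<Sum>j<n. Polynomial.smult (B (i - n) j) (z j)) + (\<Sum>r<m. 0)"
      unfolding split using False i by (intro arg_cong2[of _ _ _ _ "(+)"] sum.cong) (auto simp: M_def w_def)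
    then show ?thesis using False by (simp add: Bz w_def y_def)
  qed
  have "f dvd det (char_poly_matrix M)"
  proof (rule dvd_det_if_eigenvector[of _ "n + m" w f y "n - 1"])
    show "char_poly_matrix M \<in> carrier_mat (n + m) (n + m)" using M by simp
    show "n - 1 < n + m" using f(2) by simp
    show "w (n - 1) = 1"
      using f by (auto simp: w_def z_def n_def coeff_poly_shift coeff_1 coeff_eq_0 Suc_le_eq intro!: poly_eqI)
    fix i assume i: "i < n + m"
    have "(\<Sum>j<n + m. char_poly_matrix M $$ (i, j) * w j) =
        (\<Sum>j<n + m. (if j = i then pCons 0 (w i) else 0) - Polynomial.smult (M $$ (i, j)) (w j))"
      using i M by (intro sum.cong) (auto simp: char_poly_matrix_def algebra_simps)
    also have "\<dots> = f * y i" using i by (simp add: sum_subtractf Mw)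
    finally show "(\<Sum>j<n + m. char_poly_matrix M $$ (i, j) * w j) = f * y i" .
  qed
  then show ?thesis using M sym unfolding m_def char_poly_def by blast
qed

section \<open>Counting rows with the Pythagoras number\<close>

lemma pythagoras_number_attained:
  assumes "pythagoras_number TYPE('a::comm_ring_1) \<noteq> \<infinity>" and "x \<in> (sos_set :: 'a set)"
  shows "\<exists>xs. length xs = the_enat (pythagoras_number TYPE('a)) \<and> x = sum_sq xs"
proof -
  let ?S = "{enat q | q. \<forall>x \<in> (sos_set :: 'a set). \<exists>xs. length xs = q \<and> x = sum_sq xs}"
  have "?S \<noteq> {}"
  proof
    assume "?S = {}"
    then show False using assms(1) unfolding pythagoras_number_def by (simp only: Inf_enat_def refl if_True) simp
  qed
  then have "Inf ?S \<in> ?S" by (meson ex_in_conv wellorder_InfI)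
  then obtain q where "pythagoras_number TYPE('a) = enat q"
    "\<forall>x \<in> (sos_set :: 'a set). \<exists>xs. length xs = q \<and> x = sum_sq xs"
    unfolding pythagoras_number_def by auto
  then show ?thesis using assms(2) by simp
qed

lemma gram_concat_scaled:
  "gram (concat (map (\<lambda>t. map (\<lambda>a k. a * v t k) (as t)) [0..<n])) i j =
    (\<Sum>t<n. sum_sq (as t) * (v t i * v t j))"
proof (induction n)
  case (Suc n)
  have "gram (map (\<lambda>a k. a * v n k) xs) i j = sum_sq xs * (v n i * v n j)" for xs
    by (induction xs) (auto simp: algebra_simps)
  then show ?case using Suc by simp
qed simp

lemma certified_pos_imp_gram:
  fixes K :: "nat \<Rightarrow> nat \<Rightarrow> 'a::comm_ring_1"
  assumes pos: "certified_pos n K" and sym: "\<And>i j. K i j = K j i"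
  shows "\<exists>c ls. (pythagoras_number TYPE('a) \<noteq> \<infinity> \<longrightarrow>
      length ls = 2 * the_enat (pythagoras_number TYPE('a)) * n) \<and>
    (\<forall>i<n. \<forall>j<n. c * K i j = unit_mat i j + gram ls i j)"
proof -
  obtain s ls where s: "s \<in> sos_set"
    and g: "\<And>i j. i < n \<Longrightarrow> j < n \<Longrightarrow> gram ls i j = (1 + s) * K i j - unit_mat i j"
    using certified_posE[OF pos] by blast
  \<comment> \<open>Thanks to the factor 2, \<open>L - I = 2 ((1 + s) K - I)\<close> is still a Gram
    matrix, so \<open>L\<close> can be diagonalised even though one identity matrix has been taken
    out.\<close>
  define L where "L i j = 2 * (1 + s) * K i j - unit_mat i j" for i j
  have "(\<lambda>i j. 2 * gram ls i j) \<in> gram_cone n"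
    by (intro gram_cone_scale gram_coneI[of _ _ ls]) auto
  then have "(\<lambda>i j. (1 + 0) * L i j - unit_mat i j) \<in> gram_cone n"
    by (subst gram_cone_cong[where L = "\<lambda>i j. 2 * gram ls i j"]) (simp_all add: g L_def algebra_simps)
  then have "certified_pos n L" unfolding certified_pos_def by blast
  moreover have "L i j = L j i" for i j
    using sym[of i j] by (simp add: L_def unit_mat_def)
  ultimately obtain d \<alpha> v where d: "d \<in> sos_set" "\<forall>t<n. \<alpha> t \<in> sos_set"
    "\<And>i j. i < n \<Longrightarrow> j < n \<Longrightarrow> (1 + d) * L i j = (\<Sum>t<n. \<alpha> t * (v t i * v t j))"
    using certified_pos_diagonalise[of n L] by blast
  \<comment> \<open>If the Pythagoras number is infinite, the lengths are unconstrained and any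
    representation serves.\<close>
  have "\<forall>x\<in>sos_set :: 'a set. \<exists>xs. (pythagoras_number TYPE('a) \<noteq> \<infinity> \<longrightarrow>
      length xs = the_enat (pythagoras_number TYPE('a))) \<and> x = sum_sq xs"
  proof
    fix x :: 'a assume "x \<in> sos_set"
    then show "\<exists>xs. (pythagoras_number TYPE('a) \<noteq> \<infinity> \<longrightarrow>
      length xs = the_enat (pythagoras_number TYPE('a))) \<and> x = sum_sq xs"
      using pythagoras_number_attained[of x]
      by (cases "pythagoras_number TYPE('a) = \<infinity>") (auto simp: sos_set_def)
  qed
  from bchoice[OF this] obtain sq where sq: "\<And>x :: 'a. x \<in> sos_set \<Longrightarrow> x = sum_sq (sq x)"
    "\<And>x. x \<in> sos_set \<Longrightarrow> pythagoras_number TYPE('a) \<noteq> \<infinity> \<Longrightarrow>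
      length (sq x) = the_enat (pythagoras_number TYPE('a))"
    by blast
  define l1 where "l1 = concat (map (\<lambda>t. map (\<lambda>a k. a * unit_mat t k) (sq d)) [0..<n])"
  define l2 where "l2 = concat (map (\<lambda>t. map (\<lambda>a k. a * v t k) (sq (\<alpha> t))) [0..<n])"
  have "(2 * (1 + s) * (1 + d)) * K i j = unit_mat i j + gram (l1 @ l2) i j" if ij: "i < n" "j < n" for i j
  proof -
    have "gram l1 i j = d * unit_mat i j"
      unfolding l1_def gram_concat_scaled sq(1)[OF d(1), symmetric]
      by (subst unit_mat_eq_sum[OF ij(1)]) (simp only: sum_distrib_left)
    moreover have "gram l2 i j = (1 + d) * L i j"
      unfolding l2_def gram_concat_scaled d(3)[OF ij] using d(2) sq(1) by (intro sum.cong) auto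
    ultimately show ?thesis by (simp add: L_def algebra_simps)
  qed
  moreover have "length (l1 @ l2) = 2 * the_enat (pythagoras_number TYPE('a)) * n"
    if fin: "pythagoras_number TYPE('a) \<noteq> \<infinity>"
  proof -
    let ?p = "the_enat (pythagoras_number TYPE('a))"
    have len: "length (concat (map h [0..<n])) = ?p * n" if "\<And>t. t < n \<Longrightarrow> length (h t) = ?p"
      for h :: "nat \<Rightarrow> (nat \<Rightarrow> 'a) list"
    proof -
      have "sum_list (map (length \<circ> h) [0..<n]) = sum_list (map (\<lambda>_. ?p) [0..<n])"
        using that by (intro arg_cong[of _ _ sum_list] map_cong) auto
      then show ?thesis by (simp add: length_concat sum_list_triv)
    qed
    have "length l1 = ?p * n" "length l2 = ?p * n"
      unfolding l1_def l2_def using sq(2) d fin by (auto intro!: len)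
    then show ?thesis by simp
  qed
  ultimately show ?thesis by blast
qed

lemma symmetric_matrix_if_pos_def:
  fixes f :: "'a::comm_ring_1 poly" and n :: nat
  assumes "monic f" and n: "Polynomial.degree f = n"
    and pd: "pos_def_on_cones n (\<lambda>i j. power_sum f (i + j))"
  shows "\<exists>r (M :: 'a mat).
           (pythagoras_number TYPE('a) \<noteq> \<infinity> \<longrightarrow>
              r \<le> (2 * the_enat (pythagoras_number TYPE('a)) + 1) * n) \<and>
           M \<in> carrier_mat r r \<and> transpose_mat M = M \<and>
           f dvd char_poly M"
proof (cases "n = 0")
  case True
  then have "f = 1" using assms(1,2) by (metis monic_degree_0)
  then show ?thesis
    by (intro exI[of _ 0] exI[of _ "0\<^sub>m 0 0"]) auto
next
  case False
  have "certified_pos n (\<lambda>i j. power_sum f (i + j))"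
    by (rule pos_def_on_cones_imp_certified_pos[OF pd]) (simp add: add.commute)
  moreover have "power_sum f (i + j) = power_sum f (j + i)" for i j
    by (simp add: add.commute)
  ultimately obtain c ls where
    len: "pythagoras_number TYPE('a) \<noteq> \<infinity> \<longrightarrow> length ls = 2 * the_enat (pythagoras_number TYPE('a)) * n"
    and G: "\<And>i j. i < n \<Longrightarrow> j < n \<Longrightarrow> c * power_sum f (i + j) = unit_mat i j + gram ls i j"
    using certified_pos_imp_gram[of n "\<lambda>i j. power_sum f (i + j)"] by blast
  obtain M where "M \<in> carrier_mat (n + length ls) (n + length ls)" "transpose_mat M = M" "f dvd char_poly M"
    using symmetric_matrix_from_gram[of f c ls] assms(1) n False G by auto
  then show ?thesis using len
    by (intro exI[of _ "n + length ls"] exI[of _ M]) (auto simp: algebra_simps)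
qed

section \<open>The residue field at a prime cone\<close>

text \<open>The residue field at the support of \<open>P\<close>, i.e. the fraction field of \<open>A / supp P\<close>. A fraction is
  represented by the set of all pairs (numerator, denominator) that define it.\<close>

definition fraction :: "'a::comm_ring_1 set \<Rightarrow> 'a \<Rightarrow> 'a \<Rightarrow> ('a \<times> 'a) set" where
  "fraction P a b = {(c, d). d \<notin> supp P \<and> a * d - b * c \<in> supp P}"

definition residue_field :: "'a::comm_ring_1 set \<Rightarrow> ('a \<times> 'a) set ring" where
  "residue_field P = \<lparr>carrier = {fraction P a b | a b. b \<notin> supp P},
     mult = (\<lambda>x y. let (a, b) = (SOME p. p \<in> x); (c, d) = (SOME p. p \<in> y) in fraction P (a * c) (b * d)),
     one = fraction P 1 1, zero = fraction P 0 1,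
     add = (\<lambda>x y. let (a, b) = (SOME p. p \<in> x); (c, d) = (SOME p. p \<in> y) in fraction P (a * d + b * c) (b * d))\<rparr>"

context
  fixes P :: "'a::comm_ring_1 set" assumes P: "prime_cone P"
begin

lemmas prime_cone_closed = preorderingD[OF prime_coneD(1)[OF P]]

text \<open>Absorption of an arbitrary factor \<open>c\<close> rests on totality: \<open>c\<close>
  or \<open>- c\<close> lies in \<open>P\<close>, and \<open>supp P\<close> is stable under change
  of sign.\<close>

lemma supp_closed:
  "0 \<in> supp P" "a \<in> supp P \<Longrightarrow> b \<in> supp P \<Longrightarrow> a + b \<in> supp P" "a \<in> supp P \<Longrightarrow> - a \<in> supp P"
  "a \<in> supp P \<Longrightarrow> c * a \<in> supp P"
proof -
  show "0 \<in> supp P" using prime_cone_closed(5) by (simp add: supp_def)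
  show "a \<in> supp P \<Longrightarrow> b \<in> supp P \<Longrightarrow> a + b \<in> supp P"
    using prime_cone_closed(1)[of a b] prime_cone_closed(1)[of "-a" "-b"] by (simp add: supp_def)
  show "a \<in> supp P \<Longrightarrow> - a \<in> supp P" by (simp add: supp_def)
  show "c * a \<in> supp P" if "a \<in> supp P"
    using prime_coneD(2)[OF P, of c] prime_cone_closed(2)[of c a] prime_cone_closed(2)[of c "- a"] prime_cone_closed(2)[of "- c" a] prime_cone_closed(2)[of "- c" "- a"] that
    by (auto simp: supp_def)
qed

lemma supp_prime: "a \<notin> supp P \<Longrightarrow> b \<notin> supp P \<Longrightarrow> a * b \<notin> supp P"
  using prime_coneD(3)[OF P] by blast

lemma supp_cancel: "d * x \<in> supp P \<Longrightarrow> d \<notin> supp P \<Longrightarrow> x \<in> supp P"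
  using prime_coneD(3)[OF P] by blast

lemma fraction_subset:
  assumes "b \<notin> supp P" "d \<notin> supp P" "a * d - b * c \<in> supp P"
  shows "fraction P a b \<subseteq> fraction P c d"
proof
  fix x assume "x \<in> fraction P a b"
  then obtain e f where x: "x = (e, f)" "f \<notin> supp P" "a * f - b * e \<in> supp P" by (auto simp: fraction_def)
  have "b * (c * f - d * e) = d * (a * f - b * e) + - (f * (a * d - b * c))" by (simp add: algebra_simps)
  also have "\<dots> \<in> supp P" using assms(3) x(3) by (intro supp_closed)
  finally have "c * f - d * e \<in> supp P" using supp_cancel assms(1) by blast
  then show "x \<in> fraction P c d" using x by (simp add: fraction_def)
qed

lemma fraction_eq_iff:
  assumes "b \<notin> supp P" "d \<notin> supp P"
  shows "fraction P a b = fraction P c d \<longleftrightarrow> a * d - b * c \<in> supp P"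
proof
  assume *: "a * d - b * c \<in> supp P"
  then have "c * b - d * a \<in> supp P" using supp_closed(3)[OF *] by (simp add: mult.commute)
  then show "fraction P a b = fraction P c d"
    using fraction_subset[OF assms *] fraction_subset[OF assms(2,1)] by blast
next
  assume "fraction P a b = fraction P c d"
  moreover have "(c, d) \<in> fraction P c d" using assms(2) supp_closed(1) by (simp add: fraction_def mult.commute)
  ultimately show "a * d - b * c \<in> supp P" by (auto simp: fraction_def)
qed

lemma fraction_eqI: "b \<notin> supp P \<Longrightarrow> d \<notin> supp P \<Longrightarrow> a * d = b * c \<Longrightarrow> fraction P a b = fraction P c d"
  using fraction_eq_iff[of b d a c] supp_closed(1) by simp

lemma fraction_rep:
  assumes "b \<notin> supp P"
  obtains c d where "(SOME p. p \<in> fraction P a b) = (c, d)" "d \<notin> supp P" "a * d - b * c \<in> supp P"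
proof -
  have "(a, b) \<in> fraction P a b" using assms supp_closed(1) by (simp add: fraction_def mult.commute)
  then have "(SOME p. p \<in> fraction P a b) \<in> fraction P a b" by (rule someI)
  then show thesis using that by (auto simp: fraction_def)
qed

text \<open>The operations of \<open>residue_field\<close> act on representatives picked by
  \<open>SOME\<close>; this lemma and its analogue for addition show that the choice is
  immaterial.\<close>

lemma residue_field_mult:
  assumes "b \<notin> supp P" "d \<notin> supp P"
  shows "fraction P a b \<otimes>\<^bsub>residue_field P\<^esub> fraction P c d = fraction P (a * c) (b * d)"
proof -
  obtain a' b' where 1: "(SOME p. p \<in> fraction P a b) = (a', b')" "b' \<notin> supp P" "a * b' - b * a' \<in> supp P"
    using fraction_rep[OF assms(1)] .
  obtain c' d' where 2: "(SOME p. p \<in> fraction P c d) = (c', d')" "d' \<notin> supp P" "c * d' - d * c' \<in> supp P"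
    using fraction_rep[OF assms(2)] .
  have "(a' * c') * (b * d) - (b' * d') * (a * c) = - ((c * d') * (a * b' - b * a') + (a' * b) * (c * d' - d * c'))"
    by (simp add: algebra_simps)
  also have "\<dots> \<in> supp P" using 1 2 by (intro supp_closed)
  finally have "fraction P (a' * c') (b' * d') = fraction P (a * c) (b * d)"
    using fraction_eq_iff supp_prime assms 1 2 by blast
  then show ?thesis using 1 2 by (simp add: residue_field_def)
qed

lemma residue_field_add:
  assumes "b \<notin> supp P" "d \<notin> supp P"
  shows "fraction P a b \<oplus>\<^bsub>residue_field P\<^esub> fraction P c d = fraction P (a * d + b * c) (b * d)"
proof -
  obtain a' b' where 1: "(SOME p. p \<in> fraction P a b) = (a', b')" "b' \<notin> supp P" "a * b' - b * a' \<in> supp P"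
    using fraction_rep[OF assms(1)] .
  obtain c' d' where 2: "(SOME p. p \<in> fraction P c d) = (c', d')" "d' \<notin> supp P" "c * d' - d * c' \<in> supp P"
    using fraction_rep[OF assms(2)] .
  have "(a' * d' + b' * c') * (b * d) - (b' * d') * (a * d + b * c) =
      - ((d * d') * (a * b' - b * a') + (b * b') * (c * d' - d * c'))"
    by (simp add: algebra_simps)
  also have "\<dots> \<in> supp P" using 1 2 by (intro supp_closed)
  finally have "fraction P (a' * d' + b' * c') (b' * d') = fraction P (a * d + b * c) (b * d)"
    using fraction_eq_iff supp_prime assms 1 2 by blast
  then show ?thesis using 1 2 by (simp add: residue_field_def)
qed

lemma fraction_closed: "b \<notin> supp P \<Longrightarrow> fraction P a b \<in> carrier (residue_field P)"
  by (auto simp: residue_field_def)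

lemma residue_field_cases:
  assumes "x \<in> carrier (residue_field P)"
  obtains a b where "b \<notin> supp P" "x = fraction P a b"
  using assms by (auto simp: residue_field_def)

lemma residue_field_one: "\<one>\<^bsub>residue_field P\<^esub> = fraction P 1 1"
  and residue_field_zero: "\<zero>\<^bsub>residue_field P\<^esub> = fraction P 0 1"
  by (simp_all add: residue_field_def)

lemma one_not_supp: "1 \<notin> supp P" using prime_coneD(4)[OF P] .

lemmas residue_field_ops = residue_field_mult residue_field_add residue_field_one residue_field_zero
  supp_prime one_not_supp

lemma field_residue_field: "field (residue_field P)"
proof -
  let ?R = "residue_field P"
  have "abelian_group ?R"
  proof (rule abelian_groupI)
    show "\<exists>y\<in>carrier ?R. y \<oplus>\<^bsub>?R\<^esub> x = \<zero>\<^bsub>?R\<^esub>" if x: "x \<in> carrier ?R" for x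
    proof -
      obtain a b where x: "b \<notin> supp P" "x = fraction P a b" using x by (rule residue_field_cases)
      have "fraction P (- a) b \<oplus>\<^bsub>?R\<^esub> x = \<zero>\<^bsub>?R\<^esub>"
        unfolding x(2) residue_field_zero residue_field_add[OF x(1) x(1)]
        by (rule fraction_eqI) (use x(1) in \<open>auto simp: residue_field_ops algebra_simps\<close>)
      then show ?thesis using x(1) fraction_closed by blast
    qed
  qed (auto simp: residue_field_ops fraction_closed algebra_simps
      elim!: residue_field_cases intro!: fraction_eqI)
  moreover have "comm_monoid ?R"
    by (rule comm_monoidI) (auto simp: residue_field_ops fraction_closed algebra_simps
      elim!: residue_field_cases intro!: fraction_eqI)
  ultimately have "cring ?R"
  proof (rule cringI)
    fix x y z assume xyz: "x \<in> carrier ?R" "y \<in> carrier ?R" "z \<in> carrier ?R"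
    obtain a b where x: "b \<notin> supp P" "x = fraction P a b" using xyz(1) by (rule residue_field_cases)
    obtain c d where y: "d \<notin> supp P" "y = fraction P c d" using xyz(2) by (rule residue_field_cases)
    obtain e f where z: "f \<notin> supp P" "z = fraction P e f" using xyz(3) by (rule residue_field_cases)
    show "(x \<oplus>\<^bsub>?R\<^esub> y) \<otimes>\<^bsub>?R\<^esub> z = x \<otimes>\<^bsub>?R\<^esub> z \<oplus>\<^bsub>?R\<^esub> y \<otimes>\<^bsub>?R\<^esub> z"
      using x(1) y(1) z(1) unfolding x(2) y(2) z(2)
      by (simp only: residue_field_ops not_False_eq_True)
        (rule fraction_eqI, auto simp: supp_prime algebra_simps)
  qed
  then show ?thesis
  proof (rule cring.cring_fieldI2)
    show "\<zero>\<^bsub>?R\<^esub> \<noteq> \<one>\<^bsub>?R\<^esub>"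
      using fraction_eq_iff[OF one_not_supp one_not_supp, of 0 1] supp_closed(3)[of "- 1"] one_not_supp
      by (auto simp: residue_field_ops)
    fix x assume "x \<in> carrier ?R" "x \<noteq> \<zero>\<^bsub>?R\<^esub>"
    moreover from this obtain a b where x: "b \<notin> supp P" "x = fraction P a b" by (elim residue_field_cases)
    ultimately have a: "a \<notin> supp P"
      using fraction_eq_iff[OF x(1) one_not_supp, of a 0] by (simp add: residue_field_zero)
    have "x \<otimes>\<^bsub>?R\<^esub> fraction P b a = \<one>\<^bsub>?R\<^esub>"
      unfolding x(2) residue_field_one residue_field_mult[OF x(1) a]
      by (rule fraction_eqI) (use x(1) a in \<open>auto simp: supp_prime one_not_supp mult.commute\<close>)
    then show "\<exists>y\<in>carrier ?R. x \<otimes>\<^bsub>?R\<^esub> y = \<one>\<^bsub>?R\<^esub>" using a fraction_closed by blast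
  qed
qed

lemma residue_field_hom: "(\<lambda>a. fraction P a 1) \<in> ring_hom class_ring (residue_field P)"
  using one_not_supp by (auto simp: ring_hom_def class_ring_simps fraction_closed residue_field_ops intro!: fraction_eqI)

lemma residue_field_kernel: "fraction P a 1 = \<zero>\<^bsub>residue_field P\<^esub> \<longleftrightarrow> a \<in> supp P"
  using fraction_eq_iff[OF one_not_supp one_not_supp, of a 0] by (simp add: residue_field_zero)

end

section \<open>Encoding an algebraic closure by lists\<close>

text \<open>Zeros up to the first 1 are a self-delimiting unary code for a natural number, needing
  only two distinct letters. It records the position of a root in front of a list of
  coefficients.\<close>

lemma unary_prefix_inj:
  "replicate m 0 @ 1 # xs = replicate n 0 @ (1 :: 'a::zero_neq_one) # ys \<Longrightarrow> m = n \<and> xs = ys"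
proof (induction m arbitrary: n)
  case 0
  then show ?case by (cases n) auto
next
  case (Suc m)
  then show ?case by (cases n) auto
qed

text \<open>Every entry occupies exactly two letters, so the concatenated word can be cut apart
  again.\<close>

lemma concat_pairs_inj:
  assumes "concat (map (\<lambda>y. [fst (r y), snd (r y)]) xs) = concat (map (\<lambda>y. [fst (r y), snd (r y)]) ys)"
    and "inj_on r A" "set xs \<subseteq> A" "set ys \<subseteq> A"
  shows "xs = ys"
  using assms(1,3,4)
proof (induction xs arbitrary: ys)
  case Nil
  then show ?case by (cases ys) auto
next
  case (Cons x xs)
  then obtain y ys' where ys: "ys = y # ys'" by (cases ys) auto
  have "r x = r y" using Cons.prems(1) ys by (simp add: prod_eq_iff)
  then have "x = y" using assms(2) Cons.prems ys by (auto dest: inj_onD)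
  moreover have "xs = ys'" using Cons ys by simp
  ultimately show ?case using ys by simp
qed

text \<open>An element of an algebraic extension is determined by a polynomial over the base field and
  its position in the finite set of roots of that polynomial.\<close>

lemma (in algebraic_closure) exists_list_encoding:
  fixes r :: "'a \<Rightarrow> 'c::zero_neq_one \<times> 'c"
  assumes "inj_on r K"
  shows "\<exists>enc :: 'a \<Rightarrow> 'c list. inj_on enc (carrier L)"
proof -
  note sr = subfieldE(1)[OF subfield_axioms]
  have "\<forall>x\<in>carrier L. \<exists>p. p \<in> carrier (K[X]) \<and> p \<noteq> [] \<and> eval p x = \<zero>"
    using algebraicE[OF sr] algebraic_extension unfolding over_def by metis
  from bchoice[OF this] obtain pol where pol: "\<And>x. x \<in> carrier L \<Longrightarrow> pol x \<in> carrier (K[X])"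
    "\<And>x. x \<in> carrier L \<Longrightarrow> pol x \<noteq> []" "\<And>x. x \<in> carrier L \<Longrightarrow> eval (pol x) x = \<zero>"
    by blast
  have "\<exists>ix :: 'a \<Rightarrow> nat. inj_on ix {x. is_root p x}" if "p \<in> carrier (K[X])" for p
    using finite_imp_inj_to_nat_seg[OF finite_number_of_roots[OF carrier_polynomial_shell[OF sr that]]] by auto
  then obtain ix :: "'a list \<Rightarrow> 'a \<Rightarrow> nat" where
    ix: "\<And>p. p \<in> carrier (K[X]) \<Longrightarrow> inj_on (ix p) {x. is_root p x}" by metis
  define enc where "enc x = replicate (ix (pol x) x) 0 @ 1 # concat (map (\<lambda>y. [fst (r y), snd (r y)]) (pol x))" for x
  have "inj_on enc (carrier L)"
  proof (rule inj_onI)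
    fix x y assume x: "x \<in> carrier L" and y: "y \<in> carrier L" and "enc x = enc y"
    then have *: "ix (pol x) x = ix (pol y) y"
      "concat (map (\<lambda>y. [fst (r y), snd (r y)]) (pol x)) = concat (map (\<lambda>y. [fst (r y), snd (r y)]) (pol y))"
      unfolding enc_def using unary_prefix_inj by blast+
    have "set (pol x) \<subseteq> K" "set (pol y) \<subseteq> K"
      using pol(1)[OF x] pol(1)[OF y] polynomial_incl unfolding univ_poly_carrier[symmetric] by blast+
    then have eq: "pol x = pol y" using concat_pairs_inj[OF *(2) assms] by blast
    have "is_root (pol x) x" "is_root (pol x) y"
      using pol(2,3)[OF x] pol(2,3)[OF y, folded eq] x y unfolding is_root_def by auto
    then show "x = y" using ix[OF pol(1)[OF x]] *(1) eq by (auto dest: inj_onD)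
  qed
  then show ?thesis by blast
qed

lemma (in algebraically_closed) exists_root_carrier:
  assumes "p \<in> carrier (poly_ring L)" "0 < length p - 1"
  shows "\<exists>x\<in>carrier L. eval p x = \<zero>"
proof -
  have "size (roots p) > 0" using roots_over_carrier[OF assms(1)] assms(2) unfolding splitted_def by simp
  then obtain x where "x \<in># roots p" by (metis gr_implies_not0 multiset_nonemptyE size_empty)
  then show ?thesis using roots_mem_iff_is_root[OF assms(1)] by (auto simp: is_root_def)
qed

text \<open>Needed to keep the existence of roots when a field is copied onto lists: coefficients
  are pulled back through \<open>h\<close>, and a root is pushed forward.\<close>

lemma (in field) image_ring_exists_root:
  assumes inj: "inj_on h (carrier R)"
    and roots: "\<And>p. p \<in> carrier (poly_ring R) \<Longrightarrow> 0 < length p - 1 \<Longrightarrow> \<exists>x\<in>carrier R. eval p x = \<zero>"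
    and p: "p \<in> carrier (poly_ring (image_ring h R))" "0 < length p - 1"
  shows "\<exists>x\<in>carrier (image_ring h R). ring.eval (image_ring h R) p x = \<zero>\<^bsub>image_ring h R\<^esub>"
proof -
  let ?S = "image_ring h R"
  interpret S: field ?S using inj_imp_image_ring_is_field[OF inj] .
  interpret h: ring_hom_ring R ?S h
    using ring_hom_ringI2[OF ring_axioms S.ring_axioms] inj_imp_image_ring_iso[OF inj]
    unfolding ring_iso_def by blast
  define q where "q = map (inv_into (carrier R) h) p"
  have sp: "set p \<subseteq> h ` carrier R" "p \<noteq> []" "hd p \<noteq> h \<zero>"
  proof -
    have "polynomial\<^bsub>?S\<^esub> (carrier ?S) p" using p(1) by (simp only: univ_poly_carrier)
    moreover show "p \<noteq> []" using p(2) by auto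
    ultimately show "set p \<subseteq> h ` carrier R" "hd p \<noteq> h \<zero>"
      unfolding polynomial_def image_ring_carrier image_ring_zero by blast+
  qed
  have hq: "map h q = p"
    unfolding q_def using sp(1) by (auto intro!: map_idI simp: f_inv_into_f)
  have sq: "set q \<subseteq> carrier R" unfolding q_def using sp(1) by (auto intro: inv_into_into)
  have "h (hd q) = hd p" using sp(2) hq by (metis hd_map list.map_disc_iff)
  then have "hd q \<noteq> \<zero>" using sp(3) by auto
  then have "q \<in> carrier (poly_ring R)" using sq unfolding univ_poly_carrier[symmetric] polynomial_def by auto
  moreover have "0 < length q - 1" using p(2) by (simp add: q_def)
  ultimately obtain x where x: "x \<in> carrier R" "eval q x = \<zero>" using roots by blast
  have "S.eval p (h x) = h (eval q x)" using h.eval_hom'[OF x(1) sq] hq by simp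
  then have "S.eval p (h x) = \<zero>\<^bsub>?S\<^esub>" using x(2) by simp
  moreover have "h x \<in> carrier ?S" using x(1) by (simp add: image_ring_carrier)
  ultimately show ?thesis by blast
qed

section \<open>Newton's identities and the trace form\<close>

context field begin

text \<open>The coefficients of \<open>\<Prod>x\<in>xs. (X - x)\<close>, indexed from the leading one as in the coefficient
  lists of HOL-Algebra polynomials.\<close>

fun esym :: "'a list \<Rightarrow> nat \<Rightarrow> 'a" where
  "esym [] j = (if j = 0 then \<one> else \<zero>)"
| "esym (x # xs) j = esym xs j \<ominus> x \<otimes> (case j of 0 \<Rightarrow> \<zero> | Suc i \<Rightarrow> esym xs i)"

fun psum :: "'a list \<Rightarrow> nat \<Rightarrow> 'a" where
  "psum [] m = \<zero>"
| "psum (x # xs) m = x [^] m \<oplus> psum xs m"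

fun nat_elem :: "nat \<Rightarrow> 'a" where
  "nat_elem 0 = \<zero>"
| "nat_elem (Suc m) = nat_elem m \<oplus> \<one>"

lemma nat_elem_closed [simp]: "nat_elem m \<in> carrier R"
  by (induction m) auto

lemma esym_closed [simp]: "set xs \<subseteq> carrier R \<Longrightarrow> esym xs j \<in> carrier R"
  by (induction xs arbitrary: j) (auto split: nat.split)

lemma psum_closed [simp]: "set xs \<subseteq> carrier R \<Longrightarrow> psum xs j \<in> carrier R"
  by (induction xs) auto

lemma esym_0 [simp]: "set xs \<subseteq> carrier R \<Longrightarrow> esym xs 0 = \<one>"
  by (induction xs) (auto simp: a_minus_def)

lemma psum_0: "psum xs 0 = nat_elem (length xs)"
proof (induction xs)
  case (Cons x xs)
  then show ?case by (simp add: a_comm)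
qed simp

lemma esym_above: "set xs \<subseteq> carrier R \<Longrightarrow> length xs < j \<Longrightarrow> esym xs j = \<zero>"
  by (induction xs arbitrary: j) (auto simp: a_minus_def split: nat.split)

text \<open>Adding a root \<open>x\<close> multiplies the polynomial by \<open>X - x\<close> and
  adds powers of \<open>x\<close> to the power sums. With \<open>V\<close> and \<open>U\<close> the
  convolutions of \<open>esym xs\<close> with the old power sums and with the powers of
  \<open>x\<close>, the new convolution at \<open>k + 1\<close> is
  \<open>(U + V) (k + 1) - x (U + V) k\<close>. Since
  \<open>U (k + 1) = esym xs (k + 1) + x U k\<close>, the powers of \<open>x\<close> leave only
  \<open>esym xs (k + 1)\<close>, and the induction hypothesis is used at \<open>k\<close> and at
  \<open>k + 1\<close>.\<close>

lemma newton_identity: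
  assumes "set xs \<subseteq> carrier R"
  shows "(\<Oplus>j\<in>{..m}. esym xs j \<otimes> psum xs (m - j)) \<oplus> nat_elem m \<otimes> esym xs m =
    nat_elem (length xs) \<otimes> esym xs m"
  using assms
proof (induction xs arbitrary: m)
  case Nil
  then show ?case by (cases m) simp_all
next
  case (Cons x xs)
  then have x: "x \<in> carrier R" and xs: "set xs \<subseteq> carrier R" by auto
  define V where "V m = (\<Oplus>j\<in>{..m}. esym xs j \<otimes> psum xs (m - j))" for m
  define U where "U m = (\<Oplus>j\<in>{..m}. esym xs j \<otimes> x [^] (m - j))" for m
  have UV: "U m \<in> carrier R" "V m \<in> carrier R" for m
    unfolding U_def V_def using x xs by (auto intro!: finsum_closed)
  have IH: "V m \<oplus> nat_elem m \<otimes> esym xs m = nat_elem (length xs) \<otimes> esym xs m" for m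
    using Cons.IH[OF xs] unfolding V_def .
  show ?case
  proof (cases m)
    case 0
    then show ?thesis using x xs by (simp add: psum_0 a_minus_def a_comm)
  next
    case (Suc k)
    have W: "(\<Oplus>j\<in>{..m}. esym xs j \<otimes> psum (x # xs) (m - j)) = U m \<oplus> V m" for m
    proof -
      have "(\<Oplus>j\<in>{..m}. esym xs j \<otimes> psum (x # xs) (m - j)) =
          (\<Oplus>j\<in>{..m}. esym xs j \<otimes> x [^] (m - j) \<oplus> esym xs j \<otimes> psum xs (m - j))"
        using x xs by (intro finsum_cong') (auto simp: r_distr)
      also have "\<dots> = U m \<oplus> V m"
        unfolding U_def V_def using x xs by (intro finsum_addf) auto
      finally show ?thesis .
    qed
    have US: "U (Suc k) = esym xs (Suc k) \<oplus> x \<otimes> U k"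
    proof -
      have "U (Suc k) = esym xs (Suc k) \<otimes> x [^] (Suc k - Suc k) \<oplus> (\<Oplus>j\<in>{..k}. esym xs j \<otimes> x [^] (Suc k - j))"
        unfolding U_def using x xs by (intro finsum_Suc) auto
      also have "(\<Oplus>j\<in>{..k}. esym xs j \<otimes> x [^] (Suc k - j)) = (\<Oplus>j\<in>{..k}. x \<otimes> (esym xs j \<otimes> x [^] (k - j)))"
      proof (rule finsum_cong')
        fix j assume "j \<in> {..k}"
        then have "Suc k - j = Suc (k - j)" by auto
        then have "x [^] (Suc k - j) = x [^] (k - j) \<otimes> x" by simp
        then show "esym xs j \<otimes> x [^] (Suc k - j) = x \<otimes> (esym xs j \<otimes> x [^] (k - j))"
          using x esym_closed[OF xs, of j] by (simp add: m_ac)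
      qed (use x xs in auto)
      also have "\<dots> = x \<otimes> U k" unfolding U_def using x xs by (intro finsum_rdistr[symmetric]) auto
      finally show ?thesis using x xs by simp
    qed
    have "(\<Oplus>j\<in>{..Suc k}. esym (x # xs) j \<otimes> psum (x # xs) (Suc k - j)) =
      (\<Oplus>j\<in>{..k}. esym (x # xs) (Suc j) \<otimes> psum (x # xs) (k - j)) \<oplus> psum (x # xs) (Suc k)"
      using x xs by (subst finsum_Suc2) (auto simp: a_minus_def split: nat.split)
    also have "(\<Oplus>j\<in>{..k}. esym (x # xs) (Suc j) \<otimes> psum (x # xs) (k - j)) =
      (\<Oplus>j\<in>{..k}. esym xs (Suc j) \<otimes> psum (x # xs) (k - j) \<oplus> (\<ominus> x) \<otimes> (esym xs j \<otimes> psum (x # xs) (k - j)))"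
    proof (rule finsum_cong')
      fix j assume "j \<in> {..k}"
      have "esym xs (Suc j) \<in> carrier R" "esym xs j \<in> carrier R" "psum (x # xs) (k - j) \<in> carrier R"
        using x xs by auto
      then show "esym (x # xs) (Suc j) \<otimes> psum (x # xs) (k - j) =
          esym xs (Suc j) \<otimes> psum (x # xs) (k - j) \<oplus> (\<ominus> x) \<otimes> (esym xs j \<otimes> psum (x # xs) (k - j))"
        using x unfolding esym.simps nat.case by algebra
    qed (use x xs in auto)
    also have "\<dots> = (\<Oplus>j\<in>{..k}. esym xs (Suc j) \<otimes> psum (x # xs) (k - j))
       \<oplus> (\<Oplus>j\<in>{..k}. (\<ominus> x) \<otimes> (esym xs j \<otimes> psum (x # xs) (k - j)))"
      using x xs by (intro finsum_addf) auto
    also have "(\<Oplus>j\<in>{..k}. (\<ominus> x) \<otimes> (esym xs j \<otimes> psum (x # xs) (k - j))) = (\<ominus> x) \<otimes> (U k \<oplus> V k)"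
      unfolding W[symmetric] using x xs by (intro finsum_rdistr[symmetric]) auto
    finally have A: "(\<Oplus>j\<in>{..Suc k}. esym (x # xs) j \<otimes> psum (x # xs) (Suc k - j)) =
       (\<Oplus>j\<in>{..k}. esym xs (Suc j) \<otimes> psum (x # xs) (k - j)) \<oplus> (\<ominus> x) \<otimes> (U k \<oplus> V k) \<oplus> psum (x # xs) (Suc k)" .
    have B: "U (Suc k) \<oplus> V (Suc k) = (\<Oplus>j\<in>{..k}. esym xs (Suc j) \<otimes> psum (x # xs) (k - j)) \<oplus> psum (x # xs) (Suc k)"
      unfolding W[symmetric] using x xs by (subst finsum_Suc2) auto
    define Z where "Z = (\<Oplus>j\<in>{..k}. esym xs (Suc j) \<otimes> psum (x # xs) (k - j))"
    define p where "p = psum (x # xs) (Suc k)"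
    have c: "Z \<in> carrier R" "p \<in> carrier R"
      unfolding Z_def p_def using x xs by (auto intro!: finsum_closed)
    note cl = UV(1)[of k] UV(2)[of k] UV(2)[of "Suc k"] x esym_closed[OF xs, of k] esym_closed[OF xs, of "Suc k"]
      nat_elem_closed[of k] nat_elem_closed[of "length xs"]
    have "(\<Oplus>j\<in>{..Suc k}. esym (x # xs) j \<otimes> psum (x # xs) (Suc k - j)) = (Z \<oplus> p) \<oplus> (\<ominus> x) \<otimes> (U k \<oplus> V k)"
      unfolding A Z_def[symmetric] p_def[symmetric] using c cl by algebra
    also have "\<dots> = (esym xs (Suc k) \<oplus> x \<otimes> U k \<oplus> V (Suc k)) \<oplus> (\<ominus> x) \<otimes> (U k \<oplus> V k)"
      using B US unfolding Z_def p_def by simp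
    also have "\<dots> = esym xs (Suc k) \<oplus> V (Suc k) \<ominus> x \<otimes> V k"
      using cl by algebra
    finally have C: "(\<Oplus>j\<in>{..Suc k}. esym (x # xs) j \<otimes> psum (x # xs) (Suc k - j)) =
      esym xs (Suc k) \<oplus> V (Suc k) \<ominus> x \<otimes> V k" .
    have "esym xs (Suc k) \<oplus> V (Suc k) \<ominus> x \<otimes> V k \<oplus> (nat_elem k \<oplus> \<one>) \<otimes> (esym xs (Suc k) \<ominus> x \<otimes> esym xs k) =
      esym xs (Suc k) \<oplus> (V (Suc k) \<oplus> (nat_elem k \<oplus> \<one>) \<otimes> esym xs (Suc k)) \<ominus> x \<otimes> (V k \<oplus> nat_elem k \<otimes> esym xs k) \<ominus> x \<otimes> esym xs k"
      using cl by algebra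
    also have "\<dots> = esym xs (Suc k) \<oplus> nat_elem (length xs) \<otimes> esym xs (Suc k) \<ominus> x \<otimes> (nat_elem (length xs) \<otimes> esym xs k) \<ominus> x \<otimes> esym xs k"
      unfolding IH[of k] IH[of "Suc k", unfolded nat_elem.simps] ..
    also have "\<dots> = (nat_elem (length xs) \<oplus> \<one>) \<otimes> (esym xs (Suc k) \<ominus> x \<otimes> esym xs k)"
      using cl by algebra
    finally show ?thesis unfolding Suc C by simp
  qed
qed

lemma linear_mult_coeff:
  assumes "a \<in> carrier R" "set q \<subseteq> carrier R"
  shows "coeff (poly_mult [\<one>, \<ominus> a] q) i = (case i of 0 \<Rightarrow> \<zero> | Suc l \<Rightarrow> coeff q l) \<ominus> a \<otimes> coeff q i"
proof -
  have s1: "set (map ((\<otimes>) \<one>) q @ [\<zero>]) \<subseteq> carrier R" "set (map ((\<otimes>) (\<ominus> a)) q) \<subseteq> carrier R"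
    using assms by auto
  have 2: "coeff (poly_mult [\<ominus> a] q) = coeff (map ((\<otimes>) (\<ominus> a)) q)"
  proof -
    have "coeff (poly_mult [\<ominus> a] q) = (\<lambda>i. coeff (map ((\<otimes>) (\<ominus> a)) q) i \<oplus> coeff [] i)"
      using poly_add_coeff[OF s1(2), of "[]"] by simp
    then show ?thesis using s1(2) coeff_in_carrier[OF s1(2)] by (simp del: coeff_in_carrier)
  qed
  have s3: "set (poly_mult [\<ominus> a] q) \<subseteq> carrier R"
    using poly_mult_in_carrier[of "[\<ominus> a]" q] assms by simp
  have "coeff (poly_mult [\<one>, \<ominus> a] q) i = coeff (map ((\<otimes>) \<one>) q @ [\<zero>]) i \<oplus> coeff (poly_mult [\<ominus> a] q) i"
    using poly_add_coeff[OF s1(1) s3] by simp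
  also have "map ((\<otimes>) \<one>) q = q" using assms(2) by (intro map_idI) auto
  also have "coeff (q @ [\<zero>]) i = (case i of 0 \<Rightarrow> \<zero> | Suc l \<Rightarrow> coeff q l)"
    by (simp add: append_coeff split: nat.split)
  also have "coeff (poly_mult [\<ominus> a] q) i = \<ominus> (a \<otimes> coeff q i)"
    unfolding 2 scalar_coeff[of "\<ominus> a" q, OF a_inv_closed[OF assms(1)]]
    using coeff_in_carrier[OF assms(2)] assms(1) by (simp add: l_minus del: coeff_in_carrier)
  finally show ?thesis by (simp add: a_minus_def)
qed

text \<open>Dividing out a factor \<open>X - a\<close> removes one root and matches the recursion of
  \<open>esym\<close>, by \<open>linear_mult_coeff\<close>.\<close>

lemma split_poly_esym:
  assumes "p \<in> carrier (poly_ring R)" "p \<noteq> []" "size (roots p) = length p - 1" "hd p = \<one>"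
  shows "\<exists>xs. mset xs = roots p \<and> set xs \<subseteq> carrier R \<and> (\<forall>j<length p. p ! j = esym xs j)"
  using assms
proof (induction "length p" arbitrary: p)
  case 0
  then show ?case by simp
next
  case (Suc n)
  show ?case
  proof (cases n)
    case 0
    then have "p = [\<one>]" using Suc.hyps(2) Suc.prems(4) by (cases p) auto
    moreover have "roots p = {#}" using Suc.prems(3) Suc.hyps(2) 0 by simp
    ultimately show ?thesis by (intro exI[of _ "[]"]) simp
  next
    case (Suc m)
    have "roots p \<noteq> {#}" using Suc.prems(3) Suc.hyps(2) Suc by auto
    then obtain a where a: "a \<in> carrier R" "[\<one>, \<ominus> a] \<in> carrier (poly_ring R)" "[\<one>, \<ominus> a] pdivides p"
      using not_empty_rootsE[OF Suc.prems(1)] by metis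
    then obtain q where q: "q \<in> carrier (poly_ring R)" "p = [\<one>, \<ominus> a] \<otimes>\<^bsub>poly_ring R\<^esub> q"
      unfolding pdivides_def by (elim dividesE)
    have p: "p = poly_mult [\<one>, \<ominus> a] q" using q(2) by (simp add: univ_poly_mult)
    have q0: "q \<noteq> []"
      using poly_mult_zero[of "[\<one>, \<ominus> a]"] p Suc.prems(2) a(1) by auto
    have pol: "polynomial (carrier R) [\<one>, \<ominus> a]" "polynomial (carrier R) q"
      using a(2) q(1) by (simp_all add: univ_poly_carrier)
    have len: "length p - 1 = 1 + (length q - 1)" "hd p = hd q"
    proof -
      show "length p - 1 = 1 + (length q - 1)"
        using poly_mult_degree_eq[OF carrier_is_subring pol, folded p] q0 by simp
      have "hd q \<in> carrier R"
        using polynomial_in_carrier[OF carrier_is_subring pol(2)] q0 by (cases q) auto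
      then show "hd p = hd q"
        using poly_mult_lead_coeff[OF carrier_is_subring pol, folded p] q0 by simp
    qed
    then have lq: "length q = n" using Suc.hyps(2) q0 by (cases q) auto
    have roots: "roots p = add_mset a (roots q)"
      unfolding q(2) by (rule poly_mult_degree_one_monic_imp_same_roots[OF a(1) q(1) q0])
    have "size (roots q) = length q - 1" using Suc.prems(3) len(1) roots by simp
    then obtain xs where xs: "mset xs = roots q" "set xs \<subseteq> carrier R" "\<And>j. j < length q \<Longrightarrow> q ! j = esym xs j"
      using Suc.hyps(1)[of q] lq q(1) q0 len(2) Suc.prems(4) by auto
    have lxs: "length xs = m" using xs(1) \<open>size (roots q) = _\<close> lq Suc by (metis diff_Suc_1 size_mset)
    have "p ! j = esym (a # xs) j" if j: "j < length p" for j
    proof -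
      note sq = polynomial_in_carrier[OF carrier_is_subring pol(2)]
      have cq: "coeff q (n - 1 - j) = esym xs j" if "j < n" for j
        using coeff_nth[of "n - 1 - j" q] xs(3)[of j] lq that by simp
      have "p ! j = coeff p (n - j)" using coeff_nth[of "n - j" p] Suc.hyps(2) j by simp
      also have "\<dots> = (case n - j of 0 \<Rightarrow> \<zero> | Suc l \<Rightarrow> coeff q l) \<ominus> a \<otimes> coeff q (n - j)"
        unfolding p by (rule linear_mult_coeff[OF a(1) sq])
      \<comment> \<open>The boundary case \<open>j = n\<close> is consistent because
        \<open>xs\<close> has only \<open>n - 1\<close> entries, so \<open>esym xs n\<close>
        vanishes.\<close>
      also have "(case n - j of 0 \<Rightarrow> \<zero> | Suc l \<Rightarrow> coeff q l) = esym xs j"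
      proof (cases "j = n")
        case True
        then show ?thesis using esym_above[OF xs(2)] lxs Suc by simp
      next
        case False
        then have "j < n" using j Suc.hyps(2) by simp
        then have "n - j = Suc (n - 1 - j)" by simp
        then show ?thesis using cq[OF \<open>j < n\<close>] by simp
      qed
      also have "coeff q (n - j) = (case j of 0 \<Rightarrow> \<zero> | Suc i \<Rightarrow> esym xs i)"
      proof (cases j)
        case 0
        then show ?thesis using coeff_length[of q n] lq by simp
      next
        case (Suc i)
        then have "n - j = n - 1 - i" "i < n" using j Suc.hyps(2) by auto
        then show ?thesis using cq Suc by simp
      qed
      finally show ?thesis by simp
    qed
    then show ?thesis using roots xs(1,2) a(1) by (intro exI[of _ "a # xs"]) simp
  qed
qed

text \<open>A polynomial of degree below \<open>n\<close> with \<open>n\<close> distinct zeros is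
  zero. This is where the simplicity of the zeros of \<open>f\<close> is eventually used.\<close>

lemma poly_vanishing_at_distinct:
  assumes v: "\<And>i. i < n \<Longrightarrow> v i \<in> carrier R" and xs: "distinct xs" "length xs = n" "set xs \<subseteq> carrier R"
    and zero: "\<And>x. x \<in> set xs \<Longrightarrow> (\<Oplus>i\<in>{..<n}. v i \<otimes> x [^] i) = \<zero>"
  shows "\<forall>i<n. v i = \<zero>"
proof -
  \<comment> \<open>Coefficient lists start with the leading coefficient, hence the reversal. The
    top entries may be zero, so \<open>normalize\<close> is required before \<open>l n\<close>
    counts as a polynomial.\<close>
  define l where "l k = rev (map v [0..<k])" for k
  have l: "set (l k) \<subseteq> carrier R" "length (l k) = k" if "k \<le> n" for k
    using v that by (auto simp: l_def)
  have ev: "eval (l k) x = (\<Oplus>i\<in>{..<k}. v i \<otimes> x [^] i)" if "k \<le> n" "x \<in> carrier R" for k x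
    using that
  proof (induction k)
    case 0
    then show ?case by (simp add: l_def)
  next
    case (Suc k)
    have "eval (l (Suc k)) x = v k \<otimes> x [^] k \<oplus> eval (l k) x" by (simp add: l_def)
    then show ?case using Suc v by (simp add: lessThan_Suc finsum_insert Pi_def)
  qed
  define g where "g = normalize (l n)"
  have g: "g \<in> carrier (poly_ring R)"
    using normalize_gives_polynomial[OF l(1)[OF order_refl]] by (simp add: g_def univ_poly_carrier)
  have "g = []"
  proof (rule ccontr)
    assume g0: "g \<noteq> []"
    have "is_root g x" if "x \<in> set xs" for x
      using that xs(3) zero ev[of n x] eval_normalize[OF l(1)[OF order_refl], of x] g0 by (auto simp: is_root_def g_def)
    then have "set xs \<subseteq> set_mset (roots g)" using roots_mem_iff_is_root[OF g] by auto
    then have "card (set xs) \<le> card (set_mset (roots g))" by (intro card_mono) auto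
    also have "\<dots> \<le> size (roots g)" by (metis card_length ex_mset set_mset_mset size_mset)
    also have "\<dots> \<le> length g - 1" by (rule size_roots_le_degree[OF g])
    also have "length g - 1 < length g" using g0 by simp
    also have "length g \<le> n" using normalize_length_le[of "l n"] l(2) by (simp add: g_def)
    finally show False using xs distinct_card by fastforce
  qed
  then have "coeff (l n) = (\<lambda>_. \<zero>)" using normalize_coeff[of "l n"] by (auto simp: g_def)
  then have "set (l n) \<subseteq> {\<zero>}" using coeff_img(1)[of "l n"] by auto
  then show ?thesis by (auto simp: l_def image_subset_iff)
qed

section \<open>Homomorphic images of the power sums\<close>

context
  fixes \<phi> :: "'c::comm_ring_1 \<Rightarrow> 'a" assumes \<phi>: "\<phi> \<in> ring_hom class_ring R"
begin

lemma class_hom_simps: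
  "\<phi> a \<in> carrier R" "\<phi> (a + b) = \<phi> a \<oplus> \<phi> b" "\<phi> (a * b) = \<phi> a \<otimes> \<phi> b" "\<phi> 1 = \<one>"
  "\<phi> 0 = \<zero>" "\<phi> (- a) = \<ominus> \<phi> a" "\<phi> (a - b) = \<phi> a \<ominus> \<phi> b"
proof -
  show cl: "\<phi> a \<in> carrier R" and add: "\<phi> (a + b) = \<phi> a \<oplus> \<phi> b" and "\<phi> (a * b) = \<phi> a \<otimes> \<phi> b" "\<phi> 1 = \<one>" for a b
    using \<phi> by (auto simp: ring_hom_def class_ring_simps)
  show zero: "\<phi> 0 = \<zero>" using add[of 0 0] cl by (metis add.r_cancel_one' add_0)
  show minus: "\<phi> (- a) = \<ominus> \<phi> a" for a
    using add[of "- a" a] zero cl by (metis add.left_inverse minus_equality)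
  show "\<phi> (a - b) = \<phi> a \<ominus> \<phi> b" using add[of a "- b"] minus by (simp add: a_minus_def)
qed

lemma class_hom_sum: "\<phi> (\<Sum>j<k::nat. g j) = (\<Oplus>j\<in>{..<k}. \<phi> (g j))"
proof (induction k)
  case (Suc k)
  then show ?case by (simp add: class_hom_simps lessThan_Suc finsum_insert Pi_def a_comm)
qed (simp add: class_hom_simps)

lemma class_hom_of_nat: "\<phi> (of_nat m) = nat_elem m"
  by (induction m) (simp_all add: class_hom_simps a_comm)

text \<open>Both sides obey Newton's recursion: in \<open>newton_identity\<close> the summand for
  \<open>j = 0\<close> is \<open>psum xs m\<close> itself, and solving for it gives the defining
  equation of \<open>power_sum\<close>.\<close>

lemma class_hom_power_sum:
  assumes xs: "set xs \<subseteq> carrier R" "length xs = Polynomial.degree f"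
    and co: "\<And>j. \<phi> (rev_coeff f j) = esym xs j"
  shows "\<phi> (power_sum f m) = psum xs m"
proof (induction m rule: less_induct)
  case (less m)
  define T where "T = (\<Oplus>j\<in>{..<m}. esym xs (Suc j) \<otimes> psum xs (m - Suc j))"
  have T: "T \<in> carrier R" unfolding T_def using xs(1) by (intro finsum_closed) auto
  have V: "(\<Oplus>j\<in>{..m}. esym xs j \<otimes> psum xs (m - j)) = T \<oplus> psum xs m"
  proof (cases m)
    case 0
    then show ?thesis using xs(1) by (simp add: T_def)
  next
    case (Suc k)
    have "(\<Oplus>j\<in>{..Suc k}. esym xs j \<otimes> psum xs (Suc k - j)) =
       (\<Oplus>j\<in>{..k}. esym xs (Suc j) \<otimes> psum xs (Suc k - Suc j)) \<oplus> esym xs 0 \<otimes> psum xs (Suc k - 0)"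
      using xs(1) by (intro finsum_Suc2) auto
    then show ?thesis using xs(1) by (simp add: T_def Suc lessThan_Suc_atMost)
  qed
  have "\<phi> (\<Sum>j<m. rev_coeff f (Suc j) * power_sum f (m - Suc j)) = T"
    unfolding class_hom_sum T_def using xs(1) less by (intro finsum_cong') (auto simp: class_hom_simps co)
  then have "\<phi> (power_sum f m) = (nat_elem (length xs) \<ominus> nat_elem m) \<otimes> esym xs m \<ominus> T"
    by (subst power_sum.simps) (simp add: class_hom_simps class_hom_of_nat co xs(2))
  also have "\<dots> = nat_elem (length xs) \<otimes> esym xs m \<ominus> nat_elem m \<otimes> esym xs m \<ominus> T"
    using T nat_elem_closed[of m] nat_elem_closed[of "length xs"] esym_closed[OF xs(1), of m] by algebra
  also have "\<dots> = (T \<oplus> psum xs m \<oplus> nat_elem m \<otimes> esym xs m) \<ominus> nat_elem m \<otimes> esym xs m \<ominus> T"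
    unfolding newton_identity[OF xs(1), symmetric] V ..
  also have "\<dots> = psum xs m"
    using T nat_elem_closed[of m] esym_closed[OF xs(1), of m] psum_closed[OF xs(1), of m] by algebra
  finally show ?case .
qed

end

text \<open>The left side is additive in the list of points, and for a single point it is the
  expanded square of \<open>\<Sum> v i x^i\<close>.\<close>

lemma trace_form:
  assumes v: "\<And>i. v i \<in> carrier R" and xs: "set xs \<subseteq> carrier R"
  shows "(\<Oplus>i\<in>{..<n}. \<Oplus>j\<in>{..<n}. psum xs (i + j) \<otimes> (v i \<otimes> v j)) =
    foldr (\<lambda>y s. y \<otimes> y \<oplus> s) (map (\<lambda>x. \<Oplus>i\<in>{..<n}. v i \<otimes> x [^] i) xs) \<zero>"
  using xs
proof (induction xs)
  case Nil
  then show ?case using v by (simp add: finsum_zero)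
next
  case (Cons x xs)
  then have x: "x \<in> carrier R" and xs: "set xs \<subseteq> carrier R" by auto
  define y where "y = (\<Oplus>i\<in>{..<n}. v i \<otimes> x [^] i)"
  have y: "y \<in> carrier R" unfolding y_def using v x by (intro finsum_closed) auto
  have sq: "y \<otimes> y = (\<Oplus>i\<in>{..<n}. \<Oplus>j\<in>{..<n}. x [^] (i + j) \<otimes> (v i \<otimes> v j))"
  proof -
    have "y \<otimes> y = (\<Oplus>i\<in>{..<n}. (v i \<otimes> x [^] i) \<otimes> y)"
      by (subst (1) y_def) (use v x y in \<open>intro finsum_ldistr; auto\<close>)
    also have "\<dots> = (\<Oplus>i\<in>{..<n}. \<Oplus>j\<in>{..<n}. x [^] (i + j) \<otimes> (v i \<otimes> v j))"
    proof (rule finsum_cong')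
      fix i :: nat
      have "(v i \<otimes> x [^] i) \<otimes> y = (\<Oplus>j\<in>{..<n}. (v i \<otimes> x [^] i) \<otimes> (v j \<otimes> x [^] j))"
        unfolding y_def using v x by (intro finsum_rdistr) auto
      also have "\<dots> = (\<Oplus>j\<in>{..<n}. x [^] (i + j) \<otimes> (v i \<otimes> v j))"
      proof (rule finsum_cong')
        fix j :: nat
        have "x [^] i \<in> carrier R" "x [^] j \<in> carrier R" using x by auto
        then show "v i \<otimes> x [^] i \<otimes> (v j \<otimes> x [^] j) = x [^] (i + j) \<otimes> (v i \<otimes> v j)"
          using v[of i] v[of j] unfolding nat_pow_mult[OF x, symmetric] by algebra
      qed (use v x in auto)
      finally show "(v i \<otimes> x [^] i) \<otimes> y = (\<Oplus>j\<in>{..<n}. x [^] (i + j) \<otimes> (v i \<otimes> v j))" .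
    qed (use v x in \<open>auto intro!: finsum_closed\<close>)
    finally show ?thesis .
  qed
  have "(\<Oplus>i\<in>{..<n}. \<Oplus>j\<in>{..<n}. psum (x # xs) (i + j) \<otimes> (v i \<otimes> v j)) =
     (\<Oplus>i\<in>{..<n}. (\<Oplus>j\<in>{..<n}. x [^] (i + j) \<otimes> (v i \<otimes> v j)) \<oplus> (\<Oplus>j\<in>{..<n}. psum xs (i + j) \<otimes> (v i \<otimes> v j)))"
  proof (rule finsum_cong')
    fix i
    have "(\<Oplus>j\<in>{..<n}. psum (x # xs) (i + j) \<otimes> (v i \<otimes> v j)) =
      (\<Oplus>j\<in>{..<n}. x [^] (i + j) \<otimes> (v i \<otimes> v j) \<oplus> psum xs (i + j) \<otimes> (v i \<otimes> v j))"
      using v x xs by (intro finsum_cong') (auto simp: l_distr)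
    also have "\<dots> = (\<Oplus>j\<in>{..<n}. x [^] (i + j) \<otimes> (v i \<otimes> v j)) \<oplus> (\<Oplus>j\<in>{..<n}. psum xs (i + j) \<otimes> (v i \<otimes> v j))"
      using v x xs by (intro finsum_addf) auto
    finally show "(\<Oplus>j\<in>{..<n}. psum (x # xs) (i + j) \<otimes> (v i \<otimes> v j)) =
      (\<Oplus>j\<in>{..<n}. x [^] (i + j) \<otimes> (v i \<otimes> v j)) \<oplus> (\<Oplus>j\<in>{..<n}. psum xs (i + j) \<otimes> (v i \<otimes> v j))" .
  qed (use v x xs in \<open>auto intro!: finsum_closed\<close>)
  also have "\<dots> = y \<otimes> y \<oplus> (\<Oplus>i\<in>{..<n}. \<Oplus>j\<in>{..<n}. psum xs (i + j) \<otimes> (v i \<otimes> v j))"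
    unfolding sq using v x xs by (intro finsum_addf) (auto intro!: finsum_closed)
  finally show ?case using Cons.IH[OF xs] by (simp add: y_def)
qed

text \<open>Dividing a vanishing sum of squares by the square of a nonzero entry would exhibit
  \<open>- 1\<close> as the sum of the remaining squares.\<close>

lemma sum_squares_eq_zero:
  assumes real: "\<And>xs. set xs \<subseteq> carrier R \<Longrightarrow> foldr (\<lambda>x s. x \<otimes> x \<oplus> s) xs \<zero> \<noteq> \<ominus> \<one>"
    and ys: "set ys \<subseteq> carrier R" "foldr (\<lambda>x s. x \<otimes> x \<oplus> s) ys \<zero> = \<zero>" and y: "y \<in> set ys"
  shows "y = \<zero>"
proof (rule ccontr)
  assume y0: "y \<noteq> \<zero>"
  let ?S = "\<lambda>zs. foldr (\<lambda>x s. x \<otimes> x \<oplus> s) zs \<zero>"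
  have cl: "?S zs \<in> carrier R" if "set zs \<subseteq> carrier R" for zs
    using that by (induction zs) auto
  obtain as bs where split: "ys = as @ y # bs" using y by (meson split_list)
  have yc: "y \<in> carrier R" and ab: "set (as @ bs) \<subseteq> carrier R" using ys(1) split by auto
  have move: "?S (as @ y # bs) = y \<otimes> y \<oplus> ?S (as @ bs)" if "set (as @ bs) \<subseteq> carrier R" for as bs
    using that
  proof (induction as)
    case (Cons a as)
    then have "a \<in> carrier R" "?S (as @ bs) \<in> carrier R" using cl[of "as @ bs"] by auto
    then show ?case using Cons yc by (simp add: a_lcomm)
  qed simp
  have i: "inv y \<in> carrier R" "inv y \<otimes> y = \<one>" using yc y0 field_Units by auto
  have scale: "?S (map ((\<otimes>) c) zs) = c \<otimes> c \<otimes> ?S zs" if c: "c \<in> carrier R" and zs: "set zs \<subseteq> carrier R" for c zs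
    using zs
  proof (induction zs)
    case (Cons z zs)
    have z: "z \<in> carrier R" using Cons.prems by simp
    have "(c \<otimes> z) \<otimes> (c \<otimes> z) \<oplus> c \<otimes> c \<otimes> t = c \<otimes> c \<otimes> (z \<otimes> z \<oplus> t)" if t: "t \<in> carrier R" for t
      using c z t by algebra
    from this[of "?S zs"] show ?case using Cons cl[of zs] by simp
  qed (use c in simp)
  have S: "?S (as @ bs) \<in> carrier R" by (rule cl[OF ab])
  have "y \<otimes> y \<oplus> ?S (as @ bs) = \<zero>" using ys(2) split move[OF ab] by simp
  then have "?S (as @ bs) = \<ominus> (y \<otimes> y)" using S yc by (metis a_comm m_closed minus_equality)
  then have "?S (map ((\<otimes>) (inv y)) (as @ bs)) = inv y \<otimes> inv y \<otimes> (\<ominus> (y \<otimes> y))"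
    using scale[OF i(1) ab] by simp
  also have "\<dots> = \<ominus> ((inv y \<otimes> y) \<otimes> (inv y \<otimes> y))" using i(1) yc by algebra
  also have "\<dots> = \<ominus> \<one>" using i(2) by simp
  finally show False using real[of "map ((\<otimes>) (inv y)) (as @ bs)"] ab i(1) by auto
qed

end

section \<open>Real closures\<close>

text \<open>In the application \<open>L\<close> is an algebraic closure of the residue field at
  \<open>P\<close>. The condition on the kernel lets the ordering pass from \<open>P\<close> to the
  image.\<close>

locale ordered_hom = field L for L (structure) +
  fixes \<phi> :: "'c::comm_ring_1 \<Rightarrow> 'a" and P :: "'c set"
  assumes hom: "\<phi> \<in> ring_hom class_ring L" and P: "prime_cone P" and kernel: "\<phi> a = \<zero> \<longleftrightarrow> a \<in> supp P"
begin

lemmas hom_simps [simp] = class_hom_simps[OF hom]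

lemmas P_closed = preorderingD[OF prime_coneD(1)[OF P]]

text \<open>The weights from \<open>P\<close> make \<open>\<ominus> \<one> \<notin> wsos E\<close> a
  condition on the given ordering, not merely on some ordering of \<open>E\<close>. They are the
  reason why the image of \<open>P\<close> consists of squares in a maximal
  \<open>E\<close>.\<close>

inductive_set wsos :: "'a set \<Rightarrow> 'a set" for E where
  zero: "\<zero> \<in> wsos E"
| add: "p \<in> P \<Longrightarrow> e \<in> E \<Longrightarrow> t \<in> wsos E \<Longrightarrow> \<phi> p \<otimes> (e \<otimes> e) \<oplus> t \<in> wsos E"

definition over_image :: "'a set \<Rightarrow> bool" where
  "over_image E \<longleftrightarrow> subfield E L \<and> range \<phi> \<subseteq> E"

context
  fixes E assumes E: "over_image E"
begin

lemma over_image_subfield: "subfield E L" and over_image_mem: "\<phi> a \<in> E"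
  using E by (auto simp: over_image_def)

lemma over_image_closed:
  "a \<in> E \<Longrightarrow> a \<in> carrier L" "\<zero> \<in> E" "\<one> \<in> E" "a \<in> E \<Longrightarrow> b \<in> E \<Longrightarrow> a \<oplus> b \<in> E"
  "a \<in> E \<Longrightarrow> b \<in> E \<Longrightarrow> a \<otimes> b \<in> E" "a \<in> E \<Longrightarrow> \<ominus> a \<in> E" "a \<in> E \<Longrightarrow> b \<in> E \<Longrightarrow> a \<ominus> b \<in> E"
  using subfieldE[OF over_image_subfield] subringE[OF subfieldE(1)[OF over_image_subfield]] by (auto simp: a_minus_def)

lemma over_image_inv: "a \<in> E \<Longrightarrow> a \<noteq> \<zero> \<Longrightarrow> inv a \<in> E" "a \<in> E \<Longrightarrow> a \<noteq> \<zero> \<Longrightarrow> a \<otimes> inv a = \<one>"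
  using subfield_m_inv[OF over_image_subfield] by auto

lemma wsos_in: "t \<in> wsos E \<Longrightarrow> t \<in> E"
  by (induction rule: wsos.induct) (auto intro: over_image_closed over_image_mem)

lemma wsos_carrier: "t \<in> wsos E \<Longrightarrow> t \<in> carrier L"
  using wsos_in over_image_closed by blast

lemma wsos_add: "s \<in> wsos E \<Longrightarrow> t \<in> wsos E \<Longrightarrow> s \<oplus> t \<in> wsos E"
proof (induction rule: wsos.induct)
  case (add p e u)
  then show ?case using wsos.add[of p e E "u \<oplus> t"]
    by (simp add: a_assoc wsos_carrier over_image_closed)
qed (simp add: wsos_carrier)

lemma wsos_scale:
  assumes "p \<in> P" "e \<in> E" "t \<in> wsos E"
  shows "\<phi> p \<otimes> (e \<otimes> e) \<otimes> t \<in> wsos E"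
  using assms(3)
proof (induction rule: wsos.induct)
  case zero
  then show ?case using assms by (simp add: over_image_closed wsos.zero)
next
  case (add q d u)
  have "\<phi> p \<otimes> (e \<otimes> e) \<otimes> (\<phi> q \<otimes> (d \<otimes> d) \<oplus> u) = \<phi> (p * q) \<otimes> ((e \<otimes> d) \<otimes> (e \<otimes> d)) \<oplus> \<phi> p \<otimes> (e \<otimes> e) \<otimes> u"
    using assms(2) add over_image_closed(1)[of e] over_image_closed(1)[of d] wsos_carrier[of u] hom_simps(1)[of p] hom_simps(1)[of q]
    unfolding hom_simps(3) by algebra
  moreover have "\<phi> (p * q) \<otimes> ((e \<otimes> d) \<otimes> (e \<otimes> d)) \<oplus> \<phi> p \<otimes> (e \<otimes> e) \<otimes> u \<in> wsos E"
    using add assms by (intro wsos.add P_closed over_image_closed)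
  ultimately show ?case by simp
qed

lemma wsos_square: "p \<in> P \<Longrightarrow> e \<in> E \<Longrightarrow> \<phi> p \<otimes> (e \<otimes> e) \<in> wsos E"
  using wsos.add[OF _ _ wsos.zero, of p e E] by (simp add: over_image_closed)

lemma wsos_1: "\<one> \<in> wsos E"
  using wsos_square[of 1 \<one>] P_closed by (simp add: over_image_closed)

lemma square_wsos: "e \<in> E \<Longrightarrow> e \<otimes> e \<in> wsos E"
  using wsos_square[of 1 e] P_closed by (simp add: over_image_closed)

lemma image_wsos: "p \<in> P \<Longrightarrow> \<phi> p \<in> wsos E"
  using wsos_square[of p \<one>] by (simp add: over_image_closed)

lemma wsos_mult:
  assumes "s \<in> wsos E" "t \<in> wsos E" shows "s \<otimes> t \<in> wsos E"
  using assms
proof (induction rule: wsos.induct)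
  case zero
  then show ?case by (simp add: wsos.zero wsos_carrier)
next
  case (add p e u)
  then show ?case
    by (subst l_distr) (auto intro!: wsos_add wsos_scale simp: wsos_carrier over_image_closed)
qed

text \<open>For nonzero \<open>t\<close>, dividing the product of \<open>t\<close> and
  \<open>\<ominus> t\<close> by \<open>t^2\<close> would put \<open>\<ominus> \<one>\<close> into
  \<open>wsos E\<close>.\<close>

lemma formally_real_antisym:
  assumes "\<ominus> \<one> \<notin> wsos E" "t \<in> wsos E" "\<ominus> t \<in> wsos E"
  shows "t = \<zero>"
proof (rule ccontr)
  assume t0: "t \<noteq> \<zero>"
  have t: "t \<in> E" using assms wsos_in by blast
  note i = over_image_inv[OF t t0]
  have "(t \<otimes> (\<ominus> t)) \<otimes> (inv t \<otimes> inv t) \<in> wsos E"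
    using assms i by (intro wsos_mult square_wsos)
  moreover have "(t \<otimes> (\<ominus> t)) \<otimes> (inv t \<otimes> inv t) = \<ominus> ((t \<otimes> inv t) \<otimes> (t \<otimes> inv t))"
    using over_image_closed(1)[OF t] over_image_closed(1)[OF i(1)] by algebra
  ultimately show False using assms(1) i(2) by simp
qed

text \<open>Expanding the squares of \<open>u + v s\<close> in a representation of -1 gives
  \<open>- 1 = t1 + s^2 t2 + z s\<close>. As \<open>s\<close> is not in \<open>E\<close>,
  \<open>z\<close> vanishes, and \<open>t2\<close> is nonzero since \<open>E\<close> is formally
  real; hence \<open>- s^2 = (1 + t1) / t2\<close>.\<close>

lemma sqrt_extension_formally_real:
  assumes real: "\<ominus> \<one> \<notin> wsos E" and s: "s \<in> carrier L" "s \<otimes> s \<in> E" "s \<notin> E"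
    and not: "\<ominus> \<one> \<in> wsos (simple_extension E s)"
  shows "\<ominus> (s \<otimes> s) \<in> wsos E"
proof -
  have elt: "\<exists>u\<in>E. \<exists>v\<in>E. y = u \<oplus> v \<otimes> s" if "y \<in> simple_extension E s" for y
    using that
  proof (induction rule: simple_extension.induct)
    case zero
    then show ?case using s(1) over_image_closed(2) by (intro bexI[of _ \<zero>]) auto
  next
    case (lin y k)
    then obtain u v where uv: "u \<in> E" "v \<in> E" "y = u \<oplus> v \<otimes> s" by blast
    have "y \<otimes> s \<oplus> k = (v \<otimes> (s \<otimes> s) \<oplus> k) \<oplus> u \<otimes> s"
      using uv(3) over_image_closed(1)[OF uv(1)] over_image_closed(1)[OF uv(2)] over_image_closed(1)[OF lin(2)] s(1) by algebra
    moreover have "v \<otimes> (s \<otimes> s) \<oplus> k \<in> E" using uv lin s over_image_closed by blast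
    ultimately show ?case using uv by blast
  qed
  have form: "\<exists>t1\<in>wsos E. \<exists>t2\<in>wsos E. \<exists>z\<in>E. t = t1 \<oplus> (s \<otimes> s) \<otimes> t2 \<oplus> z \<otimes> s"
    if "t \<in> wsos (simple_extension E s)" for t
    using that
  proof (induction rule: wsos.induct)
    case zero
    show ?case using s(1) over_image_closed(2) wsos.zero by (intro bexI[of _ \<zero>]) auto
  next
    case (add p e t)
    then obtain t1 t2 z where t: "t1 \<in> wsos E" "t2 \<in> wsos E" "z \<in> E" "t = t1 \<oplus> (s \<otimes> s) \<otimes> t2 \<oplus> z \<otimes> s"
      by blast
    obtain u v where uv: "u \<in> E" "v \<in> E" "e = u \<oplus> v \<otimes> s" using elt add by blast
    have "\<phi> p \<otimes> (e \<otimes> e) \<oplus> t = (\<phi> p \<otimes> (u \<otimes> u) \<oplus> t1) \<oplus> (s \<otimes> s) \<otimes> (\<phi> p \<otimes> (v \<otimes> v) \<oplus> t2) \<oplus> (\<phi> p \<otimes> (u \<otimes> v \<oplus> u \<otimes> v) \<oplus> z) \<otimes> s"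
      unfolding uv(3) t(4) using over_image_closed(1)[OF uv(1)] over_image_closed(1)[OF uv(2)] over_image_closed(1)[OF t(3)] s(1)
        wsos_carrier[OF t(1)] wsos_carrier[OF t(2)] hom_simps(1)[of p] by algebra
    moreover have "\<phi> p \<otimes> (u \<otimes> u) \<oplus> t1 \<in> wsos E" "\<phi> p \<otimes> (v \<otimes> v) \<oplus> t2 \<in> wsos E"
      using add t uv by (auto intro: wsos.add)
    moreover have "\<phi> p \<otimes> (u \<otimes> v \<oplus> u \<otimes> v) \<oplus> z \<in> E"
      using uv t(3) by (intro over_image_closed over_image_mem)
    ultimately show ?case by blast
  qed
  obtain t1 t2 z where t: "t1 \<in> wsos E" "t2 \<in> wsos E" "z \<in> E" "\<ominus> \<one> = t1 \<oplus> (s \<otimes> s) \<otimes> t2 \<oplus> z \<otimes> s"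
    using form[OF not] by blast
  have c: "t1 \<in> carrier L" "t2 \<in> carrier L" "z \<in> carrier L"
    using t over_image_closed(1) wsos_carrier by auto
  have zs: "z \<otimes> s = (\<ominus> \<one>) \<ominus> (t1 \<oplus> (s \<otimes> s) \<otimes> t2)"
    using t(4) c s(1) by algebra
  have "z = \<zero>"
  proof (rule ccontr)
    assume "z \<noteq> \<zero>"
    note i = over_image_inv[OF t(3) this]
    have "inv z \<otimes> ((\<ominus> \<one>) \<ominus> (t1 \<oplus> (s \<otimes> s) \<otimes> t2)) \<in> E"
      using i(1) s(2) t(1,2) by (simp add: over_image_closed(3-7) wsos_in)
    moreover have "inv z \<otimes> (z \<otimes> s) = (z \<otimes> inv z) \<otimes> s"
      using c s(1) over_image_closed(1)[OF i(1)] by algebra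
    ultimately show False using s zs i(2) by simp
  qed
  then have m1: "\<ominus> \<one> = t1 \<oplus> (s \<otimes> s) \<otimes> t2" using t(4) c s(1) by simp
  have "t2 \<noteq> \<zero>" using m1 real t(1) c s(1) by auto
  note i = over_image_inv[OF wsos_in[OF t(2)] this]
  \<comment> \<open>Division by \<open>t2\<close> is written as multiplication by \<open>t2\<close>
    and by the square of its inverse, which keeps the quotient in \<open>wsos E\<close>.\<close>
  have "(\<one> \<oplus> t1) \<otimes> t2 \<otimes> (inv t2 \<otimes> inv t2) \<in> wsos E"
    using t i by (intro wsos_mult square_wsos wsos_add wsos_1)
  moreover have "(\<one> \<oplus> t1) \<otimes> t2 \<otimes> (inv t2 \<otimes> inv t2) = \<ominus> (s \<otimes> s)"
  proof -
    have 1: "\<one> \<oplus> t1 = \<ominus> ((s \<otimes> s) \<otimes> t2)"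
    proof -
      have "\<one> \<oplus> t1 = \<ominus> ((\<ominus> \<one>) \<ominus> t1)" using c by algebra
      also have "\<dots> = \<ominus> ((s \<otimes> s) \<otimes> t2)" unfolding m1 using c s(1) by algebra
      finally show ?thesis .
    qed
    have "(\<one> \<oplus> t1) \<otimes> t2 \<otimes> (inv t2 \<otimes> inv t2) = \<ominus> (s \<otimes> s) \<otimes> ((t2 \<otimes> inv t2) \<otimes> (t2 \<otimes> inv t2))"
      unfolding 1 using c s(1) over_image_closed(1)[OF i(1)] by algebra
    then show ?thesis using i(2) s(1) by simp
  qed
  ultimately show ?thesis by simp
qed

end

section \<open>Maximal formally real subfields\<close>

definition maximal_real :: "'a set \<Rightarrow> bool" where
  "maximal_real E \<longleftrightarrow> over_image E \<and> \<ominus> \<one> \<notin> wsos E \<and>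
     (\<forall>F. over_image F \<longrightarrow> \<ominus> \<one> \<notin> wsos F \<longrightarrow> E \<subseteq> F \<longrightarrow> F = E)"

lemma maximal_real_adjoin:
  assumes max: "maximal_real E" and p: "p \<in> carrier (E[X])" "p \<noteq> []" "eval p x = \<zero>"
    and x: "x \<in> carrier L" "x \<notin> E"
  shows "\<ominus> \<one> \<in> wsos (simple_extension E x)"
proof (rule ccontr)
  assume neg: "\<ominus> \<one> \<notin> wsos (simple_extension E x)"
  have E: "subfield E L" "range \<phi> \<subseteq> E" using max by (auto simp: maximal_real_def over_image_def)
  have incl: "E \<subseteq> simple_extension E x" using simple_extension_incl[OF subfieldE(3)[OF E(1)] x(1)] .
  have "(algebraic over E) x" using algebraicI[OF p] by (simp add: over_def)
  then have "over_image (simple_extension E x)"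
    using simple_extension_is_subfield[OF E(1) x(1)] E incl by (auto simp: over_image_def)
  then have "simple_extension E x = E" using max neg incl by (auto simp: maximal_real_def)
  then show False using simple_extension_mem[OF subfieldE(1)[OF E(1)] x(1)] x(2) by simp
qed

text \<open>A square root of \<open>a\<close> exists in \<open>L\<close>. If it lies outside
  \<open>E\<close>, adjoining it destroys formal reality by maximality, and
  \<open>sqrt_extension_formally_real\<close> applies.\<close>

lemma maximal_real_square:
  assumes max: "maximal_real E" and roots: "\<And>a. a \<in> carrier L \<Longrightarrow> \<exists>s\<in>carrier L. s \<otimes> s = a"
    and a: "a \<in> E"
  shows "(\<exists>b\<in>E. a = b \<otimes> b) \<or> \<ominus> a \<in> wsos E"
proof -
  have E: "over_image E" "\<ominus> \<one> \<notin> wsos E" using max by (auto simp: maximal_real_def)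
  note cl = over_image_closed[OF E(1)]
  obtain s where s: "s \<in> carrier L" "s \<otimes> s = a" using roots cl(1)[OF a] by blast
  show ?thesis
  proof (cases "s \<in> E")
    case False
    have "[\<one>, \<zero>, \<ominus> a] \<in> carrier (E[X])"
      using cl(2,3) cl(6)[OF a] unfolding univ_poly_carrier[symmetric] polynomial_def by simp
    moreover have "eval [\<one>, \<zero>, \<ominus> a] s = \<zero>"
      using s cl(1)[OF a] by (simp add: numeral_2_eq_2 r_neg)
    ultimately have "\<ominus> \<one> \<in> wsos (simple_extension E s)"
      using maximal_real_adjoin[OF max _ _ _ s(1) False] by blast
    then show ?thesis using sqrt_extension_formally_real[OF E s(1)] s(2) a False by simp
  qed (use s in blast)
qed

text \<open>Otherwise \<open>\<ominus> t\<close> would also be a weighted sum of squares, forcing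
  \<open>t\<close> to be zero, which is a square after all.\<close>

lemma maximal_real_wsos_square:
  assumes max: "maximal_real E" and roots: "\<And>a. a \<in> carrier L \<Longrightarrow> \<exists>s\<in>carrier L. s \<otimes> s = a"
    and t: "t \<in> wsos E"
  shows "\<exists>b\<in>E. t = b \<otimes> b"
proof (rule ccontr)
  assume neg: "\<not> ?thesis"
  have E: "over_image E" "\<ominus> \<one> \<notin> wsos E" using max by (auto simp: maximal_real_def)
  have "\<ominus> t \<in> wsos E" using maximal_real_square[OF max roots wsos_in[OF E(1) t]] neg by blast
  then have "t = \<zero> \<otimes> \<zero>" using formally_real_antisym[OF E t] by simp
  then show False using neg over_image_closed(2)[OF E(1)] by blast
qed

lemma wsos_mono:
  assumes "E \<subseteq> F" shows "wsos E \<subseteq> wsos F"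
proof
  fix t assume "t \<in> wsos E"
  then show "t \<in> wsos F" by induction (use assms in \<open>auto intro: wsos.intros\<close>)
qed

lemma exists_maximal_real:
  assumes "over_image E0" "\<ominus> \<one> \<notin> wsos E0"
  shows "\<exists>E. maximal_real E"
proof -
  define F where "F = {E. over_image E \<and> \<ominus> \<one> \<notin> wsos E}"
  have "\<exists>M\<in>F. \<forall>U\<in>F. M \<subseteq> U \<longrightarrow> U = M"
  proof (rule subset_Zorn_nonempty)
    show "F \<noteq> {}" using assms by (auto simp: F_def)
    fix C assume C: "C \<noteq> {}" "subset.chain F C"
    then have CF: "over_image E" "\<ominus> \<one> \<notin> wsos E" if "E \<in> C" for E
      using that by (auto simp: subset.chain_def F_def)
    have pair: "\<exists>Z\<in>C. a \<in> Z \<and> b \<in> Z" if "a \<in> \<Union>C" "b \<in> \<Union>C" for a b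
    proof -
      obtain U V where "U \<in> C" "V \<in> C" "a \<in> U" "b \<in> V" using \<open>a \<in> \<Union>C\<close> \<open>b \<in> \<Union>C\<close> by auto
      moreover then have "U \<subseteq> V \<or> V \<subseteq> U" using C by (auto simp: subset.chain_def)
      ultimately show ?thesis by blast
    qed
    obtain E1 where E1: "E1 \<in> C" using C(1) by blast
    have "subring (\<Union>C) L"
    proof (rule subringI)
      show "\<Union>C \<subseteq> carrier L" using over_image_closed(1)[OF CF(1)] by blast
      show "\<one> \<in> \<Union>C" using over_image_closed(3)[OF CF(1)] E1 by blast
      show "\<ominus> h \<in> \<Union>C" if "h \<in> \<Union>C" for h using over_image_closed(6)[OF CF(1)] that by blast
      show "h \<otimes> k \<in> \<Union>C" if "h \<in> \<Union>C" "k \<in> \<Union>C" for h k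
        using over_image_closed(5)[OF CF(1)] pair[OF that] by blast
      show "h \<oplus> k \<in> \<Union>C" if "h \<in> \<Union>C" "k \<in> \<Union>C" for h k
        using over_image_closed(4)[OF CF(1)] pair[OF that] by blast
    qed
    then have "subfield (\<Union>C) L"
      by (rule subfieldI') (use over_image_inv(1)[OF CF(1)] in blast)
    moreover have "range \<phi> \<subseteq> \<Union>C" using over_image_mem[OF CF(1)[OF E1]] E1 by blast
    ultimately have U: "over_image (\<Union>C)" by (simp add: over_image_def)
    \<comment> \<open>A weighted sum of squares involves finitely many elements, so it already lives
      in one member of the chain.\<close>
    have "\<exists>E\<in>C. t \<in> wsos E" if "t \<in> wsos (\<Union>C)" for t
      using that
    proof (induction rule: wsos.induct)
      case zero
      then show ?case using E1 wsos.zero by blast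
    next
      case (add p e t)
      then obtain E V where *: "E \<in> C" "t \<in> wsos E" "V \<in> C" "e \<in> V" by blast
      then have "E \<subseteq> V \<or> V \<subseteq> E" using C by (auto simp: subset.chain_def)
      then obtain Z where "Z \<in> C" "t \<in> wsos Z" "e \<in> Z" using * wsos_mono by blast
      then show ?case using add(1) wsos.add by blast
    qed
    then show "\<Union>C \<in> F" using U CF(2) by (auto simp: F_def)
  qed
  then show ?thesis by (auto simp: F_def maximal_real_def)
qed

section \<open>Polynomials of odd degree over a maximal formally real subfield\<close>

lemma degree_eqI:
  assumes "polynomial E p" "coeff p d \<noteq> \<zero>" "\<And>i. d < i \<Longrightarrow> coeff p i = \<zero>"
  shows "p \<noteq> []" "length p - 1 = d" "hd p = coeff p d"
proof -
  show p: "p \<noteq> []" using assms(2) by auto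
  then have top: "coeff p (length p - 1) = hd p" by (rule lead_coeff_simp)
  have "coeff p (length p - 1) \<noteq> \<zero>" using assms(1) p unfolding top polynomial_def by auto
  then have "length p - 1 \<le> d" using assms(3) not_le by blast
  moreover have "d \<le> length p - 1" using assms(2) coeff_degree not_le by blast
  ultimately show "length p - 1 = d" by simp
  then show "hd p = coeff p d" using top by simp
qed

text \<open>This keeps just what is needed about a weighted sum of squares of polynomials:
  nonnegative values, even degree and a nonnegative leading coefficient. The last two make the
  parity of the degree survive addition.\<close>

definition psd_poly :: "'a set \<Rightarrow> 'a list \<Rightarrow> bool" where
  "psd_poly E u \<longleftrightarrow> u \<in> carrier (E[X]) \<and> (\<forall>b\<in>E. eval u b \<in> wsos E) \<and>
     (u \<noteq> [] \<longrightarrow> even (length u - 1) \<and> hd u \<in> wsos E)"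

text \<open>Leading coefficients of equal degree cannot cancel: both lie in \<open>wsos E\<close>,
  and \<open>formally_real_antisym\<close> would make them zero.\<close>

lemma psd_poly_add:
  assumes E: "over_image E" "\<ominus> \<one> \<notin> wsos E" and u: "psd_poly E u" and v: "psd_poly E v"
  shows "psd_poly E (poly_add u v)" "length (poly_add u v) \<le> max (length u) (length v)"
proof -
  note sr = subfieldE(1)[OF over_image_subfield[OF E(1)]]
  have pu: "polynomial E u" and pv: "polynomial E v"
    using u v by (auto simp: psd_poly_def univ_poly_carrier)
  have cu: "set u \<subseteq> carrier L" and cv: "set v \<subseteq> carrier L"
    using polynomial_in_carrier[OF sr] pu pv by auto
  have pw: "polynomial E (poly_add u v)" using poly_add_closed[OF sr pu pv] .
  have ev: "eval (poly_add u v) b \<in> wsos E" if "b \<in> E" for b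
    using eval_poly_add[OF cu cv over_image_closed(1)[OF E(1) that]] u v that
    by (auto simp: psd_poly_def intro: wsos_add[OF E(1)])
  have co: "coeff (poly_add u v) i = coeff u i \<oplus> coeff v i" for i
    using poly_add_coeff[OF cu cv] by simp
  show "length (poly_add u v) \<le> max (length u) (length v)" using poly_add_length_le .
  have top: "coeff u (length u - 1) \<in> wsos E \<and> coeff u (length u - 1) \<noteq> \<zero>" if "u \<noteq> []" "psd_poly E u" for u
  proof -
    have "hd u \<noteq> \<zero>" using that unfolding psd_poly_def univ_poly_carrier[symmetric] polynomial_def by auto
    then show ?thesis using that lead_coeff_simp[OF that(1)] unfolding psd_poly_def by metis
  qed
  have above: "coeff u d \<in> wsos E" if "u \<noteq> []" "psd_poly E u" "length u - 1 \<le> d" for u d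
  proof (cases "d = length u - 1")
    case False
    then have "coeff u d = \<zero>" using that(3) by (intro coeff_degree) simp
    then show ?thesis by (simp add: wsos.zero)
  qed (use top that in blast)
  have "even (length (poly_add u v) - 1) \<and> hd (poly_add u v) \<in> wsos E" if "poly_add u v \<noteq> []"
  proof -
    consider "u = []" | "v = []" | "u \<noteq> []" "v \<noteq> []" by blast
    then show ?thesis
    proof cases
      case 1
      then show ?thesis using v that poly_add_zero(2)[OF sr pv] by (auto simp: psd_poly_def)
    next
      case 2
      then show ?thesis using u that poly_add_zero(1)[OF sr pu] by (auto simp: psd_poly_def)
    next
      case 3
      define d where "d = max (length u - 1) (length v - 1)"
      have ed: "even d" using u v 3 by (auto simp: psd_poly_def d_def max_def)
      have in_w: "coeff u d \<in> wsos E" "coeff v d \<in> wsos E"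
        using above[OF 3(1) u, of d] above[OF 3(2) v, of d] by (simp_all add: d_def)
      have nz: "coeff u d \<noteq> \<zero> \<or> coeff v d \<noteq> \<zero>"
        using top[OF 3(1) u] top[OF 3(2) v] unfolding d_def max_def by presburger
      have "coeff u d \<oplus> coeff v d \<noteq> \<zero>"
      proof
        assume z: "coeff u d \<oplus> coeff v d = \<zero>"
        have c: "coeff u d \<in> carrier L" "coeff v d \<in> carrier L" using cu cv by auto
        have "\<ominus> coeff u d = coeff v d" using z c by (metis a_comm minus_equality)
        then have "coeff u d = \<zero>" using formally_real_antisym[OF E in_w(1)] in_w(2) by simp
        then show False using z c nz by simp
      qed
      then have "length (poly_add u v) - 1 = d" "hd (poly_add u v) = coeff u d \<oplus> coeff v d"
        using degree_eqI[OF pw, of d] co coeff_degree[of u] coeff_degree[of v] by (auto simp: d_def)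
      then show ?thesis using ed in_w wsos_add[OF E(1)] by simp
    qed
  qed
  then show "psd_poly E (poly_add u v)"
    using pw ev by (auto simp: psd_poly_def univ_poly_carrier)
qed

lemma psd_poly_square:
  assumes E: "over_image E" and p: "p \<in> P" and g: "g \<in> carrier (E[X])"
  shows "\<exists>v. psd_poly E v \<and> length v \<le> 2 * length g - 1 \<and>
    (\<forall>x\<in>carrier L. eval v x = \<phi> p \<otimes> (eval g x \<otimes> eval g x))"
proof (cases "\<phi> p = \<zero> \<or> g = []")
  case True
  \<comment> \<open>A weight in the support has image zero, and the list containing only zero is not
    a polynomial; the zero polynomial takes its place.\<close>
  have "psd_poly E []" using wsos.zero by (auto simp: psd_poly_def univ_poly_zero_closed)
  moreover have "eval g x \<in> carrier L" if "x \<in> carrier L" for x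
    using g that eval_poly_in_carrier[OF subfieldE(1)[OF over_image_subfield[OF E]]] by (simp add: univ_poly_carrier)
  then have "eval [] x = \<phi> p \<otimes> (eval g x \<otimes> eval g x)" if "x \<in> carrier L" for x
    using True that by (elim disjE) simp_all
  ultimately show ?thesis by (intro exI[of _ "[]"]) simp
next
  case False
  note sr = subfieldE(1)[OF over_image_subfield[OF E]]
  define v where "v = poly_mult [\<phi> p] (poly_mult g g)"
  have c: "polynomial E [\<phi> p]" using False over_image_mem[OF E] by (auto simp: polynomial_def)
  have pg: "polynomial E g" using g by (simp add: univ_poly_carrier)
  have pgg: "polynomial E (poly_mult g g)" using poly_mult_closed[OF sr pg pg] .
  have pv: "polynomial E v" unfolding v_def using poly_mult_closed[OF sr c pgg] .
  have gg0: "poly_mult g g \<noteq> []" using poly_mult_integral[OF sr pg pg] False by blast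
  then have v0: "v \<noteq> []" unfolding v_def using poly_mult_integral[OF sr c pgg] by blast
  have lgg: "length (poly_mult g g) - 1 = 2 * (length g - 1)" "hd (poly_mult g g) = hd g \<otimes> hd g"
    using poly_mult_degree_eq[OF sr pg pg] poly_mult_lead_coeff[OF sr pg pg] False by auto
  have lv: "length v - 1 = 2 * (length g - 1)" "hd v = \<phi> p \<otimes> (hd g \<otimes> hd g)"
    using poly_mult_degree_eq[OF sr c pgg] poly_mult_lead_coeff[OF sr c pgg] gg0 lgg by (auto simp: v_def)
  have ev: "eval v x = \<phi> p \<otimes> (eval g x \<otimes> eval g x)" if "x \<in> carrier L" for x
  proof -
    note ic = polynomial_in_carrier[OF sr]
    have "eval v x = eval [\<phi> p] x \<otimes> eval (poly_mult g g) x"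
      unfolding v_def by (rule eval_poly_mult[OF ic[OF c] ic[OF pgg] that])
    also have "eval (poly_mult g g) x = eval g x \<otimes> eval g x"
      by (rule eval_poly_mult[OF ic[OF pg] ic[OF pg] that])
    finally show ?thesis by simp
  qed
  have hg: "hd g \<in> E" using pg False by (auto simp: polynomial_def)
  have eg: "eval g b \<in> E" if "b \<in> E" for b
    using g that simple_extension_as_eval_img[OF subringE(1)[OF sr] over_image_closed(1)[OF E that]]
      simple_extension_subring_incl[OF sr subset_refl that] by auto
  have "psd_poly E v"
    unfolding psd_poly_def univ_poly_carrier[symmetric]
    using pv lv ev hg eg p over_image_closed(1)[OF E] by (auto intro: wsos_square[OF E])
  moreover have "length v \<le> 2 * length g - 1" using lv(1) v0 False by (cases v; cases g) auto
  ultimately show ?thesis using ev by blast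
qed

text \<open>Let \<open>m\<close> be the minimal polynomial of a root \<open>\<alpha>\<close>. If \<open>- 1\<close> is a weighted sum of squares in \<open>E(\<alpha>)\<close>,
  then \<open>1 + \<Sum>w\<^sub>i g\<^sub>i\<^sup>2 = m h\<close> with \<open>deg g\<^sub>i < deg m\<close>. If \<open>deg m\<close> is odd, then so is \<open>deg h < deg m\<close>, and a root
  of \<open>h\<close> in \<open>E\<close> makes \<open>- 1\<close> a weighted sum of squares in \<open>E\<close>.\<close>

lemma maximal_real_odd_root:
  assumes max: "maximal_real E"
    and roots: "\<And>p. p \<in> carrier (poly_ring L) \<Longrightarrow> 0 < length p - 1 \<Longrightarrow> \<exists>x\<in>carrier L. eval p x = \<zero>"
  shows "p \<in> carrier (E[X]) \<Longrightarrow> odd (length p - 1) \<Longrightarrow> \<exists>x\<in>E. eval p x = \<zero>"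
proof (induction "length p" arbitrary: p rule: less_induct)
  case less
  have E: "over_image E" "\<ominus> \<one> \<notin> wsos E" using max by (auto simp: maximal_real_def)
  note sf = over_image_subfield[OF E(1)]
  note sr = subfieldE(1)[OF sf]
  note cl = over_image_closed[OF E(1)]
  note hom_eval = ring_hom_memE[OF eval_is_hom[OF sr]]
  interpret UP: domain "E[X]" using univ_poly_is_domain[OF sr] .
  have p0: "p \<noteq> []" using less.prems(2) by auto
  have "0 < length p - 1" using less.prems(2) by (rule odd_pos)
  then obtain \<alpha> where \<alpha>: "\<alpha> \<in> carrier L" "eval p \<alpha> = \<zero>"
    using roots carrier_polynomial_shell[OF sr less.prems(1)] by blast
  have alg: "(algebraic over E) \<alpha>" using algebraicI[OF less.prems(1) p0 \<alpha>(2)] by (simp add: over_def)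
  define m where "m = Irr E \<alpha>"
  have m: "m \<in> carrier (E[X])" "pirreducible E m" "eval m \<alpha> = \<zero>"
    using IrrE[OF sf \<alpha>(1) alg] by (auto simp: m_def)
  have factor: "\<exists>h\<in>carrier (E[X]). w = m \<otimes>\<^bsub>E[X]\<^esub> h \<and> h \<noteq> [] \<and> length w - 1 = (length m - 1) + (length h - 1)"
    if w: "w \<in> carrier (E[X])" "w \<noteq> []" "eval w \<alpha> = \<zero>" for w
  proof -
    have "m divides\<^bsub>E[X]\<^esub> w"
      using Irr_minimal[OF sf \<alpha>(1) alg w(1,3)] pdivides_iff_shell[OF sf m(1) w(1)] by (simp add: m_def)
    then obtain h where h: "h \<in> carrier (E[X])" "w = m \<otimes>\<^bsub>E[X]\<^esub> h" by (auto simp: factor_def)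
    have "h \<noteq> []" "m \<noteq> []"
      using h w(2) UP.r_null[OF m(1)] UP.l_null[OF h(1)] by (auto simp: univ_poly_zero)
    moreover have "length w - 1 = (length m - 1) + (length h - 1)"
      using poly_mult_degree_eq[OF sr, of m h] m(1) h calculation
      by (simp add: univ_poly_carrier univ_poly_mult)
    ultimately show ?thesis using h by blast
  qed
  have m0: "m \<noteq> []" "1 \<le> length m - 1"
    using pirreducible_degree[OF sf m(1,2)] by auto
  obtain r where r: "r \<in> carrier (E[X])" "p = m \<otimes>\<^bsub>E[X]\<^esub> r" "r \<noteq> []"
    "length p - 1 = (length m - 1) + (length r - 1)"
    using factor[OF less.prems(1) p0 \<alpha>(2)] by blast
  show ?case
  proof (cases "\<alpha> \<in> E")
    case True
    then show ?thesis using \<alpha>(2) by blast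
  next
    case False
    show ?thesis
    proof (cases "even (length m - 1)")
      case True
      \<comment> \<open>If the minimal polynomial has even degree, the parity passes to the cofactor
        \<open>r\<close>, whose degree is smaller than that of \<open>p\<close>.\<close>
      then have "odd (length r - 1)" using less.prems(2) True unfolding r(4) even_add by blast
      moreover have "length r < length p" using r(4) m0(2) less.prems(2) by linarith
      ultimately obtain x where x: "x \<in> E" "eval r x = \<zero>" using less.hyps r(1) by blast
      have "eval p x = eval m x \<otimes> eval r x"
        using hom_eval(2)[OF cl(1)[OF x(1)] m(1) r(1)] r(2) by simp
      then show ?thesis using x hom_eval(1)[OF cl(1)[OF x(1)] m(1)] by auto
    next
      case oddm: False
      have rep: "\<exists>g\<in>carrier (E[X]). length g < length m \<and> eval g \<alpha> = e" if e: "e \<in> simple_extension E \<alpha>" for e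
      proof -
        obtain g where g: "g \<in> carrier (E[X])" "e = eval g \<alpha>"
          using e simple_extension_as_eval_img[OF subringE(1)[OF sr] \<alpha>(1)] by auto
        obtain q r where qr: "q \<in> carrier (E[X])" "r \<in> carrier (E[X])"
          "g = (m \<otimes>\<^bsub>E[X]\<^esub> q) \<oplus>\<^bsub>E[X]\<^esub> r" "r = [] \<or> length r - 1 < length m - 1"
          using field_long_division_theorem_shell[OF sf g(1) m(1)] m0(1) by (auto simp: univ_poly_zero)
        have "eval g \<alpha> = eval m \<alpha> \<otimes> eval q \<alpha> \<oplus> eval r \<alpha>"
          unfolding qr(3) using hom_eval(2,3)[OF \<alpha>(1)] qr m(1) by simp
        then have "eval g \<alpha> = eval r \<alpha>"
          using m(3) hom_eval(1)[OF \<alpha>(1)] qr by simp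
        moreover have "length r < length m" using qr(4) m0 by auto
        ultimately show ?thesis using qr(2) g by auto
      qed
      \<comment> \<open>Representatives have degree at most \<open>deg m - 1\<close>, so their
        squares have degree at most \<open>2 deg m - 2\<close>. As the length of a list is the
        degree plus one, this is the bound \<open>2 * length m - 3\<close>.\<close>
      have lift: "\<exists>u. psd_poly E u \<and> length u \<le> 2 * length m - 3 \<and> eval u \<alpha> = t"
        if "t \<in> wsos (simple_extension E \<alpha>)" for t
        using that
      proof (induction rule: wsos.induct)
        case zero
        have "psd_poly E []" using wsos.zero by (auto simp: psd_poly_def univ_poly_zero_closed)
        then show ?case by (intro exI[of _ "[]"]) simp
      next
        case (add q e t)
        then obtain u where u: "psd_poly E u" "length u \<le> 2 * length m - 3" "eval u \<alpha> = t" by blast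
        obtain g where g: "g \<in> carrier (E[X])" "length g < length m" "eval g \<alpha> = e"
          using rep add(2) by blast
        obtain v where v: "psd_poly E v" "length v \<le> 2 * length g - 1"
          "eval v \<alpha> = \<phi> q \<otimes> (e \<otimes> e)"
          using psd_poly_square[OF E(1) add(1) g(1)] \<alpha>(1) g(3) by blast
        have "psd_poly E (poly_add v u)" "length (poly_add v u) \<le> 2 * length m - 3"
          using psd_poly_add[OF E v(1) u(1)] v(2) u(2) g(2) by auto
        moreover have "eval (poly_add v u) \<alpha> = \<phi> q \<otimes> (e \<otimes> e) \<oplus> t"
          using hom_eval(3)[OF \<alpha>(1), of v u] u v by (simp add: psd_poly_def univ_poly_add)
        ultimately show ?case by blast
      qed
      have "\<ominus> \<one> \<in> wsos (simple_extension E \<alpha>)"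
        using maximal_real_adjoin[OF max less.prems(1) p0 \<alpha>(2,1) False] .
      then obtain u where u: "psd_poly E u" "length u \<le> 2 * length m - 3" "eval u \<alpha> = \<ominus> \<one>"
        using lift by blast
      have one: "psd_poly E [\<one>]"
        using cl wsos_1[OF E(1)] by (auto simp: psd_poly_def univ_poly_carrier[symmetric] polynomial_def)
      define w where "w = poly_add [\<one>] u"
      have w: "psd_poly E w" "length w \<le> 2 * length m - 3"
        using psd_poly_add[OF E one u(1)] u(2) m0(2) by (auto simp: w_def)
      have ew: "eval w x = \<one> \<oplus> eval u x" if "x \<in> carrier L" for x
        using hom_eval(3)[OF that, of "[\<one>]" u] u one that by (simp add: w_def psd_poly_def univ_poly_add)
      have nonzero: "eval w x \<noteq> \<zero>" if "x \<in> E" for x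
      proof
        assume "eval w x = \<zero>"
        then have "\<one> \<oplus> eval u x = \<zero>" using ew cl(1)[OF that] by simp
        moreover have eu: "eval u x \<in> wsos E" using u that by (simp add: psd_poly_def)
        ultimately have "\<ominus> \<one> = eval u x"
          using wsos_carrier[OF E(1)] by (metis a_comm minus_equality one_closed)
        then show False using eu E(2) by simp
      qed
      have "w \<noteq> []" using nonzero[OF cl(2)] by auto
      moreover have "eval w \<alpha> = \<zero>" using ew[OF \<alpha>(1)] u(3) by (simp add: r_neg)
      ultimately obtain h where h: "h \<in> carrier (E[X])" "w = m \<otimes>\<^bsub>E[X]\<^esub> h" "h \<noteq> []"
        "length w - 1 = (length m - 1) + (length h - 1)"
        using factor w(1) unfolding psd_poly_def by blast
      have "even (length w - 1)" using w(1) \<open>w \<noteq> []\<close> by (simp add: psd_poly_def)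
      then have "odd (length h - 1)" using oddm unfolding h(4) even_add by blast
      \<comment> \<open>Here \<open>deg h = deg w - deg m\<close> is at most
        \<open>deg m - 2\<close>, hence below \<open>deg p\<close>.\<close>
      moreover have "length h < length p" using h(4) w(2) r(4) m0(2) by linarith
      ultimately obtain x where x: "x \<in> E" "eval h x = \<zero>" using less.hyps h(1) by blast
      have "eval w x = eval m x \<otimes> eval h x"
        using hom_eval(2)[OF cl(1)[OF x(1)] m(1) h(1)] h(2) by simp
      then have "eval w x = \<zero>" using x hom_eval(1)[OF cl(1)[OF x(1)] m(1)] by simp
      then show ?thesis using nonzero x(1) by blast
    qed
  qed
qed

lemma maximal_real_real_closed:
  assumes max: "maximal_real E"
    and roots: "\<And>p. p \<in> carrier (poly_ring L) \<Longrightarrow> 0 < length p - 1 \<Longrightarrow> \<exists>x\<in>carrier L. eval p x = \<zero>"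
  shows "real_closed_field (L\<lparr>carrier := E\<rparr>)" "\<And>p. p \<in> P \<Longrightarrow> \<exists>b\<in>E. \<phi> p = b \<otimes> b"
proof -
  have E: "over_image E" "\<ominus> \<one> \<notin> wsos E" using max by (auto simp: maximal_real_def)
  note sf = over_image_subfield[OF E(1)]
  note sr = subfieldE(1)[OF sf]
  have sqrt: "\<exists>s\<in>carrier L. s \<otimes> s = a" if a: "a \<in> carrier L" for a
  proof -
    have "[\<one>, \<zero>, \<ominus> a] \<in> carrier (poly_ring L)"
      using a unfolding univ_poly_carrier[symmetric] polynomial_def by simp
    then obtain s where s: "s \<in> carrier L" "eval [\<one>, \<zero>, \<ominus> a] s = \<zero>" using roots[of "[\<one>, \<zero>, \<ominus> a]"] by auto
    then have "s \<otimes> s \<ominus> a = \<zero>" using a by (simp add: numeral_2_eq_2 a_minus_def)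
    then show ?thesis using s(1) a by auto
  qed
  show "\<exists>b\<in>E. \<phi> p = b \<otimes> b" if "p \<in> P" for p
    using maximal_real_wsos_square[OF max sqrt image_wsos[OF E(1) that]] by blast
  interpret EF: field "L\<lparr>carrier := E\<rparr>" using subfield_iff(2)[OF sf] .
  have minus: "\<ominus>\<^bsub>L\<lparr>carrier := E\<rparr>\<^esub> a = \<ominus> a" if "a \<in> E" for a
    using EF.minus_equality[of "\<ominus> a" a] that over_image_closed[OF E(1)] by (simp add: l_neg)
  have sum: "foldr (\<lambda>x s. x \<otimes> x \<oplus> s) xs \<zero> \<in> wsos E" if "set xs \<subseteq> E" for xs
    using that by (induction xs) (auto intro: wsos.zero wsos_add[OF E(1)] square_wsos[OF E(1)])
  then have "foldr (\<lambda>x s. x \<otimes> x \<oplus> s) xs \<zero> \<noteq> \<ominus> \<one>" if "set xs \<subseteq> E" for xs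
    using that E(2) by metis
  moreover have "\<exists>b\<in>E. a = b \<otimes> b \<or> \<ominus> a = b \<otimes> b" if "a \<in> E" for a
    using maximal_real_square[OF max sqrt that] maximal_real_wsos_square[OF max sqrt] by blast
  moreover have "\<exists>x. EF.is_root p x" if "p \<in> carrier (poly_ring (L\<lparr>carrier := E\<rparr>))" "odd (length p - 1)" for p
  proof -
    note odd = that(2)
    have "p \<in> carrier (E[X])" using that(1) univ_poly_consistent[OF sr] by simp
    then obtain x where "x \<in> E" "eval p x = \<zero>" using maximal_real_odd_root[OF max roots] odd by blast
    then show ?thesis using odd eval_consistent[OF sr] by (auto simp: EF.is_root_def)
  qed
  ultimately show "real_closed_field (L\<lparr>carrier := E\<rparr>)"
    unfolding real_closed_field_def
    using EF.field_axioms minus over_image_closed(3)[OF E(1)] by auto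
qed

section \<open>The fraction field of the image as a starting point\<close>

definition fractions :: "'a set" where
  "fractions = {x \<in> carrier L. \<exists>a b. b \<notin> supp P \<and> x \<otimes> \<phi> b = \<phi> a}"

lemma over_image_fractions: "over_image fractions"
proof -
  have one: "1 \<notin> supp P" using prime_coneD(4)[OF P] .
  have "range \<phi> \<subseteq> fractions"
  proof
    fix x assume "x \<in> range \<phi>"
    then obtain a where "x = \<phi> a" by blast
    moreover have "\<phi> a \<otimes> \<phi> 1 = \<phi> a" by simp
    ultimately show "x \<in> fractions" unfolding fractions_def using one hom_simps(1) by blast
  qed
  moreover have "subring fractions L"
  proof (rule subringI)
    show "fractions \<subseteq> carrier L" by (auto simp: fractions_def)
    show "\<one> \<in> fractions" using calculation hom_simps(4) by (metis rangeI subset_iff)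
    fix x assume "x \<in> fractions"
    then obtain a b where x: "x \<in> carrier L" "b \<notin> supp P" "x \<otimes> \<phi> b = \<phi> a" by (auto simp: fractions_def)
    have "(\<ominus> x) \<otimes> \<phi> b = \<phi> (- a)" using x by (simp add: l_minus)
    then show "\<ominus> x \<in> fractions" using x(1,2) by (auto simp: fractions_def simp del: hom_simps(6))
    fix y assume "y \<in> fractions"
    then obtain c d where y: "y \<in> carrier L" "d \<notin> supp P" "y \<otimes> \<phi> d = \<phi> c" by (auto simp: fractions_def)
    have "(x \<otimes> y) \<otimes> \<phi> (b * d) = (x \<otimes> \<phi> b) \<otimes> (y \<otimes> \<phi> d)"
      unfolding hom_simps using x(1) y(1) hom_simps(1)[of b] hom_simps(1)[of d] by algebra
    then have "(x \<otimes> y) \<otimes> \<phi> (b * d) = \<phi> (a * c)" using x y by simp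
    then show "x \<otimes> y \<in> fractions"
      using x(1) y(1) supp_prime[OF P, OF x(2) y(2)] unfolding fractions_def by blast
    have "(x \<oplus> y) \<otimes> \<phi> (b * d) = (x \<otimes> \<phi> b) \<otimes> \<phi> d \<oplus> (y \<otimes> \<phi> d) \<otimes> \<phi> b"
      unfolding hom_simps using x(1) y(1) hom_simps(1)[of b] hom_simps(1)[of d] by algebra
    then have "(x \<oplus> y) \<otimes> \<phi> (b * d) = \<phi> (a * d + c * b)" using x y by simp
    then show "x \<oplus> y \<in> fractions"
      using x(1) y(1) supp_prime[OF P, OF x(2) y(2)] unfolding fractions_def by blast
  qed
  then have "subfield fractions L"
  proof (rule subfieldI')
    fix x assume "x \<in> fractions - {\<zero>}"
    then obtain a b where x: "x \<in> carrier L" "b \<notin> supp P" "x \<otimes> \<phi> b = \<phi> a" "x \<noteq> \<zero>" by (auto simp: fractions_def)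
    have "\<phi> b \<noteq> \<zero>" using x(2) kernel by blast
    then have "\<phi> a \<noteq> \<zero>" using x integral[of x "\<phi> b"] by auto
    then have a: "a \<notin> supp P" using kernel by blast
    have i: "inv x \<in> carrier L" "inv x \<otimes> x = \<one>" using x(1,4) field_Units by auto
    have "inv x \<otimes> \<phi> a = (inv x \<otimes> x) \<otimes> \<phi> b"
      unfolding x(3)[symmetric] using x(1) i(1) by (simp add: m_assoc)
    then have "inv x \<otimes> \<phi> a = \<phi> b" using i by simp
    then show "inv x \<in> fractions" using a i(1) by (auto simp: fractions_def)
  qed
  ultimately show ?thesis by (simp add: over_image_def)
qed

text \<open>Clearing denominators turns every weighted sum of squares \<open>t\<close> into
  \<open>t \<phi>(b)^2 = \<phi>(p)\<close> with \<open>p\<close> in \<open>P\<close> and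
  \<open>b\<close> outside the support.\<close>

lemma fractions_formally_real: "\<ominus> \<one> \<notin> wsos fractions"
proof
  have form: "t \<in> carrier L \<and> (\<exists>p\<in>P. \<exists>b. b \<notin> supp P \<and> t \<otimes> (\<phi> b \<otimes> \<phi> b) = \<phi> p)" if "t \<in> wsos fractions" for t
    using that
  proof (induction rule: wsos.induct)
    case zero
    show ?case using P_closed(5) prime_coneD(4)[OF P] by (auto intro!: bexI[of _ 0] exI[of _ 1])
  next
    case (add q e t)
    then obtain p b where t: "t \<in> carrier L" "p \<in> P" "b \<notin> supp P" "t \<otimes> (\<phi> b \<otimes> \<phi> b) = \<phi> p" by blast
    obtain a c where e: "e \<in> carrier L" "c \<notin> supp P" "e \<otimes> \<phi> c = \<phi> a" using add(2) by (auto simp: fractions_def)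
    have "(\<phi> q \<otimes> (e \<otimes> e) \<oplus> t) \<otimes> (\<phi> (b * c) \<otimes> \<phi> (b * c)) =
       \<phi> q \<otimes> ((e \<otimes> \<phi> c) \<otimes> \<phi> b) \<otimes> ((e \<otimes> \<phi> c) \<otimes> \<phi> b) \<oplus> (t \<otimes> (\<phi> b \<otimes> \<phi> b)) \<otimes> (\<phi> c \<otimes> \<phi> c)"
      unfolding hom_simps(3) using t(1) e(1) hom_simps(1)[of b] hom_simps(1)[of c] hom_simps(1)[of q] by algebra
    also have "\<dots> = \<phi> (q * (a * b) * (a * b) + p * (c * c))" by (simp add: e t)
    finally have "(\<phi> q \<otimes> (e \<otimes> e) \<oplus> t) \<otimes> (\<phi> (b * c) \<otimes> \<phi> (b * c)) = \<phi> (q * (a * b) * (a * b) + p * (c * c))" .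
    moreover have "q * (a * b) * (a * b) + p * (c * c) \<in> P"
      using add(1) t(2) by (simp add: P_closed(1-3) mult.assoc[of q])
    ultimately show ?case
    proof (intro conjI bexI exI)
      show "\<phi> q \<otimes> (e \<otimes> e) \<oplus> t \<in> carrier L" using t(1) e(1) by simp
      show "b * c \<notin> supp P" by (rule supp_prime[OF P, OF t(3) e(2)])
    qed
  qed
  assume "\<ominus> \<one> \<in> wsos fractions"
  from form[OF this] obtain p b where p: "p \<in> P" "b \<notin> supp P" "\<ominus> \<one> \<otimes> (\<phi> b \<otimes> \<phi> b) = \<phi> p" by blast
  \<comment> \<open>For \<open>t = - 1\<close> this puts \<open>p + b^2\<close> into the support.
    Subtracting it from \<open>p\<close> shows that \<open>- b^2\<close> lies in \<open>P\<close>,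
    so \<open>b^2\<close> lies in the support, which is prime.\<close>
  have "\<phi> (p + b * b) = \<zero>" by (simp add: p(3)[symmetric] l_minus l_neg)
  then have "p + b * b \<in> supp P" using kernel by blast
  then have "p + - (p + b * b) \<in> P" using p(1) P_closed(1) unfolding supp_def by blast
  then have "b * b \<in> supp P" using P_closed(3) by (simp add: supp_def)
  then show False using supp_prime[OF P, OF p(2) p(2)] by blast
qed

end

lemma (in ordered_hom) exists_real_closed:
  assumes roots: "\<And>p. p \<in> carrier (poly_ring L) \<Longrightarrow> 0 < length p - 1 \<Longrightarrow> \<exists>x\<in>carrier L. eval p x = \<zero>"
  shows "\<exists>E. real_closed_field (L\<lparr>carrier := E\<rparr>) \<and> range \<phi> \<subseteq> E \<and> (\<forall>p\<in>P. \<exists>b\<in>E. \<phi> p = b \<otimes> b)"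
proof -
  obtain E where E: "maximal_real E"
    using exists_maximal_real[OF over_image_fractions fractions_formally_real] by blast
  then have "range \<phi> \<subseteq> E" by (simp add: maximal_real_def over_image_def)
  then show ?thesis using maximal_real_real_closed[OF E roots] by blast
qed

section \<open>A real closed point above every prime cone\<close>

lemma fraction_rep_inj:
  assumes "prime_cone P"
  shows "inj_on (\<lambda>x. SOME p. p \<in> x) (carrier (residue_field P))"
proof (rule inj_onI)
  fix x y assume xy: "x \<in> carrier (residue_field P)" "y \<in> carrier (residue_field P)"
    and eq: "(SOME p. p \<in> x) = (SOME p. p \<in> y)"
  have rep: "x = fraction P (fst (SOME p. p \<in> x)) (snd (SOME p. p \<in> x))" if x: "x \<in> carrier (residue_field P)" for x
  proof -
    obtain a b where b: "b \<notin> supp P" "x = fraction P a b" using x by (rule residue_field_cases[OF assms])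
    obtain c d where "(SOME p. p \<in> x) = (c, d)" "d \<notin> supp P" "a * d - b * c \<in> supp P"
      using fraction_rep[OF assms b(1), of a] b(2) by blast
    then show ?thesis using fraction_eq_iff[OF assms b(1)] b(2) by simp
  qed
  show "x = y" using rep[OF xy(1)] rep[OF xy(2)] eq by metis
qed

text \<open>A real closure of the residue field is found inside its algebraic closure after the
  latter has been copied onto \<open>'a list\<close>, the only carrier type over which
  \<open>strict_real_zero_poly\<close> quantifies.\<close>

lemma real_closed_point:
  fixes P :: "'a::comm_ring_1 set"
  assumes P: "prime_cone P"
  shows "\<exists>(R :: 'a list ring) \<phi>. real_closed_field R \<and> \<phi> \<in> ring_hom class_ring R \<and>
    (\<forall>p\<in>P. \<exists>b\<in>carrier R. \<phi> p = b \<otimes>\<^bsub>R\<^esub> b) \<and> (\<forall>a. \<phi> a = \<zero>\<^bsub>R\<^esub> \<longleftrightarrow> a \<in> supp P)"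
proof -
  let ?K = "residue_field P"
  interpret K: field ?K by (rule field_residue_field[OF P])
  define F where "F = K.alg_closure"
  let ?\<iota> = "K.indexed_const :: _ \<Rightarrow> ((('a \<times> 'a) set list \<times> nat) multiset \<Rightarrow> ('a \<times> 'a) set)"
  interpret F: algebraic_closure F "?\<iota> ` carrier ?K"
    unfolding F_def by (rule K.alg_closureE(1))
  have \<iota>: "?\<iota> \<in> ring_hom ?K F" unfolding F_def by (rule K.alg_closureE(2))
  \<comment> \<open>Every element of the base field is coded by a chosen pair of numerator and
    denominator, that is, by two letters in \<open>'a\<close>.\<close>
  have "inj_on ((\<lambda>x. SOME p. p \<in> x) \<circ> inv_into (carrier ?K) ?\<iota>) (?\<iota> ` carrier ?K)"
    by (intro comp_inj_on inj_on_inv_into subset_refl)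
      (simp add: inv_into_image_cancel fraction_rep_inj[OF P] K.indexed_const_inj_on)
  from F.exists_list_encoding[OF this] obtain enc :: "_ \<Rightarrow> 'a list" where enc: "inj_on enc (carrier F)" by blast
  define L where "L = image_ring enc F"
  define \<phi> where "\<phi> = enc \<circ> (?\<iota> \<circ> (\<lambda>a. fraction P a 1))"
  have enc_hom: "enc \<in> ring_hom F L"
    using inj_imp_image_ring_iso[OF enc] unfolding L_def ring_iso_def by blast
  have hom: "?\<iota> \<circ> (\<lambda>a. fraction P a 1) \<in> ring_hom class_ring F"
    by (rule ring_hom_trans[OF residue_field_hom[OF P] \<iota>])
  have \<phi>: "\<phi> \<in> ring_hom class_ring L"
    unfolding \<phi>_def by (rule ring_hom_trans[OF hom enc_hom])
  have ker: "\<phi> a = \<zero>\<^bsub>L\<^esub> \<longleftrightarrow> a \<in> supp P" for a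
  proof -
    have f: "fraction P a 1 \<in> carrier ?K" by (rule fraction_closed[OF P one_not_supp[OF P]])
    have z: "?\<iota> \<zero>\<^bsub>?K\<^esub> = \<zero>\<^bsub>F\<^esub>"
      using ring_hom_zero[OF \<iota> K.ring_axioms F.ring_axioms] .
    have "\<phi> a = \<zero>\<^bsub>L\<^esub> \<longleftrightarrow> ?\<iota> (fraction P a 1) = ?\<iota> \<zero>\<^bsub>?K\<^esub>"
      unfolding \<phi>_def L_def image_ring_zero z comp_def
      by (rule inj_on_eq_iff[OF enc ring_hom_closed[OF \<iota> f] F.zero_closed])
    also have "\<dots> \<longleftrightarrow> fraction P a 1 = \<zero>\<^bsub>?K\<^esub>"
      by (rule inj_on_eq_iff[OF K.indexed_const_inj_on f K.zero_closed])
    finally show ?thesis using residue_field_kernel[OF P] by simp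
  qed
  interpret L: ordered_hom L \<phi> P
  proof (intro ordered_hom.intro ordered_hom_axioms.intro)
    show "field L" unfolding L_def by (rule F.inj_imp_image_ring_is_field[OF enc])
  qed (rule \<phi> P ker)+
  have "\<exists>x\<in>carrier L. L.eval p x = \<zero>\<^bsub>L\<^esub>" if "p \<in> carrier (poly_ring L)" "0 < length p - 1" for p
    using F.image_ring_exists_root[OF enc F.exists_root_carrier] that unfolding L_def by blast
  from L.exists_real_closed[OF this] obtain E where E: "real_closed_field (L\<lparr>carrier := E\<rparr>)"
    "range \<phi> \<subseteq> E" "\<And>p. p \<in> P \<Longrightarrow> \<exists>b\<in>E. \<phi> p = b \<otimes>\<^bsub>L\<^esub> b" by blast
  have "\<phi> \<in> ring_hom class_ring (L\<lparr>carrier := E\<rparr>)"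
    using \<phi> E(2) by (auto simp: ring_hom_def)
  then show ?thesis using E ker by (intro exI[of _ "L\<lparr>carrier := E\<rparr>"] exI[of _ \<phi>]) simp
qed

section \<open>Strict real zero polynomials\<close>

text \<open>Were \<open>- Q\<close> in \<open>P\<close>, its image in a real closed field above
  \<open>P\<close> would be a square, while the image of \<open>Q\<close> is a sum of squares by
  \<open>trace_form\<close>. All these squares then vanish, and the \<open>n\<close> distinct zeros
  of \<open>f\<close> force every \<open>u i\<close> into the support.\<close>

lemma strict_real_zero_poly_pos_def:
  fixes f :: "'a::comm_ring_1 poly"
  assumes "strict_real_zero_poly f"
  shows "pos_def_on_cones (Polynomial.degree f) (\<lambda>i j. power_sum f (i + j))"
  unfolding pos_def_on_cones_def
proof (intro allI impI notI)
  fix P and u :: "nat \<Rightarrow> 'a"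
  define n where "n = Polynomial.degree f"
  define Q where "Q = (\<Sum>i<n. \<Sum>j<n. power_sum f (i + j) * (u i * u j))"
  assume P: "prime_cone P" and u: "\<exists>i<Polynomial.degree f. u i \<notin> supp P"
    and "- (\<Sum>i<Polynomial.degree f. \<Sum>j<Polynomial.degree f. power_sum f (i + j) * (u i * u j)) \<in> P"
  then have neg: "- Q \<in> P" by (simp add: Q_def n_def)
  have monic: "monic f" using assms by (simp add: strict_real_zero_poly_def)
  then have f0: "f \<noteq> 0" by auto
  obtain R :: "'a list ring" and \<phi> where R: "real_closed_field R" and \<phi>: "\<phi> \<in> ring_hom class_ring R"
    and sq: "\<And>p. p \<in> P \<Longrightarrow> \<exists>b\<in>carrier R. \<phi> p = b \<otimes>\<^bsub>R\<^esub> b"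
    and ker: "\<And>a. \<phi> a = \<zero>\<^bsub>R\<^esub> \<longleftrightarrow> a \<in> supp P"
    using real_closed_point[OF P] by blast
  interpret R: field R using R by (simp add: real_closed_field_def)
  note hom = R.class_hom_simps[OF \<phi>]
  define p where "p = poly_image \<phi> f"
  have strict: "size (R.roots p) = length p - 1" "\<And>x. count (R.roots p) x \<le> 1"
    using assms R \<phi> by (auto simp: strict_real_zero_poly_def strict_real_zeros_in_def p_def R.splitted_def)
  have len: "length p = Suc n" using f0 by (simp add: p_def poly_image_def length_coeffs_degree n_def)
  then have p0: "p \<noteq> []" by auto
  have nth: "p ! j = \<phi> (rev_coeff f j)" if "j \<le> n" for j
  proof -
    have "length (coeffs f) = Suc n" using f0 by (simp add: length_coeffs_degree n_def)
    then have "p ! j = \<phi> (coeffs f ! (n - j))" using that by (simp add: p_def poly_image_def rev_nth)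
    also have "coeffs f ! (n - j) = rev_coeff f j"
      using f0 that by (simp add: coeffs_nth rev_coeff_def n_def)
    finally show ?thesis .
  qed
  have hd: "hd p = \<one>\<^bsub>R\<^esub>"
    using nth[of 0] p0 monic by (simp add: hd_conv_nth rev_coeff_def hom)
  have pR: "p \<in> carrier (poly_ring R)"
    unfolding univ_poly_carrier[symmetric] polynomial_def using hd p0 by (auto simp: p_def poly_image_def hom)
  obtain xs where xs: "mset xs = R.roots p" "set xs \<subseteq> carrier R" "\<And>j. j < length p \<Longrightarrow> p ! j = R.esym xs j"
    using R.split_poly_esym[OF pR p0 strict(1) hd] by blast
  have lxs: "length xs = n" using xs(1) strict(1) len by (metis diff_Suc_1 size_mset)
  \<comment> \<open>Strictness enters here: no root is counted more than once.\<close>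
  have "distinct xs"
  proof -
    have "count (mset xs) a = (if a \<in> set xs then 1 else 0)" for a
      using strict(2)[of a] xs(1) by (auto simp: count_eq_zero_iff le_Suc_eq simp flip: set_mset_mset)
    then show ?thesis by (simp add: distinct_count_atmost_1)
  qed
  \<comment> \<open>Beyond index \<open>n\<close> both sides are zero, so the identity needed for
    the power sums holds for every \<open>j\<close>.\<close>
  have co: "\<phi> (rev_coeff f j) = R.esym xs j" for j
  proof (cases "j \<le> n")
    case True
    then show ?thesis using nth xs(3) len by (metis le_imp_less_Suc)
  next
    case False
    then show ?thesis using R.esym_above[OF xs(2)] lxs by (simp add: rev_coeff_def n_def hom)
  qed
  have ps: "\<phi> (power_sum f m) = R.psum xs m" for m
    using R.class_hom_power_sum[OF \<phi> xs(2) _ co] lxs by (simp add: n_def)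
  define y where "y x = (\<Oplus>\<^bsub>R\<^esub>i\<in>{..<n}. \<phi> (u i) \<otimes>\<^bsub>R\<^esub> x [^]\<^bsub>R\<^esub> i)" for x
  have "\<phi> Q = (\<Oplus>\<^bsub>R\<^esub>i\<in>{..<n}. \<Oplus>\<^bsub>R\<^esub>j\<in>{..<n}. R.psum xs (i + j) \<otimes>\<^bsub>R\<^esub> (\<phi> (u i) \<otimes>\<^bsub>R\<^esub> \<phi> (u j)))"
    unfolding Q_def by (simp add: R.class_hom_sum[OF \<phi>] hom ps)
  also have "\<dots> = foldr (\<lambda>y s. y \<otimes>\<^bsub>R\<^esub> y \<oplus>\<^bsub>R\<^esub> s) (map y xs) \<zero>\<^bsub>R\<^esub>"
    unfolding y_def by (rule R.trace_form[OF hom(1) xs(2)])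
  finally have Q: "\<phi> Q = foldr (\<lambda>y s. y \<otimes>\<^bsub>R\<^esub> y \<oplus>\<^bsub>R\<^esub> s) (map y xs) \<zero>\<^bsub>R\<^esub>" .
  obtain b where b: "b \<in> carrier R" "\<phi> (- Q) = b \<otimes>\<^bsub>R\<^esub> b" using sq[OF neg] by blast
  \<comment> \<open>The square \<open>b * b\<close> representing the image of \<open>- Q\<close> is
    put in front of the squares for \<open>Q\<close>, so that the total is zero.\<close>
  have sum0: "foldr (\<lambda>y s. y \<otimes>\<^bsub>R\<^esub> y \<oplus>\<^bsub>R\<^esub> s) (b # map y xs) \<zero>\<^bsub>R\<^esub> = \<zero>\<^bsub>R\<^esub>"
  proof -
    have "foldr (\<lambda>y s. y \<otimes>\<^bsub>R\<^esub> y \<oplus>\<^bsub>R\<^esub> s) (b # map y xs) \<zero>\<^bsub>R\<^esub> = \<phi> (- Q) \<oplus>\<^bsub>R\<^esub> \<phi> Q"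
      by (simp only: foldr.simps comp_def Q b(2))
    then show ?thesis using hom(1)[of Q] by (simp only: hom(6) R.l_neg)
  qed
  have yc: "y x \<in> carrier R" if "x \<in> set xs" for x
    unfolding y_def using that xs(2) by (intro R.finsum_closed) (auto simp: hom(1))
  have real: "foldr (\<lambda>x s. x \<otimes>\<^bsub>R\<^esub> x \<oplus>\<^bsub>R\<^esub> s) zs \<zero>\<^bsub>R\<^esub> \<noteq> \<ominus>\<^bsub>R\<^esub> \<one>\<^bsub>R\<^esub>" if "set zs \<subseteq> carrier R" for zs
    using R that by (simp add: real_closed_field_def)
  have "y x = \<zero>\<^bsub>R\<^esub>" if "x \<in> set xs" for x
    by (rule R.sum_squares_eq_zero[OF real _ sum0]) (use b(1) yc that in auto)
  then have "\<forall>i<n. \<phi> (u i) = \<zero>\<^bsub>R\<^esub>"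
    using R.poly_vanishing_at_distinct[of n "\<lambda>i. \<phi> (u i)" xs] hom(1) \<open>distinct xs\<close> lxs xs(2)
    unfolding y_def by blast
  then show False using u ker by (auto simp: n_def)
qed

theorem theorem4p1:
  fixes f :: "'a::comm_ring_1 poly" and n :: nat
  assumes "strict_real_zero_poly f"
    and "Polynomial.degree f = n"
  shows "\<exists>r (M :: 'a mat).
           (pythagoras_number TYPE('a) \<noteq> \<infinity> \<longrightarrow>
              r \<le> (2 * the_enat (pythagoras_number TYPE('a)) + 1) * n) \<and>
           M \<in> carrier_mat r r \<and> transpose_mat M = M \<and>
           f dvd char_poly M"
  using symmetric_matrix_if_pos_def[of f n] strict_real_zero_poly_pos_def[of f] assms
  by (simp add: strict_real_zero_poly_def)

end
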